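(* Let $(M,J,g)$ be a connected compact LCK manifold with corresponding Lee form $\theta$, and for $(\varepsilon,\rho)\in\mathbb{R}^2$ let $\nabla^{\varepsilon,\rho}$ be the metric connection on $M$ defined by $$g(\nabla^{\varepsilon,\rho}_XY,Z)=g(\nabla^g_XY,Z)-\varepsilon\,d\omega(JX,JY,JZ)-\rho\,d\omega(JX,Y,Z).$$ If $\nabla^{\varepsilon,\rho}\theta=0$ for some $(\varepsilon,\rho)\in\mathbb{R}^2$ then either: (a) $\theta=0$, i.e. $(M,J,g)$ is Kähler (and therefore $\nabla^{\varepsilon,\rho}=\nabla^g$ for all $(\varepsilon,\rho)$), or (b) $(M,J,g)$ is Vaisman and $\rho=0$.
   Context: All manifolds have real dimension $\ge 4$. A Hermitian manifold $(M,J,g)$ with fundamental $2$-form $\omega(X,Y)=g(JX,Y)$ and Levi-Civita connection $\nabla^g$ is locally conformally Kähler (LCK) if there is a closed $1$-form $\theta$ (the Lee form; it is unique, and $\theta=0$ is allowed, which is the Kähler case) with $d\omega=\theta\wedge\omega$; it is Vaisman if moreover $\nabla^g\theta=0$. *)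

theory Defs
  imports "HOL-Analysis.Analysis"
begin

section \<open>Smooth manifolds\<close>

text \<open>Only meant for open \<open>S\<close>, where it depends on the values of \<open>f\<close> on \<open>S\<close> alone.\<close>

primrec Ck_on :: "nat \<Rightarrow> 'e::euclidean_space set \<Rightarrow> ('e \<Rightarrow> 'f::real_normed_vector) \<Rightarrow> bool" where
  "Ck_on 0 S f \<longleftrightarrow> continuous_on S f"
| "Ck_on (Suc k) S f \<longleftrightarrow>
     (\<forall>x\<in>S. f differentiable (at x)) \<and>
     (\<forall>v. Ck_on k S (\<lambda>x. frechet_derivative f (at x) v))"

definition smooth_on :: "'e::euclidean_space set \<Rightarrow> ('e \<Rightarrow> 'f::real_normed_vector) \<Rightarrow> bool" where
  "smooth_on S f \<longleftrightarrow> (\<forall>k. Ck_on k S f)"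

text \<open>A manifold is a whole type \<open>'a\<close> (Hausdorff and second countable by its type class)
  together with an atlas modelled on the Euclidean space \<open>'e\<close>; a chart is the pair of its
  domain and its coordinate map. The atlas need not be maximal: smooth functions with respect
  to an atlas and with respect to the maximal atlas containing it agree.\<close>

type_synonym ('a, 'e) chart = "'a set \<times> ('a \<Rightarrow> 'e)"

definition is_chart :: "('a::topological_space, 'e::euclidean_space) chart \<Rightarrow> bool" where
  "is_chart c \<longleftrightarrow> (case c of (U, \<phi>) \<Rightarrow>
     open U \<and> open (\<phi> ` U) \<and> homeomorphism U (\<phi> ` U) \<phi> (inv_into U \<phi>))"

definition smooth_manifold ::
    "('a::{t2_space,second_countable_topology}, 'e::euclidean_space) chart set \<Rightarrow> bool" where
  "smooth_manifold A \<longleftrightarrow>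
     (\<forall>c\<in>A. is_chart c) \<and>
     (\<Union>(fst ` A)) = UNIV \<and>
     (\<forall>(U, \<phi>)\<in>A. \<forall>(V, \<psi>)\<in>A. smooth_on (\<phi> ` (U \<inter> V)) (\<psi> \<circ> inv_into U \<phi>))"

definition smooth_fun :: "('a, 'e::euclidean_space) chart set \<Rightarrow> ('a \<Rightarrow> real) \<Rightarrow> bool" where
  "smooth_fun A f \<longleftrightarrow> (\<forall>(U, \<phi>)\<in>A. smooth_on (\<phi> ` U) (f \<circ> inv_into U \<phi>))"

section \<open>Tangent vectors and vector fields\<close>

text \<open>Tangent vectors at \<open>p\<close> are derivations at \<open>p\<close> of the algebra of smooth functions.
  They are set to \<open>0\<close> on non-smooth functions, so that equality of tangent vectors is equality
  of functions.\<close>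

type_synonym 'a tvec = "('a \<Rightarrow> real) \<Rightarrow> real"
type_synonym 'a vfield = "'a \<Rightarrow> 'a tvec"

definition tangent_space :: "('a, 'e::euclidean_space) chart set \<Rightarrow> 'a \<Rightarrow> 'a tvec set" where
  "tangent_space A p = {v.
     (\<forall>f. \<not> smooth_fun A f \<longrightarrow> v f = 0) \<and>
     (\<forall>f h a b. smooth_fun A f \<longrightarrow> smooth_fun A h \<longrightarrow>
        v (\<lambda>q. a * f q + b * h q) = a * v f + b * v h) \<and>
     (\<forall>f h. smooth_fun A f \<longrightarrow> smooth_fun A h \<longrightarrow>
        v (\<lambda>q. f q * h q) = f p * v h + h p * v f)}"

definition zero_tvec :: "'a tvec" where
  "zero_tvec = (\<lambda>f. 0)"

definition lincomb :: "real \<Rightarrow> 'a tvec \<Rightarrow> real \<Rightarrow> 'a tvec \<Rightarrow> 'a tvec" where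
  "lincomb a v b w = (\<lambda>f. a * v f + b * w f)"

definition vector_field :: "('a, 'e::euclidean_space) chart set \<Rightarrow> 'a vfield \<Rightarrow> bool" where
  "vector_field A X \<longleftrightarrow>
     (\<forall>p. X p \<in> tangent_space A p) \<and>
     (\<forall>f. smooth_fun A f \<longrightarrow> smooth_fun A (\<lambda>p. X p f))"

definition lie_bracket :: "'a vfield \<Rightarrow> 'a vfield \<Rightarrow> 'a vfield" where
  "lie_bracket X Y = (\<lambda>p f. X p (\<lambda>q. Y q f) - Y p (\<lambda>q. X q f))"

section \<open>Tensor fields\<close>

text \<open>Tensor fields are given pointwise on tangent vectors, with arbitrary values off the tangent
  spaces; they are smooth if they send smooth vector fields to smooth functions (fields).\<close>

type_synonym 'a form1 = "'a \<Rightarrow> 'a tvec \<Rightarrow> real"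
type_synonym 'a form2 = "'a \<Rightarrow> 'a tvec \<Rightarrow> 'a tvec \<Rightarrow> real"
type_synonym 'a endo = "'a \<Rightarrow> 'a tvec \<Rightarrow> 'a tvec"

definition one_form :: "('a, 'e::euclidean_space) chart set \<Rightarrow> 'a form1 \<Rightarrow> bool" where
  "one_form A \<theta> \<longleftrightarrow>
     (\<forall>p. \<forall>v\<in>tangent_space A p. \<forall>w\<in>tangent_space A p. \<forall>a b.
        \<theta> p (lincomb a v b w) = a * \<theta> p v + b * \<theta> p w) \<and>
     (\<forall>X. vector_field A X \<longrightarrow> smooth_fun A (\<lambda>p. \<theta> p (X p)))"

definition riemannian_metric :: "('a, 'e::euclidean_space) chart set \<Rightarrow> 'a form2 \<Rightarrow> bool" where
  "riemannian_metric A g \<longleftrightarrow>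
     (\<forall>p. \<forall>u\<in>tangent_space A p. \<forall>v\<in>tangent_space A p. \<forall>w\<in>tangent_space A p. \<forall>a b.
        g p (lincomb a u b v) w = a * g p u w + b * g p v w) \<and>
     (\<forall>p. \<forall>v\<in>tangent_space A p. \<forall>w\<in>tangent_space A p. g p v w = g p w v) \<and>
     (\<forall>p. \<forall>v\<in>tangent_space A p. v \<noteq> zero_tvec \<longrightarrow> g p v v > 0) \<and>
     (\<forall>X Y. vector_field A X \<longrightarrow> vector_field A Y \<longrightarrow> smooth_fun A (\<lambda>p. g p (X p) (Y p)))"

definition app :: "'a endo \<Rightarrow> 'a vfield \<Rightarrow> 'a vfield" where
  "app J X = (\<lambda>p. J p (X p))"

definition almost_complex_structure :: "('a, 'e::euclidean_space) chart set \<Rightarrow> 'a endo \<Rightarrow> bool" where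
  "almost_complex_structure A J \<longleftrightarrow>
     (\<forall>p. \<forall>v\<in>tangent_space A p. J p v \<in> tangent_space A p) \<and>
     (\<forall>p. \<forall>v\<in>tangent_space A p. \<forall>w\<in>tangent_space A p. \<forall>a b.
        J p (lincomb a v b w) = lincomb a (J p v) b (J p w)) \<and>
     (\<forall>p. \<forall>v\<in>tangent_space A p. J p (J p v) = (\<lambda>f. - v f)) \<and>
     (\<forall>X. vector_field A X \<longrightarrow> vector_field A (app J X))"

definition nijenhuis :: "'a endo \<Rightarrow> 'a vfield \<Rightarrow> 'a vfield \<Rightarrow> 'a vfield" where
  "nijenhuis J X Y = (\<lambda>p f.
     lie_bracket (app J X) (app J Y) p f
     - app J (lie_bracket (app J X) Y) p f
     - app J (lie_bracket X (app J Y)) p f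
     - lie_bracket X Y p f)"

text \<open>Integrability is expressed by the vanishing of the Nijenhuis tensor.\<close>

definition complex_structure :: "('a, 'e::euclidean_space) chart set \<Rightarrow> 'a endo \<Rightarrow> bool" where
  "complex_structure A J \<longleftrightarrow>
     almost_complex_structure A J \<and>
     (\<forall>X Y. vector_field A X \<longrightarrow> vector_field A Y \<longrightarrow> (\<forall>p. nijenhuis J X Y p = zero_tvec))"

definition hermitian_manifold ::
    "('a::{t2_space,second_countable_topology}, 'e::euclidean_space) chart set
      \<Rightarrow> 'a endo \<Rightarrow> 'a form2 \<Rightarrow> bool" where
  "hermitian_manifold A J g \<longleftrightarrow>
     smooth_manifold A \<and> complex_structure A J \<and> riemannian_metric A g \<and>
     (\<forall>p. \<forall>v\<in>tangent_space A p. \<forall>w\<in>tangent_space A p. g p (J p v) (J p w) = g p v w)"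

definition fundamental_form :: "'a endo \<Rightarrow> 'a form2 \<Rightarrow> 'a form2" where
  "fundamental_form J g = (\<lambda>p v w. g p (J p v) w)"

section \<open>Exterior derivative and wedge product\<close>

text \<open>Exterior derivatives are given by the invariant formula on vector fields. The formulas for
  \<open>d\<close> and for the wedge product both use the convention without factorial factors, that is,
  \<open>dx\<^sub>1 \<and> \<dots> \<and> dx\<^sub>k\<close> takes the value \<open>1\<close> on the first \<open>k\<close> coordinate fields.\<close>

definition ext_d1 :: "'a form1 \<Rightarrow> 'a vfield \<Rightarrow> 'a vfield \<Rightarrow> 'a \<Rightarrow> real" where
  "ext_d1 \<theta> X Y = (\<lambda>p.
     X p (\<lambda>q. \<theta> q (Y q)) - Y p (\<lambda>q. \<theta> q (X q)) - \<theta> p (lie_bracket X Y p))"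

definition ext_d2 :: "'a form2 \<Rightarrow> 'a vfield \<Rightarrow> 'a vfield \<Rightarrow> 'a vfield \<Rightarrow> 'a \<Rightarrow> real" where
  "ext_d2 \<omega> X Y Z = (\<lambda>p.
     X p (\<lambda>q. \<omega> q (Y q) (Z q)) - Y p (\<lambda>q. \<omega> q (X q) (Z q)) + Z p (\<lambda>q. \<omega> q (X q) (Y q))
     - \<omega> p (lie_bracket X Y p) (Z p) + \<omega> p (lie_bracket X Z p) (Y p)
     - \<omega> p (lie_bracket Y Z p) (X p))"

definition wedge12 :: "'a form1 \<Rightarrow> 'a form2 \<Rightarrow> 'a \<Rightarrow> 'a tvec \<Rightarrow> 'a tvec \<Rightarrow> 'a tvec \<Rightarrow> real" where
  "wedge12 \<theta> \<omega> p u v w = \<theta> p u * \<omega> p v w - \<theta> p v * \<omega> p u w + \<theta> p w * \<omega> p u v"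

definition closed_form1 :: "('a, 'e::euclidean_space) chart set \<Rightarrow> 'a form1 \<Rightarrow> bool" where
  "closed_form1 A \<theta> \<longleftrightarrow>
     (\<forall>X Y. vector_field A X \<longrightarrow> vector_field A Y \<longrightarrow> (\<forall>p. ext_d1 \<theta> X Y p = 0))"

section \<open>Connections\<close>

type_synonym 'a conn = "'a vfield \<Rightarrow> 'a vfield \<Rightarrow> 'a vfield"

definition affine_connection :: "('a, 'e::euclidean_space) chart set \<Rightarrow> 'a conn \<Rightarrow> bool" where
  "affine_connection A D \<longleftrightarrow>
     (\<forall>X Y. vector_field A X \<longrightarrow> vector_field A Y \<longrightarrow> vector_field A (D X Y)) \<and>
     (\<forall>X X' Y f h. vector_field A X \<longrightarrow> vector_field A X' \<longrightarrow> vector_field A Y \<longrightarrow>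
        smooth_fun A f \<longrightarrow> smooth_fun A h \<longrightarrow>
        D (\<lambda>p. lincomb (f p) (X p) (h p) (X' p)) Y
          = (\<lambda>p. lincomb (f p) (D X Y p) (h p) (D X' Y p))) \<and>
     (\<forall>X Y Y'. vector_field A X \<longrightarrow> vector_field A Y \<longrightarrow> vector_field A Y' \<longrightarrow>
        D X (\<lambda>p. lincomb 1 (Y p) 1 (Y' p)) = (\<lambda>p. lincomb 1 (D X Y p) 1 (D X Y' p))) \<and>
     (\<forall>X Y f. vector_field A X \<longrightarrow> vector_field A Y \<longrightarrow> smooth_fun A f \<longrightarrow>
        D X (\<lambda>p. lincomb (f p) (Y p) 0 zero_tvec)
          = (\<lambda>p. lincomb (X p f) (Y p) (f p) (D X Y p)))"

definition levi_civita :: "('a, 'e::euclidean_space) chart set \<Rightarrow> 'a form2 \<Rightarrow> 'a conn \<Rightarrow> bool" where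
  "levi_civita A g D \<longleftrightarrow>
     affine_connection A D \<and>
     (\<forall>X Y Z. vector_field A X \<longrightarrow> vector_field A Y \<longrightarrow> vector_field A Z \<longrightarrow>
        (\<forall>p. X p (\<lambda>q. g q (Y q) (Z q)) = g p (D X Y p) (Z p) + g p (Y p) (D X Z p))) \<and>
     (\<forall>X Y. vector_field A X \<longrightarrow> vector_field A Y \<longrightarrow>
        (\<forall>p. lincomb 1 (D X Y p) (- 1) (D Y X p) = lie_bracket X Y p))"

definition parallel_form1 ::
    "('a, 'e::euclidean_space) chart set \<Rightarrow> 'a conn \<Rightarrow> 'a form1 \<Rightarrow> bool" where
  "parallel_form1 A D \<theta> \<longleftrightarrow>
     (\<forall>X Y. vector_field A X \<longrightarrow> vector_field A Y \<longrightarrow>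
        (\<forall>p. X p (\<lambda>q. \<theta> q (Y q)) - \<theta> p (D X Y p) = 0))"

text \<open>The connection \<open>\<nabla>\<^sup>\<epsilon>\<^sup>,\<^sup>\<rho>\<close>, where \<open>D\<close> is the Levi-Civita connection of \<open>g\<close>; its value on vector
  fields \<open>X\<close>, \<open>Y\<close> is determined by its inner products with all vector fields \<open>Z\<close>.\<close>

definition eps_rho_connection ::
    "('a, 'e::euclidean_space) chart set \<Rightarrow> 'a endo \<Rightarrow> 'a form2 \<Rightarrow> 'a conn
      \<Rightarrow> real \<Rightarrow> real \<Rightarrow> 'a conn" where
  "eps_rho_connection A J g D \<epsilon> \<rho> X Y = (THE W. vector_field A W \<and>
     (\<forall>Z. vector_field A Z \<longrightarrow> (\<forall>p.
        g p (W p) (Z p) = g p (D X Y p) (Z p)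
          - \<epsilon> * ext_d2 (fundamental_form J g) (app J X) (app J Y) (app J Z) p
          - \<rho> * ext_d2 (fundamental_form J g) (app J X) Y Z p)))"

section \<open>Kaehler, locally conformally Kaehler and Vaisman manifolds\<close>

definition kahler_manifold ::
    "('a::{t2_space,second_countable_topology}, 'e::euclidean_space) chart set
      \<Rightarrow> 'a endo \<Rightarrow> 'a form2 \<Rightarrow> bool" where
  "kahler_manifold A J g \<longleftrightarrow> hermitian_manifold A J g \<and>
     (\<forall>X Y Z. vector_field A X \<longrightarrow> vector_field A Y \<longrightarrow> vector_field A Z \<longrightarrow>
        (\<forall>p. ext_d2 (fundamental_form J g) X Y Z p = 0))"

definition lee_form ::
    "('a, 'e::euclidean_space) chart set \<Rightarrow> 'a endo \<Rightarrow> 'a form2 \<Rightarrow> 'a form1 \<Rightarrow> bool" where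
  "lee_form A J g \<theta> \<longleftrightarrow> one_form A \<theta> \<and> closed_form1 A \<theta> \<and>
     (\<forall>X Y Z. vector_field A X \<longrightarrow> vector_field A Y \<longrightarrow> vector_field A Z \<longrightarrow>
        (\<forall>p. ext_d2 (fundamental_form J g) X Y Z p
              = wedge12 \<theta> (fundamental_form J g) p (X p) (Y p) (Z p)))"

definition lck_manifold ::
    "('a::{t2_space,second_countable_topology}, 'e::euclidean_space) chart set
      \<Rightarrow> 'a endo \<Rightarrow> 'a form2 \<Rightarrow> bool" where
  "lck_manifold A J g \<longleftrightarrow> hermitian_manifold A J g \<and> (\<exists>\<theta>. lee_form A J g \<theta>)"

definition vaisman_manifold ::
    "('a::{t2_space,second_countable_topology}, 'e::euclidean_space) chart set
      \<Rightarrow> 'a endo \<Rightarrow> 'a form2 \<Rightarrow> bool" where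
  "vaisman_manifold A J g \<longleftrightarrow> hermitian_manifold A J g \<and>
     (\<exists>\<theta> D. lee_form A J g \<theta> \<and> levi_civita A g D \<and> parallel_form1 A D \<theta>)"

end

theory Submission
  imports Defs
begin

text \<open>Let \<open>T\<close> be the vector field dual to \<open>\<theta>\<close>. Substituting \<open>d\<omega> = \<theta> \<and> \<omega>\<close> into the definition of
  \<open>\<nabla>\<^sup>\<epsilon>\<^sup>,\<^sup>\<rho>\<close>, the condition \<open>\<nabla>\<^sup>\<epsilon>\<^sup>,\<^sup>\<rho> \<theta> = 0\<close> becomes
  \<open>(\<nabla>\<^sub>X \<theta>)(Y) = \<rho> (\<bar>T\<bar>\<^sup>2 g(X, Y) - \<theta>(X) \<theta>(Y) - \<theta>(JX) \<theta>(JY))\<close>.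
  Hence \<open>\<bar>T\<bar>\<close> is constant, and taking traces gives \<open>div T = \<rho> (n - 2) \<bar>T\<bar>\<^sup>2\<close>, a constant. On a
  compact manifold the integral of a divergence vanishes, so \<open>\<rho> = 0\<close> or \<open>T = 0\<close>. Compactness
  is essential: for a Kaehler metric \<open>h\<close>, the metric \<open>dt\<^sup>2 + ds\<^sup>2 + e\<^sup>t h\<close> has \<open>\<theta> = dt\<close> and satisfies the
  condition with \<open>\<rho> = 1/2\<close>.

  Integration is only needed for the density \<open>\<surd>\<bar>det g\<^sub>i\<^sub>j\<bar>\<close> in charts, glued by a partition of unity.\<close>

section \<open>Smooth maps between Euclidean spaces\<close>

text \<open>In vector form the equation for \<open>\<theta>\<close> reads
  \<open>D_X T = \<rho> (|T|^2 X - \<theta>(X) T + \<theta>(JX) JT)\<close>. Applying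
  \<open>\<theta>\<close>, the first two terms cancel and \<open>\<theta>(JT) = 0\<close>, whence
  the constancy of \<open>|T|\<close>. The endomorphisms \<open>X\<close>,
  \<open>\<theta>(X) T\<close> and \<open>\<theta>(JX) JT\<close> have traces \<open>n\<close>,
  \<open>|T|^2\<close> and \<open>\<theta>(JJT) = - |T|^2\<close>, whence the factor
  \<open>n - 2\<close>, nonzero in dimension at least 4.

  The bulk of the work is the divergence theorem. Derivations act on global smooth functions and
  connections on global fields, so coordinates must be globalised by bump functions. Jacobi's
  formula turns the trace of \<open>D X\<close>, multiplied by the density, into a sum of partial
  derivatives.

  No measure on the manifold is constructed. The partition of unity enters twice: it cuts
  \<open>T\<close> into pieces supported in charts, and a second copy moves the resulting integrals
  into common charts, where the derivatives of its members add up to 0.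

  Determinants live on \<open>real^'n\<close>, the atlas on an arbitrary Euclidean space. Changing
  the model is harmless because it preserves the smooth functions, hence the derivations and
  everything built from them.\<close>

lemma frechet_derivative_cong_open:
  assumes "open S" "x \<in> S" "\<And>y. y \<in> S \<Longrightarrow> f y = g y"
  shows "frechet_derivative f (at x) = frechet_derivative g (at x)"
proof -
  have "(f has_derivative F) (at x) \<longleftrightarrow> (g has_derivative F) (at x)" for F
    using assms has_derivative_transform_within_open[of f F x UNIV S g]
      has_derivative_transform_within_open[of g F x UNIV S f] by auto
  then show ?thesis unfolding frechet_derivative_def by simp
qed

lemma Ck_on_cong:
  assumes "open S" "\<And>x. x \<in> S \<Longrightarrow> f x = g x" "Ck_on k S f"
  shows "Ck_on k S g"
  using assms(2,3)
proof (induction k arbitrary: f g)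
  case 0
  then show ?case by (simp cong: continuous_on_cong)
next
  case (Suc k)
  have "g differentiable (at x)" if "x \<in> S" for x
    using Suc.prems that assms(1) unfolding differentiable_def
    by (metis Ck_on.simps(2) differentiable_def has_derivative_transform_within_open)
  moreover have "Ck_on k S (\<lambda>x. frechet_derivative g (at x) v)" for v
  proof (rule Suc.IH)
    show "frechet_derivative f (at x) v = frechet_derivative g (at x) v" if "x \<in> S" for x
      using frechet_derivative_cong_open[OF assms(1) that Suc.prems(1)] by simp
    show "Ck_on k S (\<lambda>x. frechet_derivative f (at x) v)"
      using Suc.prems(2) by simp
  qed
  ultimately show ?case by simp
qed

lemma Ck_on_subset: "Ck_on k S f \<Longrightarrow> T \<subseteq> S \<Longrightarrow> Ck_on k T f"
  by (induction k arbitrary: f) (auto intro: continuous_on_subset)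

text \<open>Continuity and differentiability are conditions at single points, and directional
  derivatives inherit the local hypothesis. This is what lets smoothness on a manifold be checked
  near each point.\<close>

lemma Ck_on_local:
  assumes "\<And>x. x \<in> S \<Longrightarrow> \<exists>V. open V \<and> x \<in> V \<and> Ck_on k V f"
  shows "Ck_on k S f"
  using assms
proof (induction k arbitrary: f)
  case 0
  have "continuous (at x within S) f" if x: "x \<in> S" for x
  proof -
    obtain V where "open V" "x \<in> V" "Ck_on 0 V f" using 0[OF x] by blast
    then show ?thesis
      by (simp add: continuous_on_eq_continuous_at continuous_at_imp_continuous_at_within)
  qed
  then show ?case by (simp add: continuous_on_eq_continuous_within)
next
  case (Suc k)
  show ?case
    unfolding Ck_on.simps
  proof (intro conjI ballI allI)
    show "f differentiable (at x)" if "x \<in> S" for x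
      using Suc.prems[OF that] by auto
    show "Ck_on k S (\<lambda>x. frechet_derivative f (at x) v)" for v
      using Suc.prems by (intro Suc.IH) (metis Ck_on.simps(2))
  qed
qed

lemma Ck_on_continuous: "Ck_on k S f \<Longrightarrow> continuous_on S f"
  by (cases k) (auto intro!: differentiable_imp_continuous_on simp: differentiable_on_def differentiable_at_withinI)

lemma Ck_on_SucD: "Ck_on (Suc k) S f \<Longrightarrow> Ck_on k S f"
proof (induction k arbitrary: f)
  case 0
  then show ?case by (metis Ck_on.simps(1) Ck_on_continuous)
next
  case (Suc k)
  then show ?case by (metis Ck_on.simps(2))
qed

lemma Ck_on_const: "Ck_on k S (\<lambda>x. c)"
  by (induction k arbitrary: c) auto

lemma frechet_derivative_eq: "(f has_derivative F) (at x) \<Longrightarrow> frechet_derivative f (at x) = F"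
  using frechet_derivative_at by fastforce

lemma differentiable_has_frechet_derivative:
  "f differentiable (at x) \<Longrightarrow> (f has_derivative frechet_derivative f (at x)) (at x)"
  by (simp add: frechet_derivative_works)

text \<open>\<open>frechet_derivative\<close> is a choice operator; on an open set it may be
  exchanged for an explicit family \<open>F\<close>, so the inductions below can work with the usual
  differentiation rules.\<close>

lemma Ck_on_SucI:
  assumes "open S" "\<And>x. x \<in> S \<Longrightarrow> (f has_derivative F x) (at x)"
    "\<And>v. Ck_on k S (\<lambda>x. F x v)"
  shows "Ck_on (Suc k) S f"
  unfolding Ck_on.simps
proof (intro conjI ballI allI)
  show "f differentiable (at x)" if "x \<in> S" for x
    using assms(2)[OF that] differentiable_def by blast
  show "Ck_on k S (\<lambda>x. frechet_derivative f (at x) v)" for v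
    by (rule Ck_on_cong[OF assms(1) _ assms(3)[of v]])
       (metis assms(2) frechet_derivative_eq)
qed

lemma Ck_on_SucE:
  assumes "Ck_on (Suc k) S f" "x \<in> S"
  shows "(f has_derivative frechet_derivative f (at x)) (at x)"
  using assms by (simp add: differentiable_has_frechet_derivative)

lemma Ck_on_bounded_linear:
  assumes "bounded_linear L" "open S"
  shows "Ck_on k S f \<Longrightarrow> Ck_on k S (\<lambda>x. L (f x))"
proof (induction k arbitrary: f)
  case 0
  then show ?case using assms(1) by (simp add: bounded_linear.continuous_on)
next
  case (Suc k)
  show ?case
  proof (rule Ck_on_SucI[OF assms(2), where F="\<lambda>x v. L (frechet_derivative f (at x) v)"])
    show "((\<lambda>x. L (f x)) has_derivative (\<lambda>v. L (frechet_derivative f (at x) v))) (at x)"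
      if "x \<in> S" for x
      by (rule bounded_linear.has_derivative[OF assms(1) Ck_on_SucE[OF Suc.prems that]])
    show "Ck_on k S (\<lambda>x. L (frechet_derivative f (at x) v))" for v
      using Suc.prems by (intro Suc.IH) simp
  qed
qed

lemma Ck_on_id: "open S \<Longrightarrow> Ck_on k S (\<lambda>x. x)"
proof (cases k)
  case (Suc j)
  assume "open S"
  then show ?thesis unfolding Suc
    by (intro Ck_on_SucI[where F="\<lambda>x v. v"]) (auto intro: has_derivative_ident Ck_on_const)
qed simp

lemma Ck_on_linear: "bounded_linear L \<Longrightarrow> open S \<Longrightarrow> Ck_on k S L"
  using Ck_on_bounded_linear[OF _ _ Ck_on_id] by auto

lemma Ck_on_add:
  assumes "open S"
  shows "Ck_on k S f \<Longrightarrow> Ck_on k S g \<Longrightarrow> Ck_on k S (\<lambda>x. f x + g x)"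
proof (induction k arbitrary: f g)
  case (Suc k)
  show ?case
  proof (rule Ck_on_SucI[OF assms, where
        F="\<lambda>x v. frechet_derivative f (at x) v + frechet_derivative g (at x) v"])
    show "((\<lambda>x. f x + g x) has_derivative
        (\<lambda>v. frechet_derivative f (at x) v + frechet_derivative g (at x) v)) (at x)"
      if "x \<in> S" for x
      by (rule has_derivative_add[OF Suc.prems[THEN Ck_on_SucE, OF that]])
    show "Ck_on k S (\<lambda>x. frechet_derivative f (at x) v + frechet_derivative g (at x) v)" for v
      using Suc.prems by (intro Suc.IH) simp_all
  qed
qed (simp add: continuous_on_add)

lemma Ck_on_bilinear:
  assumes B: "bounded_bilinear B" and "open S"
  shows "Ck_on k S f \<Longrightarrow> Ck_on k S g \<Longrightarrow> Ck_on k S (\<lambda>x. B (f x) (g x))"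
proof (induction k arbitrary: f g)
  case 0
  then show ?case using B by (simp add: bounded_bilinear.continuous_on)
next
  case (Suc k)
  have f: "Ck_on k S f" and g: "Ck_on k S g" using Suc.prems Ck_on_SucD by blast+
  show ?case
  proof (rule Ck_on_SucI[OF assms(2), where
        F="\<lambda>x v. B (f x) (frechet_derivative g (at x) v) + B (frechet_derivative f (at x) v) (g x)"])
    show "((\<lambda>x. B (f x) (g x)) has_derivative
        (\<lambda>v. B (f x) (frechet_derivative g (at x) v) + B (frechet_derivative f (at x) v) (g x))) (at x)"
      if "x \<in> S" for x
      by (rule bounded_bilinear.FDERIV[OF B Suc.prems[THEN Ck_on_SucE, OF that]])
    show "Ck_on k S (\<lambda>x. B (f x) (frechet_derivative g (at x) v) + B (frechet_derivative f (at x) v) (g x))" for v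
      using Suc.prems by (intro Ck_on_add[OF assms(2)] Suc.IH[OF f] Suc.IH[OF _ g]) simp_all
  qed
qed

lemmas Ck_on_mult = Ck_on_bilinear[OF bounded_bilinear_mult]
lemmas Ck_on_scaleR = Ck_on_bilinear[OF bounded_bilinear_scaleR]

lemma Ck_on_sum:
  "open S \<Longrightarrow> (\<And>i. i \<in> I \<Longrightarrow> Ck_on k S (f i)) \<Longrightarrow> Ck_on k S (\<lambda>x. \<Sum>i\<in>I. f i x)"
  by (induction I rule: infinite_finite_induct) (auto intro: Ck_on_const Ck_on_add)

lemma Ck_on_prod:
  fixes f :: "_ \<Rightarrow> _ \<Rightarrow> real"
  shows "open S \<Longrightarrow> (\<And>i. i \<in> I \<Longrightarrow> Ck_on k S (f i)) \<Longrightarrow> Ck_on k S (\<lambda>x. \<Prod>i\<in>I. f i x)"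
  by (induction I rule: infinite_finite_induct) (auto intro: Ck_on_const Ck_on_mult)

text \<open>The derivative of \<open>inverse f\<close> contains \<open>inverse f\<close> itself, but
  only to order \<open>k\<close>, and to that order the induction hypothesis supplies it.\<close>

lemma Ck_on_inverse:
  fixes f :: "_ \<Rightarrow> real"
  assumes "open S" "\<And>x. x \<in> S \<Longrightarrow> f x \<noteq> 0"
  shows "Ck_on k S f \<Longrightarrow> Ck_on k S (\<lambda>x. inverse (f x))"
proof (induction k)
  case 0
  then show ?case using assms by (auto intro!: continuous_on_inverse)
next
  case (Suc k)
  have i: "Ck_on k S (\<lambda>x. inverse (f x))" using Suc Ck_on_SucD by blast
  show ?case
  proof (rule Ck_on_SucI[OF assms(1), where
        F="\<lambda>x v. (-1) * (inverse (f x) * frechet_derivative f (at x) v * inverse (f x))"])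
    show "((\<lambda>x. inverse (f x)) has_derivative
        (\<lambda>v. (-1) * (inverse (f x) * frechet_derivative f (at x) v * inverse (f x)))) (at x)"
      if "x \<in> S" for x
      using Deriv.has_derivative_inverse[OF assms(2)[OF that] Ck_on_SucE[OF Suc.prems that]]
      by simp
    show "Ck_on k S (\<lambda>x. (-1) * (inverse (f x) * frechet_derivative f (at x) v * inverse (f x)))" for v
      using Suc.prems
      by (intro Ck_on_mult[OF assms(1) Ck_on_const Ck_on_mult[OF assms(1) Ck_on_mult[OF assms(1) i] i]]) simp
  qed
qed

lemma linear_Basis_expand:
  fixes f :: "'e::euclidean_space \<Rightarrow> 'f::real_normed_vector"
  assumes "linear f"
  shows "f x = (\<Sum>b\<in>Basis. (x \<bullet> b) *\<^sub>R f b)"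
  by (metis (no_types, lifting) assms euclidean_representation linear_scale linear_sum sum.cong)

lemma Ck_on_compose:
  fixes h :: "'e::euclidean_space \<Rightarrow> 'd::euclidean_space" and f :: "'d \<Rightarrow> 'f::real_normed_vector"
  assumes S: "open S" and hS: "h ` S \<subseteq> V"
  shows "Ck_on k S h \<Longrightarrow> Ck_on k V f \<Longrightarrow> Ck_on k S (\<lambda>x. f (h x))"
proof (induction k arbitrary: f)
  case 0
  then show ?case using hS by (auto intro: continuous_on_compose2)
next
  case (Suc k)
  have h: "Ck_on k S h" using Suc.prems Ck_on_SucD by blast
  have dh: "(h has_derivative frechet_derivative h (at x)) (at x)" if "x \<in> S" for x
    using Suc.prems(1) that by (rule Ck_on_SucE)
  have df: "(f has_derivative frechet_derivative f (at y)) (at y)" if "y \<in> V" for y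
    using Suc.prems(2) that by (rule Ck_on_SucE)
  show ?case
  \<comment> \<open>\<open>Ck_on\<close> differentiates in fixed directions, whereas the chain rule
    produces the direction \<open>h'(x) v\<close>, which moves with \<open>x\<close>. Expanding it
    in \<open>Basis\<close> leaves products of functions of class \<open>k\<close>.\<close>
  proof (rule Ck_on_SucI[OF S, where F="\<lambda>x v. \<Sum>b\<in>Basis.
        (frechet_derivative h (at x) v \<bullet> b) *\<^sub>R frechet_derivative f (at (h x)) b"])
    show "((\<lambda>x. f (h x)) has_derivative (\<lambda>v. \<Sum>b\<in>Basis.
        (frechet_derivative h (at x) v \<bullet> b) *\<^sub>R frechet_derivative f (at (h x)) b)) (at x)"
      if x: "x \<in> S" for x
    proof -
      have y: "h x \<in> V" using x hS by blast
      have lin: "frechet_derivative f (at (h x)) u = (\<Sum>b\<in>Basis. (u \<bullet> b) *\<^sub>R frechet_derivative f (at (h x)) b)" for u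
        using df[OF y] linear_Basis_expand has_derivative_linear by blast
      show ?thesis
        by (rule has_derivative_eq_rhs[OF has_derivative_compose[OF dh[OF x] df[OF y]]])
          (rule ext, rule lin)
    qed
    show "Ck_on k S (\<lambda>x. \<Sum>b\<in>Basis.
        (frechet_derivative h (at x) v \<bullet> b) *\<^sub>R frechet_derivative f (at (h x)) b)" for v
    proof (rule Ck_on_sum[OF S], rule Ck_on_scaleR[OF S])
      show "Ck_on k S (\<lambda>x. frechet_derivative h (at x) v \<bullet> b)" for b
        using Suc.prems(1)
        by (intro Ck_on_bounded_linear[OF bounded_linear_inner_left S]) simp
      show "Ck_on k S (\<lambda>x. frechet_derivative f (at (h x)) b)" for b
        using Suc.prems(2) by (intro Suc.IH[OF h]) simp
    qed
  qed
qed

lemma smooth_on_cong: "open S \<Longrightarrow> (\<And>x. x \<in> S \<Longrightarrow> f x = g x) \<Longrightarrow> smooth_on S f \<Longrightarrow> smooth_on S g"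
  unfolding smooth_on_def by (metis Ck_on_cong)

lemma smooth_on_subset: "smooth_on S f \<Longrightarrow> T \<subseteq> S \<Longrightarrow> smooth_on T f"
  unfolding smooth_on_def by (metis Ck_on_subset)

lemma smooth_on_local:
  assumes "\<And>x. x \<in> S \<Longrightarrow> \<exists>V. open V \<and> x \<in> V \<and> smooth_on V f"
  shows "smooth_on S f"
  unfolding smooth_on_def using assms
  by (intro allI Ck_on_local) (metis smooth_on_def)

lemma smooth_on_continuous: "smooth_on S f \<Longrightarrow> continuous_on S f"
  unfolding smooth_on_def using Ck_on_continuous by blast

lemma smooth_on_has_derivative:
  "smooth_on S f \<Longrightarrow> x \<in> S \<Longrightarrow> (f has_derivative frechet_derivative f (at x)) (at x)"
  unfolding smooth_on_def using Ck_on_SucE by blast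

lemma smooth_on_frechet_derivative:
  "smooth_on S f \<Longrightarrow> smooth_on S (\<lambda>x. frechet_derivative f (at x) v)"
  unfolding smooth_on_def by (metis Ck_on.simps(2))

lemma smooth_on_const: "smooth_on S (\<lambda>x. c)"
  unfolding smooth_on_def by (simp add: Ck_on_const)

lemma smooth_on_linear: "bounded_linear L \<Longrightarrow> open S \<Longrightarrow> smooth_on S L"
  unfolding smooth_on_def by (simp add: Ck_on_linear)

lemma smooth_on_bounded_linear:
  "bounded_linear L \<Longrightarrow> open S \<Longrightarrow> smooth_on S f \<Longrightarrow> smooth_on S (\<lambda>x. L (f x))"
  unfolding smooth_on_def by (simp add: Ck_on_bounded_linear)

lemma smooth_on_add: "open S \<Longrightarrow> smooth_on S f \<Longrightarrow> smooth_on S g \<Longrightarrow> smooth_on S (\<lambda>x. f x + g x)"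
  unfolding smooth_on_def by (simp add: Ck_on_add)

lemma smooth_on_mult:
  fixes f g :: "_ \<Rightarrow> real"
  shows "open S \<Longrightarrow> smooth_on S f \<Longrightarrow> smooth_on S g \<Longrightarrow> smooth_on S (\<lambda>x. f x * g x)"
  unfolding smooth_on_def by (simp add: Ck_on_mult)

lemma smooth_on_scaleR:
  "open S \<Longrightarrow> smooth_on S f \<Longrightarrow> smooth_on S g \<Longrightarrow> smooth_on S (\<lambda>x. f x *\<^sub>R g x)"
  unfolding smooth_on_def by (simp add: Ck_on_scaleR)

lemma smooth_on_sum:
  "open S \<Longrightarrow> (\<And>i. i \<in> I \<Longrightarrow> smooth_on S (f i)) \<Longrightarrow> smooth_on S (\<lambda>x. \<Sum>i\<in>I. f i x)"
  unfolding smooth_on_def by (simp add: Ck_on_sum)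

lemma smooth_on_prod:
  fixes f :: "_ \<Rightarrow> _ \<Rightarrow> real"
  shows "open S \<Longrightarrow> (\<And>i. i \<in> I \<Longrightarrow> smooth_on S (f i)) \<Longrightarrow> smooth_on S (\<lambda>x. \<Prod>i\<in>I. f i x)"
  unfolding smooth_on_def by (simp add: Ck_on_prod)

lemma smooth_on_inverse:
  fixes f :: "_ \<Rightarrow> real"
  shows "open S \<Longrightarrow> (\<And>x. x \<in> S \<Longrightarrow> f x \<noteq> 0) \<Longrightarrow> smooth_on S f \<Longrightarrow> smooth_on S (\<lambda>x. inverse (f x))"
  unfolding smooth_on_def by (simp add: Ck_on_inverse)

lemma smooth_on_compose:
  fixes h :: "'e::euclidean_space \<Rightarrow> 'd::euclidean_space"
  shows "open S \<Longrightarrow> h ` S \<subseteq> V \<Longrightarrow> smooth_on S h \<Longrightarrow> smooth_on V f \<Longrightarrow> smooth_on S (\<lambda>x. f (h x))"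
  unfolding smooth_on_def by (metis Ck_on_compose)

section \<open>Bump functions and Hadamard's lemma\<close>

text \<open>The denominator \<open>x ^ k\<close> makes the family stable under differentiation: the
  derivative of a member is a linear combination of members, so smoothness follows by one induction
  for all \<open>k\<close> together.\<close>

definition flat_exp :: "nat \<Rightarrow> real \<Rightarrow> real" where
  "flat_exp k x = (if x > 0 then exp (- 1 / x) / x ^ k else 0)"

lemma flat_exp_tendsto_0: "(flat_exp k \<longlongrightarrow> 0) (at 0)"
proof -
  \<comment> \<open>To the right of 0 the substitution \<open>y = 1 / x\<close> reduces the limit to
    the growth of \<open>exp\<close>; to the left the function is 0.\<close>
  have "((\<lambda>y::real. y ^ k / exp y) \<longlongrightarrow> 0) at_top"
    by (rule tendsto_power_div_exp_0)
  then have "((\<lambda>x::real. inverse x ^ k / exp (inverse x)) \<longlongrightarrow> 0) (at_right 0)"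
    by (rule filterlim_compose[OF _ filterlim_inverse_at_top_right])
  then have "(flat_exp k \<longlongrightarrow> 0) (at_right 0)"
    by (rule Lim_transform_eventually)
       (auto simp: eventually_at_filter flat_exp_def exp_minus field_simps)
  moreover have "(flat_exp k \<longlongrightarrow> 0) (at_left 0)"
    by (rule tendsto_eventually) (auto simp: eventually_at_filter flat_exp_def)
  ultimately show ?thesis by (simp add: filterlim_split_at)
qed

lemma flat_exp_DERIV:
  "(flat_exp k has_real_derivative (- real k * flat_exp (Suc k) x + flat_exp (k + 2) x)) (at x)"
proof -
  consider "x < 0" | "x = 0" | "x > 0" by linarith
  then show ?thesis
  proof cases
    case 1
    have "((\<lambda>x. 0) has_real_derivative 0) (at x)" by simp
    then have "(flat_exp k has_real_derivative 0) (at x)"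
      by (rule DERIV_cong_ev[THEN iffD1, rotated 3])
         (use 1 eventually_nhds_in_open[of "{..<0}" x] in \<open>auto simp: flat_exp_def elim!: eventually_mono\<close>)
    then show ?thesis using 1 by (simp add: flat_exp_def)
  next
    case 2
    \<comment> \<open>The difference quotient at 0 is \<open>flat_exp (Suc k)\<close>, so the
      derivative there is the limit just computed.\<close>
    have "((\<lambda>h. (flat_exp k (0 + h) - flat_exp k 0) / h) \<longlongrightarrow> 0) (at 0)"
      by (rule Lim_transform_eventually[OF flat_exp_tendsto_0[of "Suc k"]])
         (auto simp: eventually_at_filter flat_exp_def)
    then show ?thesis using 2 by (simp add: DERIV_def flat_exp_def)
  next
    case 3
    have "((\<lambda>x. exp (- 1 / x) / x ^ k) has_real_derivative
        (- real k * flat_exp (Suc k) x + flat_exp (k + 2) x)) (at x)"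
    proof -
      have e: "((\<lambda>x. exp (- 1 / x)) has_real_derivative exp (- 1 / x) * (1 / (x * x))) (at x)"
        using 3 by (auto intro!: derivative_eq_intros)
      have p: "((\<lambda>x. x ^ k) has_real_derivative real k * x ^ (k - 1)) (at x)"
        using DERIV_pow[of k x] by simp
      have "(exp (- 1 / x) * (1 / (x * x)) * x ^ k - exp (- 1 / x) * (real k * x ^ (k - 1))) / (x ^ k * x ^ k)
          = - real k * flat_exp (Suc k) x + flat_exp (k + 2) x"
        using 3 by (cases k) (simp_all add: flat_exp_def field_simps)
      with DERIV_divide[OF e p] 3 show ?thesis by simp
    qed
    then show ?thesis
      by (rule DERIV_cong_ev[THEN iffD1, rotated 3])
         (use 3 eventually_nhds_in_open[of "{0<..}" x] in \<open>auto simp: flat_exp_def elim!: eventually_mono\<close>)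
  qed
qed

lemma smooth_on_flat_exp: "smooth_on UNIV (flat_exp k)"
proof -
  have "Ck_on n UNIV (flat_exp k)" for n
  proof (induction n arbitrary: k)
    case 0
    then show ?case
      by (auto intro!: continuous_at_imp_continuous_on DERIV_isCont[OF flat_exp_DERIV])
  next
    case (Suc n)
    show ?case
      by (rule Ck_on_SucI[OF open_UNIV flat_exp_DERIV[unfolded has_field_derivative_def]])
         (rule Ck_on_mult[OF open_UNIV Ck_on_add[OF open_UNIV Ck_on_mult[OF open_UNIV Ck_on_const]] Ck_on_const],
           rule Suc, rule Suc)
  qed
  then show ?thesis by (simp add: smooth_on_def)
qed

lemma smooth_bump_exists:
  fixes a :: "'e::euclidean_space"
  assumes "r > 0"
  obtains \<beta> :: "'e \<Rightarrow> real" and s where "smooth_on UNIV \<beta>" "0 < s" "s < r"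
    "\<And>x. 0 \<le> \<beta> x"
    "\<And>x. x \<in> ball a s \<Longrightarrow> \<beta> x = 1" "\<And>x. x \<notin> cball a r \<Longrightarrow> \<beta> x = 0"
proof
  \<comment> \<open>\<open>u\<close> is at least 1 on the ball of radius \<open>r / 2\<close> and at
    most 0 outside the ball of radius \<open>r\<close>. The quotient \<open>\<beta>\<close> is 1
    where \<open>1 - u \<le> 0\<close> and 0 where \<open>u \<le> 0\<close>; its denominator never
    vanishes, since \<open>u\<close> or \<open>1 - u\<close> is positive.\<close>
  define u where "u x = 2 - 2 * ((x - a) \<bullet> (x - a)) / r\<^sup>2" for x
  define \<beta> where "\<beta> x = flat_exp 0 (u x) * inverse (flat_exp 0 (u x) + flat_exp 0 (1 - u x))" for x
  have pos: "flat_exp 0 t + flat_exp 0 (1 - t) > 0" for t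
    by (auto simp: flat_exp_def add_pos_pos)
  have id: "smooth_on UNIV (\<lambda>x::'e. x - a)"
    using smooth_on_add[OF open_UNIV smooth_on_linear[OF bounded_linear_ident open_UNIV] smooth_on_const[of _ "- a"]]
    by simp
  have q: "smooth_on UNIV (\<lambda>x. (x - a) \<bullet> (x - a))"
    using id unfolding smooth_on_def by (simp add: Ck_on_bilinear[OF bounded_bilinear_inner])
  have su: "smooth_on UNIV u"
    using smooth_on_add[OF open_UNIV smooth_on_const[of _ 2] smooth_on_mult[OF open_UNIV smooth_on_const[of _ "- 2 / r\<^sup>2"] q]]
    by (rule smooth_on_cong[rotated 2]) (auto simp: u_def)
  have su': "smooth_on UNIV (\<lambda>x. 1 - u x)"
    using smooth_on_add[OF open_UNIV smooth_on_const[of _ 1] smooth_on_mult[OF open_UNIV smooth_on_const[of _ "- 1"] su]]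
    by simp
  have e: "smooth_on UNIV (\<lambda>x. flat_exp 0 (u x))" "smooth_on UNIV (\<lambda>x. flat_exp 0 (1 - u x))"
    using smooth_on_compose[OF open_UNIV _ su smooth_on_flat_exp]
      smooth_on_compose[OF open_UNIV _ su' smooth_on_flat_exp] by auto
  show "smooth_on UNIV \<beta>"
    unfolding \<beta>_def
    by (intro smooth_on_mult smooth_on_inverse smooth_on_add open_UNIV e) (metis pos less_irrefl)
  show "0 < r / 2" "r / 2 < r" using assms by auto
  show "0 \<le> \<beta> x" for x
    using pos[of "u x"] unfolding \<beta>_def by (auto simp: flat_exp_def field_simps)
  show "\<beta> x = 1" if "x \<in> ball a (r/2)" for x
  proof -
    have "norm (x - a) < r / 2" using that by (simp add: dist_norm norm_minus_commute)
    then have "(norm (x - a))\<^sup>2 \<le> (r/2)\<^sup>2" by (intro power_mono) auto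
    then have "4 * (norm (x - a))\<^sup>2 \<le> r\<^sup>2" by (simp add: power_divide)
    then have "2 * (norm (x - a))\<^sup>2 \<le> r\<^sup>2"
      using zero_le_power2[of "norm (x - a)"] by linarith
    then have "u x \<ge> 1" using assms by (simp add: u_def power2_norm_eq_inner[symmetric] field_simps)
    then show ?thesis by (auto simp: \<beta>_def flat_exp_def)
  qed
  show "\<beta> x = 0" if "x \<notin> cball a r" for x
  proof -
    have "norm (x - a) > r" using that by (simp add: dist_norm norm_minus_commute)
    then have "(norm (x - a))\<^sup>2 \<ge> r\<^sup>2" using assms by (intro power_mono) auto
    then have "u x \<le> 0" using assms by (simp add: u_def power2_norm_eq_inner[symmetric] field_simps)
    then show ?thesis by (auto simp: \<beta>_def flat_exp_def)
  qed
qed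

lemma segment_in_ball:
  fixes a x :: "'e::real_normed_vector"
  assumes "x \<in> ball a r" "t \<in> {0..1}"
  shows "a + t *\<^sub>R (x - a) \<in> ball a r"
proof -
  have "norm (t *\<^sub>R (x - a)) \<le> norm (x - a)"
    using assms(2) by (simp add: mult_left_le_one_le)
  then show ?thesis using assms(1) by (simp add: dist_norm norm_minus_commute)
qed

text \<open>Differentiation under the integral sign. The chain rule for \<open>a + t (x - a)\<close>
  contributes a factor \<open>t\<close>; the weight \<open>t ^ m\<close> is carried along so that
  the result has the same shape again.\<close>

lemma radial_integral_has_derivative:
  fixes F :: "'e::euclidean_space \<Rightarrow> real"
  assumes F: "smooth_on (ball a r) F" and x: "x \<in> ball a r"
  shows "((\<lambda>x. integral {0..1} (\<lambda>t. t ^ m * F (a + t *\<^sub>R (x - a)))) has_derivative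
     (\<lambda>v. integral {0..1} (\<lambda>t. t ^ Suc m * frechet_derivative F (at (a + t *\<^sub>R (x - a))) v))) (at x)"
proof -
  \<comment> \<open>The Leibniz rule wants the derivative as a continuous family of bounded linear
    maps; \<open>G\<close> assembles it from the partial derivatives.\<close>
  define G where "G y t = (\<Sum>b\<in>Basis. (t ^ Suc m * frechet_derivative F (at (a + t *\<^sub>R (y - a))) b) *\<^sub>R
      blinfun_inner_left b)" for y :: 'e and t :: real
  have G: "blinfun_apply (G y t) v = t ^ Suc m * frechet_derivative F (at (a + t *\<^sub>R (y - a))) v"
    if "y \<in> ball a r" "t \<in> {0..1}" for y t v
  proof -
    have "frechet_derivative F (at (a + t *\<^sub>R (y - a))) v =
       (\<Sum>b\<in>Basis. (v \<bullet> b) *\<^sub>R frechet_derivative F (at (a + t *\<^sub>R (y - a))) b)"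
      by (rule linear_Basis_expand[OF has_derivative_linear[OF
            smooth_on_has_derivative[OF F segment_in_ball[OF that]]]])
    then show ?thesis
      by (simp add: G_def blinfun.sum_left blinfun.scaleR_left sum_distrib_left inner_commute algebra_simps)
  qed
  have seg: "continuous_on (ball a r \<times> cbox 0 1) (\<lambda>p. a + snd p *\<^sub>R (fst p - a))"
    by (intro continuous_intros)
  have seg_sub: "(\<lambda>p. a + snd p *\<^sub>R (fst p - a)) ` (ball a r \<times> cbox 0 (1::real)) \<subseteq> ball a r"
    using segment_in_ball by fastforce
  have contG: "continuous_on (ball a r \<times> cbox 0 1) (\<lambda>(y, t). G y t)"
    unfolding G_def case_prod_unfold
    by (intro continuous_intros continuous_on_compose2[OF smooth_on_continuous[OF
          smooth_on_frechet_derivative[OF F]] seg seg_sub])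
  have cont: "continuous_on (cbox 0 1) (\<lambda>t. t ^ m * F (a + t *\<^sub>R (y - a)))" if "y \<in> ball a r" for y
    by (intro continuous_intros continuous_on_compose2[OF smooth_on_continuous[OF F]])
       (use that segment_in_ball in fastforce)
  have "((\<lambda>x. integral (cbox 0 1) (\<lambda>t. t ^ m * F (a + t *\<^sub>R (x - a)))) has_derivative
      blinfun_apply (integral (cbox 0 1) (G x))) (at x within ball a r)"
  proof (rule leibniz_rule[OF _ integrable_continuous[OF cont] contG x convex_ball])
    fix y t assume y: "y \<in> ball a r" and t: "t \<in> cbox 0 (1::real)"
    have "((\<lambda>y. a + t *\<^sub>R (y - a)) has_derivative (\<lambda>v. t *\<^sub>R v)) (at y)"
      by (auto intro!: derivative_eq_intros)
    from has_derivative_compose[OF this smooth_on_has_derivative[OF F segment_in_ball[OF y]]] t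
    have d: "((\<lambda>y. F (a + t *\<^sub>R (y - a))) has_derivative
        (\<lambda>v. frechet_derivative F (at (a + t *\<^sub>R (y - a))) (t *\<^sub>R v))) (at y)" by simp
    have l: "linear (frechet_derivative F (at (a + t *\<^sub>R (y - a))))"
      using smooth_on_has_derivative[OF F segment_in_ball[OF y]] t has_derivative_linear by auto
    have "((\<lambda>y. t ^ m * F (a + t *\<^sub>R (y - a))) has_derivative
        (\<lambda>v. t ^ m * frechet_derivative F (at (a + t *\<^sub>R (y - a))) (t *\<^sub>R v))) (at y)"
      by (rule has_derivative_mult_right[OF d])
    moreover have "(\<lambda>v. t ^ m * frechet_derivative F (at (a + t *\<^sub>R (y - a))) (t *\<^sub>R v)) = blinfun_apply (G y t)"
      using G[OF y] t by (auto simp: linear_scale[OF l])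
    ultimately show "((\<lambda>y. t ^ m * F (a + t *\<^sub>R (y - a))) has_derivative blinfun_apply (G y t)) (at y within ball a r)"
      by (metis has_derivative_at_withinI)
  qed auto
  moreover have "blinfun_apply (integral (cbox 0 1) (G x)) v =
      integral {0..1} (\<lambda>t. t ^ Suc m * frechet_derivative F (at (a + t *\<^sub>R (x - a))) v)" for v
  proof -
    have "continuous_on (cbox 0 1) (\<lambda>t. case (x, t) of (y, t) \<Rightarrow> G y t)"
      by (rule continuous_on_compose2[OF contG]) (use x in \<open>auto intro!: continuous_intros\<close>)
    then have "(G x) integrable_on (cbox 0 1)"
      by (intro integrable_continuous) simp
    from integral_linear[OF this blinfun.bounded_linear_left[of v]]
    have "blinfun_apply (integral (cbox 0 1) (G x)) v = integral (cbox 0 1) (\<lambda>t. blinfun_apply (G x t) v)"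
      by (simp add: o_def)
    also have "\<dots> = integral (cbox 0 1) (\<lambda>t. t ^ Suc m * frechet_derivative F (at (a + t *\<^sub>R (x - a))) v)"
      by (rule integral_cong) (use G[OF x] in auto)
    finally show ?thesis by simp
  qed
  then have "blinfun_apply (integral (cbox 0 1) (G x)) =
      (\<lambda>v. integral {0..1} (\<lambda>t. t ^ Suc m * frechet_derivative F (at (a + t *\<^sub>R (x - a))) v))"
    by (rule ext)
  ultimately show ?thesis
    by (simp only: at_within_open[OF x open_ball] box_real)
qed

text \<open>Each differentiation replaces \<open>F\<close> by a directional derivative and
  \<open>m\<close> by \<open>Suc m\<close>, so the induction on \<open>k\<close> has to be general
  in both.\<close>

lemma smooth_on_radial_integral:
  fixes F :: "'e::euclidean_space \<Rightarrow> real"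
  assumes "smooth_on (ball a r) F"
  shows "smooth_on (ball a r) (\<lambda>x. integral {0..1} (\<lambda>t. t ^ m * F (a + t *\<^sub>R (x - a))))"
proof -
  have "Ck_on k (ball a r) (\<lambda>x. integral {0..1} (\<lambda>t. t ^ m * F (a + t *\<^sub>R (x - a))))" for k
    using assms
  proof (induction k arbitrary: m F)
    case 0
    then show ?case
      using has_derivative_continuous[OF radial_integral_has_derivative[OF 0]]
      by (auto intro: continuous_at_imp_continuous_on)
  next
    case (Suc k)
    show ?case
      by (rule Ck_on_SucI[OF open_ball radial_integral_has_derivative[OF Suc.prems]])
         (auto intro: Suc.IH[OF smooth_on_frechet_derivative[OF Suc.prems], of "Suc m", simplified])
  qed
  then show ?thesis by (simp add: smooth_on_def)
qed

text \<open>Integrate the derivative of \<open>t \<mapsto> f (a + t (x - a))\<close> over the unit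
  interval and expand the direction \<open>x - a\<close> in \<open>Basis\<close>. It serves to
  evaluate an arbitrary derivation at a point.\<close>

lemma Hadamard:
  fixes f :: "'e::euclidean_space \<Rightarrow> real"
  assumes f: "smooth_on (ball a r) f" and r: "r > 0"
  obtains h where "\<And>b. smooth_on (ball a r) (h b)"
    "\<And>b. h b a = frechet_derivative f (at a) b"
    "\<And>x. x \<in> ball a r \<Longrightarrow> f x = f a + (\<Sum>b\<in>Basis. ((x - a) \<bullet> b) * h b x)"
proof
  \<comment> \<open>The trivial factor \<open>t ^ 0\<close> gives the integrand the shape treated by
    \<open>smooth_on_radial_integral\<close>.\<close>
  define h where "h b x = integral {0..1} (\<lambda>t. t ^ 0 * frechet_derivative f (at (a + t *\<^sub>R (x - a))) b)" for b x
  show "smooth_on (ball a r) (h b)" for b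
    unfolding h_def by (rule smooth_on_radial_integral[OF smooth_on_frechet_derivative[OF f]])
  show "h b a = frechet_derivative f (at a) b" for b
    by (simp add: h_def)
  show "f x = f a + (\<Sum>b\<in>Basis. ((x - a) \<bullet> b) * h b x)" if x: "x \<in> ball a r" for x
  proof -
    let ?D = "\<lambda>t. frechet_derivative f (at (a + t *\<^sub>R (x - a)))"
    have der: "((\<lambda>t. f (a + t *\<^sub>R (x - a))) has_vector_derivative ?D t (x - a)) (at t within {0..1})"
      if t: "t \<in> {0..1}" for t
    proof -
      have d: "((\<lambda>t. a + t *\<^sub>R (x - a)) has_derivative (\<lambda>s. s *\<^sub>R (x - a))) (at t within {0..1})"
        by (auto intro!: derivative_eq_intros)
      have e: "(f has_derivative ?D t) (at (a + t *\<^sub>R (x - a)))"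
        by (rule smooth_on_has_derivative[OF f segment_in_ball[OF x t]])
      from has_derivative_compose[OF d e] show ?thesis
        unfolding has_vector_derivative_def
        by (simp add: linear_scale[OF has_derivative_linear[OF e]])
    qed
    have "(\<lambda>t. ?D t (x - a)) integrable_on {0..1} \<and> integral {0..1} (\<lambda>t. ?D t (x - a)) = f x - f a"
      using fundamental_theorem_of_calculus[OF _ der] by (auto dest: integral_unique has_integral_integrable)
    then have "f x - f a = integral {0..1} (\<lambda>t. ?D t (x - a))" by simp
    also have "\<dots> = integral {0..1} (\<lambda>t. \<Sum>b\<in>Basis. ((x - a) \<bullet> b) * ?D t b)"
    proof (rule integral_cong)
      fix t :: real assume t: "t \<in> {0..1}"
      show "?D t (x - a) = (\<Sum>b\<in>Basis. ((x - a) \<bullet> b) * ?D t b)"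
        using linear_Basis_expand[OF has_derivative_linear[OF
            smooth_on_has_derivative[OF f segment_in_ball[OF x t]]], of "x - a"] by simp
    qed
    also have "\<dots> = (\<Sum>b\<in>Basis. integral {0..1} (\<lambda>t. ((x - a) \<bullet> b) * ?D t b))"
    proof (rule integral_sum)
      fix b :: 'e
      have "continuous_on {0..1} (\<lambda>t. ?D t b)"
        by (rule continuous_on_compose2[OF smooth_on_continuous[OF smooth_on_frechet_derivative[OF f]]])
           (use segment_in_ball[OF x] in \<open>auto intro!: continuous_intros\<close>)
      then show "(\<lambda>t. ((x - a) \<bullet> b) * ?D t b) integrable_on {0..1}"
        by (intro integrable_continuous_real continuous_intros)
    qed simp
    finally show ?thesis by (simp add: h_def)
  qed
qed

section \<open>Smooth functions and tangent vectors in charts\<close>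

text \<open>The partial derivative along \<open>w\<close> in the chart, as a derivation at
  \<open>p\<close>. The value 0 on other functions is the normalisation demanded by
  \<open>tangent_space\<close>.\<close>

definition coord_vec ::
    "('a, 'e::euclidean_space) chart set \<Rightarrow> 'a set \<Rightarrow> ('a \<Rightarrow> 'e) \<Rightarrow> 'a \<Rightarrow> 'e \<Rightarrow> 'a tvec" where
  "coord_vec A U \<phi> p w =
     (\<lambda>f. if smooth_fun A f then frechet_derivative (f \<circ> inv_into U \<phi>) (at (\<phi> p)) w else 0)"

definition coords ::
    "('a, 'e::euclidean_space) chart set \<Rightarrow> 'a set \<Rightarrow> ('a \<Rightarrow> 'e) \<Rightarrow> 'a \<Rightarrow> 'a tvec \<Rightarrow> 'e" where
  "coords A U \<phi> p v = (THE w. coord_vec A U \<phi> p w = v)"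

locale smooth_mfd =
  fixes A :: "('a::{t2_space,second_countable_topology}, 'e::euclidean_space) chart set"
  assumes mfd: "smooth_manifold A"
begin

lemma chart_props:
  assumes "(U, \<phi>) \<in> A"
  shows "open U" "open (\<phi> ` U)" "inj_on \<phi> U" "continuous_on U \<phi>" "continuous_on (\<phi> ` U) (inv_into U \<phi>)"
proof -
  have c: "is_chart (U, \<phi>)" using mfd assms by (auto simp: smooth_manifold_def)
  then show "open U" "open (\<phi> ` U)" "continuous_on U \<phi>" "continuous_on (\<phi> ` U) (inv_into U \<phi>)"
    by (auto simp: is_chart_def homeomorphism_def)
  show "inj_on \<phi> U"
    using c by (intro inj_on_inverseI[of U "inv_into U \<phi>"]) (auto simp: is_chart_def homeomorphism_def)
qed

lemma chart_inv [simp]: "(U, \<phi>) \<in> A \<Longrightarrow> p \<in> U \<Longrightarrow> inv_into U \<phi> (\<phi> p) = p"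
  by (simp add: chart_props(3))

lemma chart_exists: obtains U \<phi> where "(U, \<phi>) \<in> A" "p \<in> U"
proof -
  have "p \<in> \<Union>(fst ` A)" using mfd by (simp add: smooth_manifold_def)
  then show ?thesis using that by fastforce
qed

lemma open_chart_image:
  assumes "(U, \<phi>) \<in> A" "open W" "W \<subseteq> U"
  shows "open (\<phi> ` W)"
proof -
  have "open (\<phi> ` U \<inter> inv_into U \<phi> -` W)"
    by (rule continuous_open_preimage[OF chart_props(5,2)[OF assms(1)] assms(2)])
  also have "\<phi> ` U \<inter> inv_into U \<phi> -` W = \<phi> ` W"
    using assms by (auto simp: subset_iff)
  finally show ?thesis .
qed

lemma chart_preimage:
  assumes "(U, \<phi>) \<in> A" "S \<subseteq> \<phi> ` U"
  shows "inv_into U \<phi> ` S = U \<inter> \<phi> -` S"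
proof (intro equalityI subsetI)
  fix q assume "q \<in> inv_into U \<phi> ` S"
  then obtain y where "y \<in> S" "q = inv_into U \<phi> y" by blast
  then show "q \<in> U \<inter> \<phi> -` S"
    using assms(2) inv_into_into[of y \<phi> U] f_inv_into_f[of y \<phi> U] by auto
next
  fix q assume "q \<in> U \<inter> \<phi> -` S"
  then show "q \<in> inv_into U \<phi> ` S"
    using assms(1) by (intro image_eqI[of q _ "\<phi> q"]) simp_all
qed

lemma open_chart_preimage:
  "(U, \<phi>) \<in> A \<Longrightarrow> open S \<Longrightarrow> open (U \<inter> \<phi> -` S)"
  by (rule continuous_open_preimage[OF chart_props(4,1)])

lemma smooth_transition:
  "(U, \<phi>) \<in> A \<Longrightarrow> (V, \<psi>) \<in> A \<Longrightarrow> smooth_on (\<phi> ` (U \<inter> V)) (\<psi> \<circ> inv_into U \<phi>)"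
  using mfd by (auto simp: smooth_manifold_def)

lemma smooth_fun_chart: "smooth_fun A f \<Longrightarrow> (U, \<phi>) \<in> A \<Longrightarrow> smooth_on (\<phi> ` U) (f \<circ> inv_into U \<phi>)"
  by (auto simp: smooth_fun_def)

text \<open>Transition maps carry smoothness near a point from one chart to every other, so a single
  convenient chart per point is enough.\<close>

lemma smooth_funI_local:
  assumes "\<And>p. \<exists>U \<phi> W. (U, \<phi>) \<in> A \<and> open W \<and> p \<in> W \<and> W \<subseteq> U \<and> smooth_on (\<phi> ` W) (f \<circ> inv_into U \<phi>)"
  shows "smooth_fun A f"
  unfolding smooth_fun_def
proof clarify
  fix V \<psi> assume V: "(V, \<psi>) \<in> A"
  show "smooth_on (\<psi> ` V) (f \<circ> inv_into V \<psi>)"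
  proof (rule smooth_on_local)
    fix y assume "y \<in> \<psi> ` V"
    then obtain q where q: "q \<in> V" "y = \<psi> q" by blast
    obtain U \<phi> W where U: "(U, \<phi>) \<in> A" and W: "open W" "q \<in> W" "W \<subseteq> U"
      and f: "smooth_on (\<phi> ` W) (f \<circ> inv_into U \<phi>)" using assms[of q] by blast
    have o: "open (\<psi> ` (V \<inter> W))"
      using open_chart_image[OF V] chart_props(1)[OF V] W by (simp add: open_Int)
    have t: "smooth_on (\<psi> ` (V \<inter> W)) (\<phi> \<circ> inv_into V \<psi>)"
      by (rule smooth_on_subset[OF smooth_transition[OF V U]]) (use W in auto)
    have "smooth_on (\<psi> ` (V \<inter> W)) (\<lambda>x. (f \<circ> inv_into U \<phi>) ((\<phi> \<circ> inv_into V \<psi>) x))"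
      by (rule smooth_on_compose[OF o _ t f]) (use V in auto)
    then have "smooth_on (\<psi> ` (V \<inter> W)) (f \<circ> inv_into V \<psi>)"
      by (rule smooth_on_cong[OF o, rotated]) (use U V W in \<open>auto simp: subset_iff\<close>)
    then show "\<exists>Z. open Z \<and> y \<in> Z \<and> smooth_on Z (f \<circ> inv_into V \<psi>)"
      using o q W by blast
  qed
qed

text \<open>The open sets \<open>W\<close> and the complement of \<open>K\<close> cover the
  manifold; on one of them \<open>F\<close> is \<open>h\<close> in coordinates, on the other it is
  0. Local constructions in a chart become global functions in this way.\<close>

lemma smooth_fun_zero_extend:
  assumes U: "(U, \<phi>) \<in> A" and W: "open W" "W \<subseteq> U" and h: "smooth_on (\<phi> ` W) h"
    and K: "closed K" "K \<subseteq> W"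
    and F: "\<And>q. q \<in> W \<Longrightarrow> F q = h (\<phi> q)" "\<And>q. q \<notin> K \<Longrightarrow> F q = 0"
  shows "smooth_fun A F"
proof (rule smooth_funI_local)
  fix p
  show "\<exists>U \<phi> W. (U, \<phi>) \<in> A \<and> open W \<and> p \<in> W \<and> W \<subseteq> U \<and> smooth_on (\<phi> ` W) (F \<circ> inv_into U \<phi>)"
  proof (cases "p \<in> W")
    case True
    have "smooth_on (\<phi> ` W) (F \<circ> inv_into U \<phi>)"
      by (rule smooth_on_cong[OF open_chart_image[OF U W] _ h]) (use F(1) U W in \<open>auto simp: subset_iff\<close>)
    then show ?thesis using U W True by blast
  next
    case False
    obtain V \<psi> where V: "(V, \<psi>) \<in> A" "p \<in> V" by (rule chart_exists)
    have o: "open (V \<inter> - K)" using chart_props(1)[OF V(1)] K by (simp add: open_Int open_Compl)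
    have "smooth_on (\<psi> ` (V \<inter> - K)) (F \<circ> inv_into V \<psi>)"
      by (rule smooth_on_cong[OF open_chart_image[OF V(1) o] _ smooth_on_const[of _ 0]])
         (use F(2) V(1) in auto)
    then show ?thesis using V o False K by blast
  qed
qed

lemma smooth_fun_const: "smooth_fun A (\<lambda>p. c)"
  unfolding smooth_fun_def by (auto simp: o_def smooth_on_const)

lemma smooth_fun_add:
  assumes "smooth_fun A f" "smooth_fun A h"
  shows "smooth_fun A (\<lambda>p. f p + h p)"
  unfolding smooth_fun_def
proof clarify
  fix U \<phi> assume U: "(U, \<phi>) \<in> A"
  show "smooth_on (\<phi> ` U) ((\<lambda>p. f p + h p) \<circ> inv_into U \<phi>)"
    using smooth_on_add[OF chart_props(2)[OF U] assms[THEN smooth_fun_chart, OF U]] by (simp add: o_def)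
qed

lemma smooth_fun_mult:
  assumes "smooth_fun A f" "smooth_fun A h"
  shows "smooth_fun A (\<lambda>p. f p * h p)"
  unfolding smooth_fun_def
proof clarify
  fix U \<phi> assume U: "(U, \<phi>) \<in> A"
  show "smooth_on (\<phi> ` U) ((\<lambda>p. f p * h p) \<circ> inv_into U \<phi>)"
    using smooth_on_mult[OF chart_props(2)[OF U] assms[THEN smooth_fun_chart, OF U]] by (simp add: o_def)
qed

lemma smooth_fun_sum: "(\<And>i. i \<in> I \<Longrightarrow> smooth_fun A (f i)) \<Longrightarrow> smooth_fun A (\<lambda>p. \<Sum>i\<in>I. f i p)"
  by (induction I rule: infinite_finite_induct) (auto intro: smooth_fun_const smooth_fun_add)

lemma smooth_fun_diff: "smooth_fun A f \<Longrightarrow> smooth_fun A h \<Longrightarrow> smooth_fun A (\<lambda>p. f p - h p)"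
  using smooth_fun_add[OF _ smooth_fun_mult[OF smooth_fun_const[of "-1"]], of f h] by simp

lemma smooth_fun_inverse:
  assumes "smooth_fun A f" "\<And>p. f p \<noteq> 0"
  shows "smooth_fun A (\<lambda>p. inverse (f p))"
  unfolding smooth_fun_def
proof clarify
  fix U \<phi> assume U: "(U, \<phi>) \<in> A"
  show "smooth_on (\<phi> ` U) ((\<lambda>p. inverse (f p)) \<circ> inv_into U \<phi>)"
    using smooth_on_inverse[OF chart_props(2)[OF U] _ smooth_fun_chart[OF assms(1) U]] assms(2)
    by (simp add: o_def)
qed

lemma smooth_fun_continuous: "smooth_fun A f \<Longrightarrow> continuous_on UNIV f"
proof (rule continuous_at_imp_continuous_on, rule ballI)
  fix p assume f: "smooth_fun A f"
  obtain U \<phi> where U: "(U, \<phi>) \<in> A" "p \<in> U" by (rule chart_exists)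
  have "continuous_on U (\<lambda>q. (f \<circ> inv_into U \<phi>) (\<phi> q))"
    by (rule continuous_on_compose2[OF smooth_on_continuous[OF smooth_fun_chart[OF f U(1)]] chart_props(4)[OF U(1)]]) simp
  then have "continuous_on U f"
    by (rule continuous_on_eq) (use U in auto)
  then show "isCont f p" using U chart_props(1) by (metis continuous_on_eq_continuous_at)
qed

text \<open>The Euclidean bump function is pulled back by a chart. The preimage \<open>K\<close> of
  the closed ball is compact, hence closed in a Hausdorff space, so extension by 0 is
  smooth.\<close>

lemma bump_exists:
  assumes "open N" "p \<in> N"
  obtains \<xi> K W where "smooth_fun A \<xi>" "compact K" "closed K" "K \<subseteq> N" "open W" "p \<in> W" "W \<subseteq> K"
    "\<And>q. q \<in> W \<Longrightarrow> \<xi> q = 1" "\<And>q. q \<notin> K \<Longrightarrow> \<xi> q = 0" "\<And>q. 0 \<le> \<xi> q"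
proof -
  obtain U \<phi> where U: "(U, \<phi>) \<in> A" "p \<in> U" by (rule chart_exists)
  define O' where "O' = U \<inter> N"
  have O': "open O'" "O' \<subseteq> U" "p \<in> O'" using assms U chart_props(1) by (auto simp: O'_def)
  have oi: "open (\<phi> ` O')" by (rule open_chart_image[OF U(1) O'(1,2)])
  then obtain r where r: "r > 0" "cball (\<phi> p) r \<subseteq> \<phi> ` O'"
    using O'(3) open_contains_cball by (metis imageI)
  obtain \<beta> :: "'e \<Rightarrow> real" and s where \<beta>: "smooth_on UNIV \<beta>" "0 < s" "s < r" "\<And>x. 0 \<le> \<beta> x"
    "\<And>x. x \<in> ball (\<phi> p) s \<Longrightarrow> \<beta> x = 1" "\<And>x. x \<notin> cball (\<phi> p) r \<Longrightarrow> \<beta> x = 0"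
    by (fact smooth_bump_exists[OF r(1), of "\<phi> p"])
  define K where "K = inv_into U \<phi> ` cball (\<phi> p) r"
  define W where "W = inv_into U \<phi> ` ball (\<phi> p) s"
  define \<xi> where "\<xi> q = (if q \<in> O' then \<beta> (\<phi> q) else 0)" for q
  have sub: "cball (\<phi> p) r \<subseteq> \<phi> ` U" using r O' by blast
  have K: "compact K" unfolding K_def
    by (rule compact_continuous_image[OF continuous_on_subset[OF chart_props(5)[OF U(1)] sub] compact_cball])
  have Kpre: "K = U \<inter> \<phi> -` cball (\<phi> p) r"
    unfolding K_def by (rule chart_preimage[OF U(1) sub])
  have KO: "K \<subseteq> O'"
  proof
    fix q assume q: "q \<in> K"
    then obtain q' where "q' \<in> O'" "\<phi> q = \<phi> q'" using r(2) Kpre by blast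
    then show "q \<in> O'" using q Kpre O'(2) chart_props(3)[OF U(1)] by (auto dest: inj_onD)
  qed
  have bs: "ball (\<phi> p) s \<subseteq> cball (\<phi> p) r" using \<beta>(3) by auto
  have Wpre: "W = U \<inter> \<phi> -` ball (\<phi> p) s"
    unfolding W_def by (rule chart_preimage[OF U(1) subset_trans[OF bs sub]])
  have W: "open W" unfolding Wpre
    by (rule open_chart_preimage[OF U(1) open_ball])
  have WK: "W \<subseteq> K" unfolding W_def K_def using bs by blast
  have z: "\<xi> q = 0" if "q \<notin> K" for q
  proof (cases "q \<in> O'")
    case True
    then have "\<phi> q \<notin> cball (\<phi> p) r"
      using that O'(2) unfolding Kpre by blast
    then show ?thesis using \<beta> by (simp add: \<xi>_def)
  qed (simp add: \<xi>_def)
  show ?thesis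
  proof (rule that[of \<xi> K W])
    show "smooth_fun A \<xi>"
      by (rule smooth_fun_zero_extend[OF U(1) O'(1,2) smooth_on_subset[OF \<beta>(1) subset_UNIV] compact_imp_closed[OF K] KO _ z])
         (simp_all add: \<xi>_def)
    show "K \<subseteq> N" using KO by (auto simp: O'_def)
    show "\<xi> q = 1" if "q \<in> W" for q
      using that WK KO Wpre \<beta> by (auto simp: \<xi>_def)
    show "p \<in> W" using U \<beta> by (simp add: Wpre)
  qed (use K compact_imp_closed W WK z \<beta> in \<open>auto simp: \<xi>_def\<close>)
qed

section \<open>Tangent vectors as derivations\<close>

lemma tangent_lin:
  "v \<in> tangent_space A p \<Longrightarrow> smooth_fun A f \<Longrightarrow> smooth_fun A h \<Longrightarrow>
    v (\<lambda>q. a * f q + b * h q) = a * v f + b * v h"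
  by (simp add: tangent_space_def)

lemma tangent_mult:
  "v \<in> tangent_space A p \<Longrightarrow> smooth_fun A f \<Longrightarrow> smooth_fun A h \<Longrightarrow>
    v (\<lambda>q. f q * h q) = f p * v h + h p * v f"
  by (simp add: tangent_space_def)

lemma tangent_nonsmooth: "v \<in> tangent_space A p \<Longrightarrow> \<not> smooth_fun A f \<Longrightarrow> v f = 0"
  by (simp add: tangent_space_def)

text \<open>The product rule for \<open>1 = 1 * 1\<close> gives
  \<open>v 1 = 2 * v 1\<close>.\<close>

lemma tangent_const:
  assumes "v \<in> tangent_space A p"
  shows "v (\<lambda>q. c) = 0"
proof -
  have "v (\<lambda>q. 1 * 1) = 1 * v (\<lambda>q. 1) + 1 * v (\<lambda>q. 1)"
    by (rule tangent_mult[OF assms smooth_fun_const smooth_fun_const])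
  then have "v (\<lambda>q. 1) = 0" by simp
  then show ?thesis
    using tangent_lin[OF assms smooth_fun_const smooth_fun_const, of c 1 0 1] by simp
qed

lemma tangent_add:
  "v \<in> tangent_space A p \<Longrightarrow> smooth_fun A f \<Longrightarrow> smooth_fun A h \<Longrightarrow> v (\<lambda>q. f q + h q) = v f + v h"
  using tangent_lin[of v p f h 1 1] by simp

lemma tangent_sum:
  assumes "v \<in> tangent_space A p"
  shows "(\<And>i. i \<in> I \<Longrightarrow> smooth_fun A (f i)) \<Longrightarrow> v (\<lambda>q. \<Sum>i\<in>I. f i q) = (\<Sum>i\<in>I. v (f i))"
  by (induction I rule: infinite_finite_induct)
     (simp_all add: tangent_const[OF assms] tangent_add[OF assms] smooth_fun_sum)

text \<open>For a bump function \<open>\<xi>\<close> supported in \<open>N\<close> and equal to 1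
  near \<open>p\<close>, \<open>f - h = (1 - \<xi>) (f - h)\<close>. Both factors vanish at
  \<open>p\<close>, so the product rule gives 0.\<close>

lemma tangent_local:
  assumes v: "v \<in> tangent_space A p" and f: "smooth_fun A f" and h: "smooth_fun A h"
    and N: "open N" "p \<in> N" and eq: "\<And>q. q \<in> N \<Longrightarrow> f q = h q"
  shows "v f = v h"
proof -
  obtain \<xi> K W where c: "smooth_fun A \<xi>" "K \<subseteq> N" "p \<in> W" "\<And>q. q \<in> W \<Longrightarrow> \<xi> q = 1" "\<And>q. q \<notin> K \<Longrightarrow> \<xi> q = 0"
    by (rule bump_exists[OF N]) blast
  have s: "smooth_fun A (\<lambda>q. 1 - \<xi> q)" "smooth_fun A (\<lambda>q. f q - h q)"
    by (intro smooth_fun_diff smooth_fun_const f h c)+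
  have "(\<lambda>q. 1 * f q + (-1) * h q) = (\<lambda>q. (1 - \<xi> q) * (f q - h q))"
  proof
    fix q show "1 * f q + (-1) * h q = (1 - \<xi> q) * (f q - h q)"
      using c(2) c(5)[of q] eq[of q] by (cases "q \<in> K") auto
  qed
  then have "1 * v f + (-1) * v h = (1 - \<xi> p) * v (\<lambda>q. f q - h q) + (f p - h p) * v (\<lambda>q. 1 - \<xi> q)"
    by (metis (no_types) tangent_lin[OF v f h] tangent_mult[OF v s])
  then show ?thesis using c eq N by simp
qed

lemma tangent_lincomb:
  assumes "v \<in> tangent_space A p" "w \<in> tangent_space A p"
  shows "lincomb a v b w \<in> tangent_space A p"
  using assms unfolding tangent_space_def lincomb_def
  by (auto simp: algebra_simps)

lemma tangent_zero: "zero_tvec \<in> tangent_space A p"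
  by (simp add: tangent_space_def zero_tvec_def)

lemma smooth_fun_chart_derivative:
  assumes "smooth_fun A f" "(U, \<phi>) \<in> A" "p \<in> U"
  shows "((f \<circ> inv_into U \<phi>) has_derivative frechet_derivative (f \<circ> inv_into U \<phi>) (at (\<phi> p))) (at (\<phi> p))"
  using smooth_on_has_derivative[OF smooth_fun_chart[OF assms(1,2)]] assms(3) by blast

lemma coord_vec_lincomb:
  assumes "(U, \<phi>) \<in> A" "p \<in> U"
  shows "coord_vec A U \<phi> p (a *\<^sub>R w + b *\<^sub>R w') = lincomb a (coord_vec A U \<phi> p w) b (coord_vec A U \<phi> p w')"
proof
  fix f
  show "coord_vec A U \<phi> p (a *\<^sub>R w + b *\<^sub>R w') f = lincomb a (coord_vec A U \<phi> p w) b (coord_vec A U \<phi> p w') f"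
  proof (cases "smooth_fun A f")
    case True
    then have "linear (frechet_derivative (f \<circ> inv_into U \<phi>) (at (\<phi> p)))"
      using smooth_fun_chart_derivative assms has_derivative_linear by blast
    then show ?thesis by (simp add: coord_vec_def lincomb_def linear_add linear_scale)
  qed (simp add: coord_vec_def lincomb_def)
qed

lemma coord_vec_zero: "(U, \<phi>) \<in> A \<Longrightarrow> p \<in> U \<Longrightarrow> coord_vec A U \<phi> p 0 = zero_tvec"
  using coord_vec_lincomb[of U \<phi> p 0 0 0 0] by (simp add: lincomb_def zero_tvec_def)

lemma coord_vec_tangent:
  assumes U: "(U, \<phi>) \<in> A" "p \<in> U"
  shows "coord_vec A U \<phi> p w \<in> tangent_space A p"
proof -
  let ?d = "\<lambda>f. frechet_derivative (f \<circ> inv_into U \<phi>) (at (\<phi> p))"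
  have "coord_vec A U \<phi> p w (\<lambda>q. a * f q + b * h q) = a * coord_vec A U \<phi> p w f + b * coord_vec A U \<phi> p w h"
    if f: "smooth_fun A f" and h: "smooth_fun A h" for f h a b
  proof -
    have "((\<lambda>q. a * f q + b * h q) \<circ> inv_into U \<phi> has_derivative (\<lambda>v. a * ?d f v + b * ?d h v)) (at (\<phi> p))"
      using has_derivative_add[OF has_derivative_mult_right[OF smooth_fun_chart_derivative[OF f U], of a]
          has_derivative_mult_right[OF smooth_fun_chart_derivative[OF h U], of b]]
      by (simp add: o_def)
    then have "?d (\<lambda>q. a * f q + b * h q) = (\<lambda>v. a * ?d f v + b * ?d h v)"
      by (rule frechet_derivative_eq)
    moreover have "smooth_fun A (\<lambda>q. a * f q + b * h q)"
      by (intro smooth_fun_add smooth_fun_mult smooth_fun_const f h)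
    ultimately show ?thesis using f h by (simp add: coord_vec_def)
  qed
  moreover have "coord_vec A U \<phi> p w (\<lambda>q. f q * h q) = f p * coord_vec A U \<phi> p w h + h p * coord_vec A U \<phi> p w f"
    if f: "smooth_fun A f" and h: "smooth_fun A h" for f h
  proof -
    have "((\<lambda>q. f q * h q) \<circ> inv_into U \<phi> has_derivative (\<lambda>v. f p * ?d h v + ?d f v * h p)) (at (\<phi> p))"
      using has_derivative_mult[OF smooth_fun_chart_derivative[OF f U] smooth_fun_chart_derivative[OF h U]] U
      by (simp add: o_def)
    then have "?d (\<lambda>q. f q * h q) = (\<lambda>v. f p * ?d h v + ?d f v * h p)"
      by (rule frechet_derivative_eq)
    then show ?thesis using f h smooth_fun_mult[OF f h] by (simp add: coord_vec_def)
  qed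
  ultimately show ?thesis unfolding tangent_space_def by (auto simp: coord_vec_def)
qed

text \<open>A tangent vector can only be applied to globally smooth functions, so the chart
  coordinates, centred at \<open>p\<close>, are multiplied by a bump function; near \<open>p\<close>
  nothing changes.\<close>

lemma coordinate_functions:
  assumes U: "(U, \<phi>) \<in> A" "p \<in> U"
  obtains x :: "'e \<Rightarrow> 'a \<Rightarrow> real" and W where "open W" "p \<in> W" "W \<subseteq> U" "\<And>u. smooth_fun A (x u)"
    "\<And>u q. q \<in> W \<Longrightarrow> x u q = (\<phi> q - \<phi> p) \<bullet> u"
    "\<And>u w q. q \<in> W \<Longrightarrow> coord_vec A U \<phi> q w (x u) = w \<bullet> u"
proof -
  obtain \<xi> K W where c: "smooth_fun A \<xi>" "closed K" "K \<subseteq> U" "open W" "p \<in> W" "W \<subseteq> K"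
    "\<And>q. q \<in> W \<Longrightarrow> \<xi> q = 1" "\<And>q. q \<notin> K \<Longrightarrow> \<xi> q = 0"
    by (rule bump_exists[OF chart_props(1)[OF U(1)] U(2)]) blast
  define x where "x u q = (if q \<in> U then \<xi> q * ((\<phi> q - \<phi> p) \<bullet> u) else 0)" for u q
  have aff: "smooth_on S (\<lambda>y. (y - \<phi> p) \<bullet> u)" if "open S" for u :: 'e and S
  proof -
    have "smooth_on S (\<lambda>y. y \<bullet> u + (- (\<phi> p \<bullet> u)))"
      by (rule smooth_on_add[OF that smooth_on_linear[OF bounded_linear_inner_left that] smooth_on_const])
    then show ?thesis by (simp add: inner_diff_left)
  qed
  have sx: "smooth_fun A (x u)" for u
    by (rule smooth_fun_zero_extend[OF U(1) chart_props(1)[OF U(1)] subset_refl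
          smooth_on_mult[OF chart_props(2)[OF U(1)] smooth_fun_chart[OF c(1) U(1)] aff[OF chart_props(2)[OF U(1)]]]
          c(2,3)])
       (use U c(8) in \<open>auto simp: x_def\<close>)
  have WU: "W \<subseteq> U" using c by auto
  have xW: "x u q = (\<phi> q - \<phi> p) \<bullet> u" if "q \<in> W" for u q
    using that WU c by (auto simp: x_def)
  have "coord_vec A U \<phi> q w (x u) = w \<bullet> u" if q: "q \<in> W" for u w q
  proof -
    have "frechet_derivative (x u \<circ> inv_into U \<phi>) (at (\<phi> q)) = frechet_derivative (\<lambda>y. (y - \<phi> p) \<bullet> u) (at (\<phi> q))"
      by (rule frechet_derivative_cong_open[OF open_chart_image[OF U(1) c(4) WU]])
         (use q xW WU U in \<open>auto simp: subset_iff\<close>)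
    also have "\<dots> = (\<lambda>v. v \<bullet> u)"
      by (rule frechet_derivative_eq) (auto intro!: derivative_eq_intros)
    finally show ?thesis using sx by (simp add: coord_vec_def)
  qed
  then show ?thesis using that c WU sx xW by metis
qed

lemma coord_vec_inj:
  assumes U: "(U, \<phi>) \<in> A" "p \<in> U" and eq: "coord_vec A U \<phi> p w = coord_vec A U \<phi> p w'"
  shows "w = w'"
proof -
  obtain x :: "'e \<Rightarrow> 'a \<Rightarrow> real" and W where "p \<in> W" "\<And>u w q. q \<in> W \<Longrightarrow> coord_vec A U \<phi> q w (x u) = w \<bullet> u"
    by (rule coordinate_functions[OF U]) blast
  then have "w \<bullet> u = w' \<bullet> u" for u using eq by metis
  then show ?thesis by (metis euclidean_eqI)
qed

text \<open>By Hadamard's lemma, \<open>f\<close> equals \<open>f p\<close> plus the sum of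
  \<open>x b * H b\<close> near \<open>p\<close>, where \<open>x b\<close> vanishes at
  \<open>p\<close> and \<open>H b p\<close> is a partial derivative. The product rule leaves the sum
  of \<open>v (x b) * H b p\<close>, so \<open>w\<close> has the components
  \<open>v (x b)\<close>.\<close>

lemma tangent_eq_coord_vec:
  assumes U: "(U, \<phi>) \<in> A" "p \<in> U" and v: "v \<in> tangent_space A p"
  shows "\<exists>w. v = coord_vec A U \<phi> p w"
proof -
  obtain x :: "'e \<Rightarrow> 'a \<Rightarrow> real" and W where x: "open W" "p \<in> W" "W \<subseteq> U" "\<And>u. smooth_fun A (x u)"
    "\<And>u q. q \<in> W \<Longrightarrow> x u q = (\<phi> q - \<phi> p) \<bullet> u"
    "\<And>u w q. q \<in> W \<Longrightarrow> coord_vec A U \<phi> q w (x u) = w \<bullet> u"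
    by (rule coordinate_functions[OF U]) blast
  obtain r where r: "r > 0" "ball (\<phi> p) r \<subseteq> \<phi> ` W"
    using open_chart_image[OF U(1) x(1,3)] x(2) open_contains_ball by (metis imageI)
  \<comment> \<open>Hadamard's lemma needs a ball, so the neighbourhood \<open>W\<close> is shrunk
    to the preimage of one.\<close>
  define B where "B = inv_into U \<phi> ` ball (\<phi> p) r"
  have BU: "B = U \<inter> \<phi> -` ball (\<phi> p) r"
    unfolding B_def by (rule chart_preimage[OF U(1)]) (use r(2) x(3) in blast)
  have oB: "open B" unfolding BU
    by (rule open_chart_preimage[OF U(1) open_ball])
  have pB: "p \<in> B" using U r by (simp add: BU)
  have BW: "B \<subseteq> W"
  proof
    fix q assume q: "q \<in> B"
    then obtain q' where "q' \<in> W" "\<phi> q = \<phi> q'" using r(2) BU by blast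
    then show "q \<in> W" using q BU x(3) chart_props(3)[OF U(1)] by (auto dest: inj_onD)
  qed
  obtain \<xi> K N where c: "smooth_fun A \<xi>" "closed K" "K \<subseteq> B" "open N" "p \<in> N" "N \<subseteq> K"
    "\<And>q. q \<in> N \<Longrightarrow> \<xi> q = 1" "\<And>q. q \<notin> K \<Longrightarrow> \<xi> q = 0"
    by (rule bump_exists[OF oB pB]) blast
  define w where "w = (\<Sum>b\<in>Basis. v (x b) *\<^sub>R b)"
  have "v f = coord_vec A U \<phi> p w f" for f
  proof (cases "smooth_fun A f")
    case False
    then show ?thesis using tangent_nonsmooth[OF v] by (simp add: coord_vec_def)
  next
    case f: True
    let ?F = "f \<circ> inv_into U \<phi>"
    have sub: "ball (\<phi> p) r \<subseteq> \<phi> ` U" using r x(3) by blast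
    have iB: "\<phi> ` B = ball (\<phi> p) r" using sub by (auto simp: BU)
    obtain h where h: "\<And>b. smooth_on (ball (\<phi> p) r) (h b)"
      "\<And>b. h b (\<phi> p) = frechet_derivative ?F (at (\<phi> p)) b"
      "\<And>y. y \<in> ball (\<phi> p) r \<Longrightarrow> ?F y = ?F (\<phi> p) + (\<Sum>b\<in>Basis. ((y - \<phi> p) \<bullet> b) * h b y)"
      by (rule Hadamard[OF smooth_on_subset[OF smooth_fun_chart[OF f U(1)] sub] r(1)]) blast
    define H where "H b q = (if q \<in> B then \<xi> q * h b (\<phi> q) else 0)" for b q
    have BU': "B \<subseteq> U" using BU by auto
    have sc: "smooth_on (\<phi> ` B) (\<lambda>y. (\<xi> \<circ> inv_into U \<phi>) y * h b y)" for b
      unfolding iB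
      by (rule smooth_on_mult[OF open_ball smooth_on_subset[OF smooth_fun_chart[OF c(1) U(1)] sub] h(1)])
    have sH: "smooth_fun A (H b)" for b
      by (rule smooth_fun_zero_extend[OF U(1) oB BU' sc c(2,3)])
         (use U(1) BU' c(8) in \<open>auto simp: H_def subset_iff\<close>)
    have loc: "f q = f p + (\<Sum>b\<in>Basis. x b q * H b q)" if q: "q \<in> N" for q
    proof -
      have qB: "q \<in> B" "q \<in> U" "q \<in> W" using q c BU' BW by auto
      have "?F (\<phi> q) = ?F (\<phi> p) + (\<Sum>b\<in>Basis. ((\<phi> q - \<phi> p) \<bullet> b) * h b (\<phi> q))"
        by (rule h(3)) (use qB iB in blast)
      then show ?thesis using U qB q c(7) x(5) by (simp add: H_def)
    qed
    have s1: "smooth_fun A (\<lambda>q. \<Sum>b\<in>Basis. x b q * H b q)"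
      by (intro smooth_fun_sum smooth_fun_mult x sH)
    have "v f = v (\<lambda>q. f p + (\<Sum>b\<in>Basis. x b q * H b q))"
      by (rule tangent_local[OF v f smooth_fun_add[OF smooth_fun_const s1] c(4,5) loc])
    also have "\<dots> = (\<Sum>b\<in>Basis. v (\<lambda>q. x b q * H b q))"
      by (simp add: tangent_add[OF v smooth_fun_const s1] tangent_const[OF v]
          tangent_sum[OF v] smooth_fun_mult x sH)
    also have "\<dots> = (\<Sum>b\<in>Basis. v (x b) * frechet_derivative ?F (at (\<phi> p)) b)"
    proof (rule sum.cong[OF refl])
      fix b :: 'e
      have "x b p = 0" "H b p = frechet_derivative ?F (at (\<phi> p)) b"
        using x(2,5) pB c(5,7) h(2) by (auto simp: H_def)
      then show "v (\<lambda>q. x b q * H b q) = v (x b) * frechet_derivative ?F (at (\<phi> p)) b"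
        using tangent_mult[OF v x(4) sH] by simp
    qed
    also have "\<dots> = frechet_derivative ?F (at (\<phi> p)) w"
    proof -
      have l: "linear (frechet_derivative ?F (at (\<phi> p)))"
        using smooth_fun_chart_derivative[OF f U] has_derivative_linear by blast
      show ?thesis by (simp add: w_def linear_sum[OF l] linear_scale[OF l])
    qed
    finally show ?thesis using f by (simp add: coord_vec_def)
  qed
  then show ?thesis by blast
qed

lemma coords_coord_vec [simp]:
  assumes "(U, \<phi>) \<in> A" "p \<in> U"
  shows "coords A U \<phi> p (coord_vec A U \<phi> p w) = w"
  unfolding coords_def by (rule the_equality) (use coord_vec_inj[OF assms] in auto)

lemma coord_vec_coords [simp]:
  assumes "(U, \<phi>) \<in> A" "p \<in> U" "v \<in> tangent_space A p"
  shows "coord_vec A U \<phi> p (coords A U \<phi> p v) = v"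
  using tangent_eq_coord_vec[OF assms] coords_coord_vec[OF assms(1,2)] by metis

lemma coord_vec_apply:
  assumes "(U, \<phi>) \<in> A" "p \<in> U" "smooth_fun A f"
  shows "coord_vec A U \<phi> p w f = (\<Sum>b\<in>Basis. (w \<bullet> b) * frechet_derivative (f \<circ> inv_into U \<phi>) (at (\<phi> p)) b)"
  using linear_Basis_expand[OF has_derivative_linear[OF smooth_fun_chart_derivative[OF assms(3,1,2)]], of w] assms(3)
  by (simp add: coord_vec_def)

section \<open>Vector fields in coordinates\<close>

lemma vector_field_tangent: "vector_field A X \<Longrightarrow> X p \<in> tangent_space A p"
  by (simp add: vector_field_def)

lemma vector_field_smooth: "vector_field A X \<Longrightarrow> smooth_fun A f \<Longrightarrow> smooth_fun A (\<lambda>p. X p f)"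
  by (simp add: vector_field_def)

lemma vector_field_lincomb:
  assumes "vector_field A X" "vector_field A Y" "smooth_fun A f" "smooth_fun A h"
  shows "vector_field A (\<lambda>p. lincomb (f p) (X p) (h p) (Y p))"
  using assms unfolding vector_field_def
  by (auto intro!: tangent_lincomb) (auto simp: lincomb_def intro!: smooth_fun_add smooth_fun_mult)

lemma vector_fieldI_coords:
  assumes t: "\<And>p. X p \<in> tangent_space A p"
    and s: "\<And>U \<phi> b. (U, \<phi>) \<in> A \<Longrightarrow> b \<in> Basis \<Longrightarrow>
       smooth_on (\<phi> ` U) (\<lambda>y. coords A U \<phi> (inv_into U \<phi> y) (X (inv_into U \<phi> y)) \<bullet> b)"
  shows "vector_field A X"
  unfolding vector_field_def
proof (intro conjI allI impI t)
  fix f assume f: "smooth_fun A f"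
  show "smooth_fun A (\<lambda>p. X p f)"
    unfolding smooth_fun_def
  proof clarify
    fix U \<phi> assume U: "(U, \<phi>) \<in> A"
    note o = chart_props(2)[OF U]
    let ?c = "\<lambda>y. coords A U \<phi> (inv_into U \<phi> y) (X (inv_into U \<phi> y))"
    have "smooth_on (\<phi> ` U) (\<lambda>y. \<Sum>b\<in>Basis. (?c y \<bullet> b) * frechet_derivative (f \<circ> inv_into U \<phi>) (at y) b)"
      by (intro smooth_on_sum[OF o] smooth_on_mult[OF o] s[OF U] smooth_on_frechet_derivative smooth_fun_chart[OF f U])
    then show "smooth_on (\<phi> ` U) ((\<lambda>p. X p f) \<circ> inv_into U \<phi>)"
    proof (rule smooth_on_cong[OF o, rotated])
      fix y assume "y \<in> \<phi> ` U"
      then obtain p where p: "p \<in> U" "y = \<phi> p" by blast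
      have "X p f = coord_vec A U \<phi> p (coords A U \<phi> p (X p)) f" using U p t by simp
      then show "(\<Sum>b\<in>Basis. (?c y \<bullet> b) * frechet_derivative (f \<circ> inv_into U \<phi>) (at y) b) = ((\<lambda>p. X p f) \<circ> inv_into U \<phi>) y"
        using coord_vec_apply[OF U p(1) f] U p by simp
    qed
  qed
qed

text \<open>Near a point the components of \<open>X\<close> are the functions \<open>X (x b)\<close>
  for the globalised coordinates \<open>x b\<close>, and these are smooth by the definition of a
  vector field.\<close>

lemma smooth_on_coords:
  assumes X: "vector_field A X" and U: "(U, \<phi>) \<in> A"
  shows "smooth_on (\<phi> ` U) (\<lambda>y. coords A U \<phi> (inv_into U \<phi> y) (X (inv_into U \<phi> y)))"
proof (rule smooth_on_local)
  fix y assume "y \<in> \<phi> ` U"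
  then obtain p where p: "p \<in> U" "y = \<phi> p" by blast
  obtain x :: "'e \<Rightarrow> 'a \<Rightarrow> real" and W where x: "open W" "p \<in> W" "W \<subseteq> U" "\<And>u. smooth_fun A (x u)"
    "\<And>u w q. q \<in> W \<Longrightarrow> coord_vec A U \<phi> q w (x u) = w \<bullet> u"
    by (rule coordinate_functions[OF U p(1)]) blast
  have o: "open (\<phi> ` W)" by (rule open_chart_image[OF U x(1,3)])
  have "smooth_on (\<phi> ` W) (\<lambda>y. \<Sum>b\<in>Basis. ((\<lambda>q. X q (x b)) \<circ> inv_into U \<phi>) y *\<^sub>R b)"
    using x(3) by (intro smooth_on_sum[OF o] smooth_on_scaleR[OF o] smooth_on_const
        smooth_on_subset[OF smooth_fun_chart[OF vector_field_smooth[OF X x(4)] U]]) auto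
  then have "smooth_on (\<phi> ` W) (\<lambda>y. coords A U \<phi> (inv_into U \<phi> y) (X (inv_into U \<phi> y)))"
  proof (rule smooth_on_cong[OF o, rotated])
    fix z assume "z \<in> \<phi> ` W"
    then obtain q where q: "q \<in> W" "z = \<phi> q" by blast
    have qU: "q \<in> U" using q x by auto
    have "X q (x b) = coords A U \<phi> q (X q) \<bullet> b" for b
      using x(5)[OF q(1), of "coords A U \<phi> q (X q)"] U qU vector_field_tangent[OF X] by simp
    then show "(\<Sum>b\<in>Basis. ((\<lambda>q. X q (x b)) \<circ> inv_into U \<phi>) z *\<^sub>R b) = coords A U \<phi> (inv_into U \<phi> z) (X (inv_into U \<phi> z))"
      using U qU q by (simp add: euclidean_representation)
  qed
  then show "\<exists>V. open V \<and> y \<in> V \<and> smooth_on V (\<lambda>y. coords A U \<phi> (inv_into U \<phi> y) (X (inv_into U \<phi> y)))"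
    using o x p by blast
qed

text \<open>Brackets, connections and exterior derivatives take global fields; coordinate fields cut
  off by a bump function are global and unchanged near \<open>p\<close>.\<close>

lemma coordinate_fields:
  assumes U: "(U, \<phi>) \<in> A" "p \<in> U"
  obtains E :: "'e \<Rightarrow> 'a vfield" and W where "open W" "p \<in> W" "W \<subseteq> U"
    "\<And>w. vector_field A (E w)" "\<And>w q. q \<in> W \<Longrightarrow> E w q = coord_vec A U \<phi> q w"
proof -
  obtain \<xi> K W where c: "smooth_fun A \<xi>" "closed K" "K \<subseteq> U" "open W" "p \<in> W" "W \<subseteq> K"
    "\<And>q. q \<in> W \<Longrightarrow> \<xi> q = 1" "\<And>q. q \<notin> K \<Longrightarrow> \<xi> q = 0"
    by (rule bump_exists[OF chart_props(1)[OF U(1)] U(2)]) blast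
  define E where "E w q = (if q \<in> U then lincomb (\<xi> q) (coord_vec A U \<phi> q w) 0 zero_tvec else zero_tvec)" for w q
  have "vector_field A (E w)" for w
    unfolding vector_field_def
  proof (intro conjI allI impI)
    show "E w q \<in> tangent_space A q" for q
      using U(1) by (simp add: E_def tangent_lincomb coord_vec_tangent tangent_zero)
    show "smooth_fun A (\<lambda>q. E w q f)" if f: "smooth_fun A f" for f
      by (rule smooth_fun_zero_extend[OF U(1) chart_props(1)[OF U(1)] subset_refl
          smooth_on_mult[OF chart_props(2)[OF U(1)] smooth_fun_chart[OF c(1) U(1)]
            smooth_on_frechet_derivative[OF smooth_fun_chart[OF f U(1)], of w]]
          c(2,3)])
         (use U(1) c(3,8) f in \<open>auto simp: E_def lincomb_def zero_tvec_def coord_vec_def\<close>)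
  qed
  moreover have "E w q = coord_vec A U \<phi> q w" if "q \<in> W" for w q
    using that c by (auto simp: E_def lincomb_def zero_tvec_def)
  ultimately show ?thesis using that c by (metis subset_trans)
qed

text \<open>This allows a pointwise identity between tensors to be derived from hypotheses that
  speak of vector fields only.\<close>

lemma vector_field_through:
  assumes "v \<in> tangent_space A p"
  obtains X where "vector_field A X" "X p = v"
proof -
  obtain U \<phi> where U: "(U, \<phi>) \<in> A" "p \<in> U" by (rule chart_exists)
  obtain E :: "'e \<Rightarrow> 'a vfield" and W where "p \<in> W"
    "\<And>w. vector_field A (E w)" "\<And>w q. q \<in> W \<Longrightarrow> E w q = coord_vec A U \<phi> q w"
    by (rule coordinate_fields[OF U]) blast
  then show ?thesis using that[of "E (coords A U \<phi> p v)"] assms U by simp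
qed

text \<open>In a chart the differential vanishes, so \<open>f\<close> is constant on the preimages
  of small convex balls; connectedness turns local into global constancy.\<close>

lemma constant_if_derivatives_vanish:
  assumes f: "smooth_fun A f" and con: "connected (UNIV :: 'a set)"
    and d: "\<And>p v. v \<in> tangent_space A p \<Longrightarrow> v f = 0"
  shows "f p = f q"
proof -
  have "f constant_on UNIV"
  proof (rule locally_constant_imp_constant[OF con])
    fix p :: 'a assume "p \<in> UNIV"
    obtain U \<phi> where U: "(U, \<phi>) \<in> A" "p \<in> U" by (rule chart_exists)
    obtain r where r: "r > 0" "ball (\<phi> p) r \<subseteq> \<phi> ` U"
      using chart_props(2)[OF U(1)] U(2) open_contains_ball by (metis imageI)
    have "((f \<circ> inv_into U \<phi>) has_derivative (\<lambda>v. 0)) (at y within ball (\<phi> p) r)" if y: "y \<in> ball (\<phi> p) r" for y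
    proof -
      obtain q where q: "q \<in> U" "y = \<phi> q" using y r by blast
      have "frechet_derivative (f \<circ> inv_into U \<phi>) (at (\<phi> q)) w = 0" for w
        using d[OF coord_vec_tangent[OF U(1) q(1), of w]] f by (simp add: coord_vec_def)
      then have "frechet_derivative (f \<circ> inv_into U \<phi>) (at (\<phi> q)) = (\<lambda>v. 0)" by (rule ext)
      then show ?thesis
        using smooth_fun_chart_derivative[OF f U(1) q(1)] q by (metis has_derivative_at_withinI)
    qed
    from has_derivative_zero_unique[OF convex_ball this]
    have c: "(f \<circ> inv_into U \<phi>) y = (f \<circ> inv_into U \<phi>) (\<phi> p)" if "y \<in> ball (\<phi> p) r" for y
      using that r(1) by (metis centre_in_ball)
    have "open (U \<inter> \<phi> -` ball (\<phi> p) r)"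
      by (rule open_chart_preimage[OF U(1) open_ball])
    moreover have "f q = f p" if "q \<in> U \<inter> \<phi> -` ball (\<phi> p) r" for q
      using that c[of "\<phi> q"] U by simp
    moreover have "p \<in> U \<inter> \<phi> -` ball (\<phi> p) r" using U r by simp
    ultimately show "\<exists>T. openin (top_of_set UNIV) T \<and> p \<in> T \<and> (\<forall>x\<in>T. f x = f p)"
      unfolding subtopology_UNIV open_openin[symmetric] by blast
  qed
  then show ?thesis by (auto simp: constant_on_def)
qed

end

section \<open>Riemannian metrics\<close>

locale riem_mfd = smooth_mfd A
  for A :: "('a::{t2_space,second_countable_topology}, real^'n::finite) chart set" +
  fixes g :: "'a form2"
  assumes metric: "riemannian_metric A g"
begin

lemma metric_lin_left:
  "u \<in> tangent_space A p \<Longrightarrow> v \<in> tangent_space A p \<Longrightarrow> w \<in> tangent_space A p \<Longrightarrow>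
    g p (lincomb a u b v) w = a * g p u w + b * g p v w"
  using metric by (simp add: riemannian_metric_def)

lemma metric_sym: "v \<in> tangent_space A p \<Longrightarrow> w \<in> tangent_space A p \<Longrightarrow> g p v w = g p w v"
  using metric by (simp add: riemannian_metric_def)

lemma metric_lin_right:
  "u \<in> tangent_space A p \<Longrightarrow> v \<in> tangent_space A p \<Longrightarrow> w \<in> tangent_space A p \<Longrightarrow>
    g p w (lincomb a u b v) = a * g p w u + b * g p w v"
  using metric_lin_left[of u p v w a b] by (simp add: metric_sym[of w] tangent_lincomb)

lemma metric_pos: "v \<in> tangent_space A p \<Longrightarrow> v \<noteq> zero_tvec \<Longrightarrow> g p v v > 0"
  using metric by (simp add: riemannian_metric_def)

lemma metric_smooth:
  "vector_field A X \<Longrightarrow> vector_field A Y \<Longrightarrow> smooth_fun A (\<lambda>p. g p (X p) (Y p))"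
  using metric by (simp add: riemannian_metric_def)

lemma metric_neg_left:
  assumes "v \<in> tangent_space A p" "w \<in> tangent_space A p"
  shows "g p (\<lambda>f. - v f) w = - g p v w"
  using metric_lin_left[OF assms(1,1,2), of "-1" 0] by (simp add: lincomb_def)

lemma metric_zero_left: "w \<in> tangent_space A p \<Longrightarrow> g p zero_tvec w = 0"
  using metric_lin_left[OF tangent_zero tangent_zero, of w p 0 0] by (simp add: lincomb_def zero_tvec_def)

text \<open>Test with \<open>u = v - w\<close> and use definiteness.\<close>

lemma metric_nondegenerate:
  assumes "v \<in> tangent_space A p" "w \<in> tangent_space A p"
    and "\<And>u. u \<in> tangent_space A p \<Longrightarrow> g p v u = g p w u"
  shows "v = w"
proof (rule ccontr)
  assume "v \<noteq> w"
  then have "lincomb 1 v (-1) w \<noteq> zero_tvec" by (auto simp: lincomb_def zero_tvec_def fun_eq_iff)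
  moreover have t: "lincomb 1 v (-1) w \<in> tangent_space A p" by (rule tangent_lincomb[OF assms(1,2)])
  ultimately have "g p (lincomb 1 v (-1) w) (lincomb 1 v (-1) w) > 0" by (rule metric_pos[rotated])
  then show False using metric_lin_left[OF assms(1,2) t, of 1 "-1"] assms(3)[OF t] by simp
qed

lemma linear_on_coord_vec:
  assumes U: "(U, \<phi>) \<in> A" "p \<in> U"
    and lin: "\<And>v w a b. v \<in> tangent_space A p \<Longrightarrow> w \<in> tangent_space A p \<Longrightarrow> L (lincomb a v b w) = a * L v + b * L w"
  shows "L (coord_vec A U \<phi> p w) = (\<Sum>i\<in>UNIV. w $ i * L (coord_vec A U \<phi> p (axis i 1)))"
proof -
  have c: "L (coord_vec A U \<phi> p (a *\<^sub>R v + b *\<^sub>R w)) = a * L (coord_vec A U \<phi> p v) + b * L (coord_vec A U \<phi> p w)" for a b v w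
    using lin[OF coord_vec_tangent[OF U] coord_vec_tangent[OF U]] by (simp add: coord_vec_lincomb[OF U])
  have "linear (\<lambda>w. L (coord_vec A U \<phi> p w))"
  proof (rule linearI)
    show "L (coord_vec A U \<phi> p (x + y)) = L (coord_vec A U \<phi> p x) + L (coord_vec A U \<phi> p y)" for x y
      using c[of 1 x 1 y] by simp
    show "L (coord_vec A U \<phi> p (r *\<^sub>R x)) = r *\<^sub>R L (coord_vec A U \<phi> p x)" for r x
      using c[of r x 0 0] by simp
  qed
  from linear_sum[OF this, of "\<lambda>i. w $ i *\<^sub>R axis i 1" UNIV] linear_scale[OF this]
  show ?thesis using basis_expansion[of w] by (simp add: scalar_mult_eq_scaleR)
qed

definition gram :: "'a set \<Rightarrow> ('a \<Rightarrow> real^'n) \<Rightarrow> 'a \<Rightarrow> real^'n^'n" where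
  "gram U \<phi> p = vec_lambda (\<lambda>i. vec_lambda (\<lambda>j.
     g p (coord_vec A U \<phi> p (axis i 1)) (coord_vec A U \<phi> p (axis j 1))))"

lemma gram_nth: "gram U \<phi> p $ i $ j = g p (coord_vec A U \<phi> p (axis i 1)) (coord_vec A U \<phi> p (axis j 1))"
  by (simp add: gram_def)

lemma metric_coord_left:
  assumes U: "(U, \<phi>) \<in> A" "p \<in> U" and u: "u \<in> tangent_space A p"
  shows "g p (coord_vec A U \<phi> p w) u = (\<Sum>i\<in>UNIV. w $ i * g p (coord_vec A U \<phi> p (axis i 1)) u)"
  by (rule linear_on_coord_vec[OF U, of "\<lambda>v. g p v u"]) (rule metric_lin_left[OF _ _ u])

lemma metric_coord_right:
  assumes U: "(U, \<phi>) \<in> A" "p \<in> U" and u: "u \<in> tangent_space A p"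
  shows "g p u (coord_vec A U \<phi> p w) = (\<Sum>i\<in>UNIV. w $ i * g p u (coord_vec A U \<phi> p (axis i 1)))"
  by (rule linear_on_coord_vec[OF U, of "\<lambda>v. g p u v"]) (rule metric_lin_right[OF _ _ u])

lemma gram_sym: "(U, \<phi>) \<in> A \<Longrightarrow> p \<in> U \<Longrightarrow> gram U \<phi> p $ i $ j = gram U \<phi> p $ j $ i"
  by (simp add: gram_nth metric_sym coord_vec_tangent)

lemma metric_coord_axis:
  assumes U: "(U, \<phi>) \<in> A" "p \<in> U"
  shows "g p (coord_vec A U \<phi> p w) (coord_vec A U \<phi> p (axis j 1)) = (gram U \<phi> p *v w) $ j"
  using metric_coord_left[OF U coord_vec_tangent[OF U], of w "axis j 1"] gram_sym[OF U]
  by (simp add: matrix_vector_mult_def gram_nth mult.commute)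

text \<open>A kernel vector of the Gram matrix would be the coordinate vector of a tangent vector
  orthogonal to everything, which nondegeneracy forces to be 0.\<close>

lemma det_gram_nonzero:
  assumes U: "(U, \<phi>) \<in> A" "p \<in> U"
  shows "det (gram U \<phi> p) \<noteq> 0"
proof -
  have "w = 0" if w: "gram U \<phi> p *v w = 0" for w
  proof (rule coord_vec_inj[OF U], rule metric_nondegenerate)
    show "g p (coord_vec A U \<phi> p w) u = g p (coord_vec A U \<phi> p 0) u" if "u \<in> tangent_space A p" for u
    proof -
      have "g p (coord_vec A U \<phi> p w) (coord_vec A U \<phi> p (coords A U \<phi> p u)) = 0"
        using w by (subst metric_coord_right[OF U coord_vec_tangent[OF U]]) (simp add: metric_coord_axis[OF U])
      then show ?thesis using that U by (simp add: coord_vec_zero metric_zero_left)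
    qed
  qed (rule coord_vec_tangent[OF U])+
  then show ?thesis
    by (metis invertible_det_nz invertible_left_inverse matrix_left_invertible_ker)
qed

lemma smooth_on_gram:
  assumes U: "(U, \<phi>) \<in> A"
  shows "smooth_on (\<phi> ` U) (\<lambda>y. gram U \<phi> (inv_into U \<phi> y) $ i $ j)"
proof (rule smooth_on_local)
  fix y assume "y \<in> \<phi> ` U"
  then obtain p where p: "p \<in> U" "y = \<phi> p" by blast
  obtain E :: "real^'n \<Rightarrow> 'a vfield" and W where E: "open W" "p \<in> W" "W \<subseteq> U"
    "\<And>w. vector_field A (E w)" "\<And>w q. q \<in> W \<Longrightarrow> E w q = coord_vec A U \<phi> q w"
    by (rule coordinate_fields[OF U p(1)]) blast
  have o: "open (\<phi> ` W)" by (rule open_chart_image[OF U E(1,3)])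
  have "smooth_on (\<phi> ` W) ((\<lambda>q. g q (E (axis i 1) q) (E (axis j 1) q)) \<circ> inv_into U \<phi>)"
    by (rule smooth_on_subset[OF smooth_fun_chart[OF metric_smooth[OF E(4,4)] U]]) (use E in blast)
  then have "smooth_on (\<phi> ` W) (\<lambda>y. gram U \<phi> (inv_into U \<phi> y) $ i $ j)"
    by (rule smooth_on_cong[OF o, rotated]) (use U E in \<open>auto simp: gram_nth subset_iff\<close>)
  then show "\<exists>V. open V \<and> y \<in> V \<and> smooth_on V (\<lambda>y. gram U \<phi> (inv_into U \<phi> y) $ i $ j)"
    using o E p by blast
qed

lemma smooth_on_one_form_coord:
  assumes \<theta>: "one_form A \<theta>" and U: "(U, \<phi>) \<in> A"
  shows "smooth_on (\<phi> ` U) (\<lambda>y. \<theta> (inv_into U \<phi> y) (coord_vec A U \<phi> (inv_into U \<phi> y) w))"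
proof (rule smooth_on_local)
  fix y assume "y \<in> \<phi> ` U"
  then obtain p where p: "p \<in> U" "y = \<phi> p" by blast
  obtain E :: "real^'n \<Rightarrow> 'a vfield" and W where E: "open W" "p \<in> W" "W \<subseteq> U"
    "\<And>w. vector_field A (E w)" "\<And>w q. q \<in> W \<Longrightarrow> E w q = coord_vec A U \<phi> q w"
    by (rule coordinate_fields[OF U p(1)]) blast
  have o: "open (\<phi> ` W)" by (rule open_chart_image[OF U E(1,3)])
  have "smooth_fun A (\<lambda>q. \<theta> q (E w q))" using \<theta> E(4) by (simp add: one_form_def)
  then have "smooth_on (\<phi> ` W) ((\<lambda>q. \<theta> q (E w q)) \<circ> inv_into U \<phi>)"
    by (rule smooth_on_subset[OF smooth_fun_chart[OF _ U]]) (use E in blast)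
  then have "smooth_on (\<phi> ` W) (\<lambda>y. \<theta> (inv_into U \<phi> y) (coord_vec A U \<phi> (inv_into U \<phi> y) w))"
    by (rule smooth_on_cong[OF o, rotated]) (use U E in \<open>auto simp: subset_iff\<close>)
  then show "\<exists>V. open V \<and> y \<in> V \<and> smooth_on V (\<lambda>y. \<theta> (inv_into U \<phi> y) (coord_vec A U \<phi> (inv_into U \<phi> y) w))"
    using o E p by blast
qed

lemma smooth_on_det:
  fixes M :: "'b::euclidean_space \<Rightarrow> real^'m::finite^'m"
  assumes "open S" "\<And>i j. smooth_on S (\<lambda>y. M y $ i $ j)"
  shows "smooth_on S (\<lambda>y. det (M y))"
  unfolding det_def by (intro smooth_on_sum smooth_on_mult smooth_on_prod smooth_on_const assms)

lemma sharp_exists: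
  assumes \<theta>: "one_form A \<theta>"
  obtains T where "vector_field A T" "\<And>p v. v \<in> tangent_space A p \<Longrightarrow> g p (T p) v = \<theta> p v"
proof -
  have lin: "\<theta> p (lincomb a v b w) = a * \<theta> p v + b * \<theta> p w"
    if "v \<in> tangent_space A p" "w \<in> tangent_space A p" for p v w a b
    using \<theta> that by (simp add: one_form_def)
  define b where "b U \<phi> p = (vec_lambda (\<lambda>i. \<theta> p (coord_vec A U \<phi> p (axis i 1))) :: real^'n)" for U \<phi> p
  \<comment> \<open>Cramer's rule for the linear system \<open>gram t = b\<close>: it exhibits the
    components as quotients of determinants with smooth entries, which is how smoothness of the dual
    field is obtained.\<close>
  define t where "t U \<phi> p = vec_lambda (\<lambda>k. det (vec_lambda (\<lambda>i. vec_lambda (\<lambda>j.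
      if j = k then b U \<phi> p $ i else gram U \<phi> p $ i $ j)) :: real^'n^'n)
      / det (gram U \<phi> p))" for U \<phi> p
  have Gt: "gram U \<phi> p *v t U \<phi> p = b U \<phi> p" if "(U, \<phi>) \<in> A" "p \<in> U" for U \<phi> p
    unfolding cramer[OF det_gram_nonzero[OF that]] t_def by (rule refl)
  have rep: "g p (coord_vec A U \<phi> p (t U \<phi> p)) v = \<theta> p v"
    if U: "(U, \<phi>) \<in> A" "p \<in> U" and v: "v \<in> tangent_space A p" for U \<phi> p v
  proof -
    have L: "\<theta> p (coord_vec A U \<phi> p w) = (\<Sum>i\<in>UNIV. w $ i * \<theta> p (coord_vec A U \<phi> p (axis i 1)))" for w
      by (rule linear_on_coord_vec[OF U, of "\<theta> p"]) (rule lin)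
    have "g p (coord_vec A U \<phi> p (t U \<phi> p)) (coord_vec A U \<phi> p (coords A U \<phi> p v))
        = \<theta> p (coord_vec A U \<phi> p (coords A U \<phi> p v))"
      unfolding metric_coord_right[OF U coord_vec_tangent[OF U], of _ "coords A U \<phi> p v"]
        L[of "coords A U \<phi> p v"] metric_coord_axis[OF U] Gt[OF U] b_def
      by simp
    then show ?thesis using U v by simp
  qed
  \<comment> \<open>This choice refers to no chart; nondegeneracy then identifies it with the Cramer
    solution in every chart, so no gluing is required.\<close>
  define T where "T p = (SOME v. v \<in> tangent_space A p \<and> (\<forall>w\<in>tangent_space A p. g p v w = \<theta> p w))" for p
  have T: "T p \<in> tangent_space A p \<and> (\<forall>w\<in>tangent_space A p. g p (T p) w = \<theta> p w)" for p
  proof -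
    obtain U \<phi> where U: "(U, \<phi>) \<in> A" "p \<in> U" by (rule chart_exists)
    show ?thesis unfolding T_def
      by (rule someI[of _ "coord_vec A U \<phi> p (t U \<phi> p)"]) (simp add: coord_vec_tangent[OF U] rep[OF U])
  qed
  have Tt: "coords A U \<phi> p (T p) = t U \<phi> p" if U: "(U, \<phi>) \<in> A" "p \<in> U" for U \<phi> p
  proof -
    have "T p = coord_vec A U \<phi> p (t U \<phi> p)"
      by (rule metric_nondegenerate) (use T rep[OF U] coord_vec_tangent[OF U] in auto)
    then show ?thesis using U by simp
  qed
  have "vector_field A T"
  proof (rule vector_fieldI_coords)
    show "T p \<in> tangent_space A p" for p using T by blast
    fix U \<phi> and e :: "real^'n" assume U: "(U, \<phi>) \<in> A" and "e \<in> Basis"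
    then obtain k where e: "e = axis k 1" using axis_index by blast
    note o = chart_props(2)[OF U]
    have "smooth_on (\<phi> ` U) (\<lambda>y. t U \<phi> (inv_into U \<phi> y) $ k)"
      unfolding t_def divide_inverse vec_lambda_beta
    proof (intro smooth_on_mult[OF o] smooth_on_det[OF o] smooth_on_inverse[OF o])
      show "det (gram U \<phi> (inv_into U \<phi> y)) \<noteq> 0" if "y \<in> \<phi> ` U" for y
        using that U by (intro det_gram_nonzero) (auto intro: inv_into_into)
      show "smooth_on (\<phi> ` U) (\<lambda>y. gram U \<phi> (inv_into U \<phi> y) $ i $ j)" for i j
        by (rule smooth_on_gram[OF U])
      fix i j :: 'n
      show "smooth_on (\<phi> ` U) (\<lambda>y. vec_lambda (\<lambda>i. vec_lambda (\<lambda>j.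
          if j = k then b U \<phi> (inv_into U \<phi> y) $ i else gram U \<phi> (inv_into U \<phi> y) $ i $ j)) $ i $ j)"
        using smooth_on_gram[OF U, of i j] smooth_on_one_form_coord[OF \<theta> U, of "axis i 1"]
        by (cases "j = k") (simp_all add: b_def)
    qed
    then show "smooth_on (\<phi> ` U) (\<lambda>y. coords A U \<phi> (inv_into U \<phi> y) (T (inv_into U \<phi> y)) \<bullet> e)"
      by (rule smooth_on_cong[OF o, rotated]) (use Tt[OF U] U in \<open>auto simp: e inner_axis inv_into_into\<close>)
  qed
  then show ?thesis using that T by blast
qed

end

section \<open>Integrals of compactly supported functions\<close>

lemma continuous_on_zero_extend:
  fixes f :: "'a::topological_space \<Rightarrow> 'b::real_normed_vector"
  assumes "open S" "closed K" "K \<subseteq> S" "continuous_on S f" "\<And>x. x \<in> S \<Longrightarrow> x \<notin> K \<Longrightarrow> f x = 0"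
  shows "continuous_on UNIV (\<lambda>x. if x \<in> S then f x else 0)"
proof -
  have "continuous_on (S \<union> - K) (\<lambda>x. if x \<in> S then f x else 0)"
  proof (rule continuous_on_open_Un)
    show "continuous_on S (\<lambda>x. if x \<in> S then f x else 0)"
      using assms(4) by (rule continuous_on_eq) simp
    show "continuous_on (- K) (\<lambda>x. if x \<in> S then f x else 0)"
      using continuous_on_const[of "- K" 0] by (rule continuous_on_eq) (use assms in auto)
  qed (use assms in \<open>auto simp: open_Compl\<close>)
  moreover have "S \<union> - K = UNIV" using assms(3) by auto
  ultimately show ?thesis by simp
qed

lemma integrable_lborel_compact_support:
  fixes f :: "'e::euclidean_space \<Rightarrow> 'f::{banach, second_countable_topology}"
  assumes "continuous_on UNIV f" "compact K" "\<And>x. x \<notin> K \<Longrightarrow> f x = 0"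
  shows "integrable lborel f"
proof -
  have "(\<lambda>x. indicator K x *\<^sub>R f x) = f" using assms(3) by (auto simp: indicator_def)
  then show ?thesis
    using borel_integrable_compact[OF assms(2) continuous_on_subset[OF assms(1) subset_UNIV]] by simp
qed

lemma absolutely_integrable_compact_support:
  fixes f :: "'e::euclidean_space \<Rightarrow> 'f::euclidean_space"
  assumes "open S" "compact K" "K \<subseteq> S" "continuous_on S f" "\<And>x. x \<in> S \<Longrightarrow> x \<notin> K \<Longrightarrow> f x = 0"
  shows "f absolutely_integrable_on S"
proof -
  let ?F = "\<lambda>x. if x \<in> S then f x else 0"
  have c: "continuous_on UNIV ?F"
    by (rule continuous_on_zero_extend[OF assms(1) compact_imp_closed[OF assms(2)] assms(3-5)])
  have "integrable lborel ?F"
    by (rule integrable_lborel_compact_support[OF c assms(2)]) (use assms(5) in auto)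
  then have "integrable lebesgue ?F"
    by (subst integrable_completion) (use c in \<open>auto intro: borel_measurable_continuous_onI\<close>)
  then have "?F absolutely_integrable_on UNIV" by (simp add: set_integrable_def)
  then show ?thesis by (simp only: absolutely_integrable_restrict_UNIV)
qed

text \<open>By translation invariance every difference quotient of \<open>h\<close> along
  \<open>v\<close> has integral 0; dominated convergence passes this on to the derivative.\<close>

lemma integral_derivative_lborel_eq_0:
  fixes h :: "'e::euclidean_space \<Rightarrow> real"
  assumes d: "\<And>x. (h has_derivative h' x) (at x)" and c: "continuous_on UNIV (\<lambda>x. h' x v)"
    and K: "compact K" and z: "\<And>x. x \<notin> K \<Longrightarrow> h x = 0" "\<And>x. x \<notin> K \<Longrightarrow> h' x v = 0"
  shows "(\<integral>x. h' x v \<partial>lborel) = 0"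
proof -
  have ch: "continuous_on UNIV h"
    using d has_derivative_continuous by (blast intro: continuous_at_imp_continuous_on)
  have ih: "integrable lborel h"
    by (rule integrable_lborel_compact_support[OF ch K z(1)])
  define t where "t n = inverse (real (Suc n))" for n
  have t: "t n > 0" "t n \<le> 1" for n by (auto simp: t_def field_simps)
  have t0: "t \<longlonglongrightarrow> 0" unfolding t_def by (rule LIMSEQ_inverse_real_of_nat)
  define s where "s n x = (h (x + t n *\<^sub>R v) - h x) / t n" for n x
  have tr: "integrable lborel (\<lambda>x. h (x + u))" "(\<integral>x. h (x + u) \<partial>lborel) = (\<integral>x. h x \<partial>lborel)" for u
  proof -
    have "integrable (distr lborel borel ((+) u)) h" unfolding lborel_distr_plus by (rule ih)
    then show "integrable lborel (\<lambda>x. h (x + u))"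
      by (subst (asm) integrable_distr_eq)
         (auto simp: add.commute intro: borel_measurable_continuous_onI ch)
    have "(\<integral>x. h x \<partial>lborel) = (\<integral>x. h x \<partial>distr lborel borel ((+) u))"
      by (simp only: lborel_distr_plus)
    also have "\<dots> = (\<integral>x. h (u + x) \<partial>lborel)"
      by (rule integral_distr) (auto intro: borel_measurable_continuous_onI ch)
    finally show "(\<integral>x. h (x + u) \<partial>lborel) = (\<integral>x. h x \<partial>lborel)" by (simp add: add.commute)
  qed
  have s0: "(\<integral>x. s n x \<partial>lborel) = 0" for n
    unfolding s_def using tr ih by simp
  have "bounded ((\<lambda>x. h' x v) ` K)"
    by (rule compact_imp_bounded[OF compact_continuous_image[OF continuous_on_subset[OF c subset_UNIV] K]])
  then obtain M where M: "M > 0" "\<And>x. x \<in> K \<Longrightarrow> \<bar>h' x v\<bar> \<le> M"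
    by (auto simp: bounded_pos)
  have M': "\<bar>h' x v\<bar> \<le> M" for x using M z(2) by (cases "x \<in> K") auto
  have line: "((\<lambda>r. h (x + r *\<^sub>R v)) has_real_derivative h' (x + r *\<^sub>R v) v) (at r)" for x r
  proof -
    have "((\<lambda>r. x + r *\<^sub>R v) has_derivative (\<lambda>r. r *\<^sub>R v)) (at r)"
      by (auto intro!: derivative_eq_intros)
    from has_derivative_compose[OF this d[of "x + r *\<^sub>R v"]] show ?thesis
      using linear_scale[OF has_derivative_linear[OF d[of "x + r *\<^sub>R v"]]]
      by (simp add: has_field_derivative_def mult_commute_abs)
  qed
  \<comment> \<open>\<open>K\<close> swept backwards along \<open>v\<close>. The increments
    \<open>t n\<close> are at most 1, so \<open>K'\<close> contains the supports of all difference
    quotients, and \<open>M\<close> on \<open>K'\<close> dominates them by the mean value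
    theorem.\<close>
  define K' where "K' = (\<lambda>(x, r). x - r *\<^sub>R v) ` (K \<times> {0..1::real})"
  have K': "compact K'" unfolding K'_def case_prod_unfold
    by (intro compact_continuous_image compact_Times K compact_Icc continuous_intros)
  have bound: "norm (s n x) \<le> indicator K' x *\<^sub>R M" for n x
  proof (cases "x \<in> K'")
    case True
    obtain r where r: "0 < r" "r < t n" "h (x + t n *\<^sub>R v) - h (x + 0 *\<^sub>R v) = (t n - 0) * h' (x + r *\<^sub>R v) v"
      using MVT2[OF t(1)[of n] line[of x]] by blast
    then have "s n x = h' (x + r *\<^sub>R v) v" using t(1)[of n] by (simp add: s_def)
    then show ?thesis using M' True by simp
  next
    case False
    have "x + r *\<^sub>R v \<notin> K" if "0 \<le> r" "r \<le> 1" for r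
    proof
      assume "x + r *\<^sub>R v \<in> K"
      then have "(\<lambda>(x, r). x - r *\<^sub>R v) (x + r *\<^sub>R v, r) \<in> K'"
        unfolding K'_def using that by (intro imageI) auto
      then show False using False by simp
    qed
    from this[of 0] this[of "t n"] t[of n] z(1) M(1) show ?thesis by (simp add: s_def zero_le_mult_iff)
  qed
  have lim: "(\<lambda>n. s n x) \<longlonglongrightarrow> h' x v" for x
  proof -
    have "((\<lambda>r. (h (x + r *\<^sub>R v) - h x) / r) \<longlongrightarrow> h' x v) (at 0)"
      using line[of x 0] by (simp add: DERIV_def)
    then show ?thesis unfolding s_def
      by (rule filterlim_compose) (use t t0 in \<open>auto simp: filterlim_at intro!: always_eventually less_imp_neq[symmetric]\<close>)
  qed
  have "(\<lambda>n. \<integral>x. s n x \<partial>lborel) \<longlonglongrightarrow> (\<integral>x. h' x v \<partial>lborel)"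
  proof (rule integral_dominated_convergence[where w="\<lambda>x. indicator K' x *\<^sub>R M"])
    show "integrable lborel (\<lambda>x. indicator K' x *\<^sub>R M)"
      using borel_integrable_compact[OF K' continuous_on_const] .
    show "(\<lambda>x. h' x v) \<in> borel_measurable lborel" "s n \<in> borel_measurable lborel" for n
      unfolding s_def using c t(1)[of n]
      by (auto intro!: borel_measurable_continuous_onI continuous_intros continuous_on_compose2[OF ch])
  qed (use lim bound in auto)
  then show ?thesis using LIMSEQ_unique[OF _ tendsto_const[of 0]] by (simp add: s0)
qed

lemma integral_derivative_eq_0:
  fixes h :: "'e::euclidean_space \<Rightarrow> real"
  assumes S: "open S" and d: "\<And>x. x \<in> S \<Longrightarrow> (h has_derivative h' x) (at x)"
    and c: "continuous_on S (\<lambda>x. h' x v)"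
    and K: "compact K" "K \<subseteq> S" and z: "\<And>x. x \<in> S \<Longrightarrow> x \<notin> K \<Longrightarrow> h x = 0"
  shows "((\<lambda>x. h' x v) has_integral 0) S"
proof -
  have op: "open (- K)" using compact_imp_closed[OF K(1)] by (simp add: open_Compl)
  let ?H = "\<lambda>x. if x \<in> S then h x else 0"
  let ?H' = "\<lambda>x w. if x \<in> S then h' x w else 0"
  have d0: "(?H has_derivative (\<lambda>v. 0)) (at x)" if "x \<notin> K" for x
    by (rule has_derivative_transform_within_open[OF has_derivative_const[of 0] op]) (use that z in auto)
  have dS: "(?H has_derivative h' x) (at x)" if "x \<in> S" for x
    by (rule has_derivative_transform_within_open[OF d[OF that] S that]) simp
  \<comment> \<open>The hypothesis \<open>z\<close> concerns the values of \<open>h\<close> only;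
    that the derivative vanishes too follows from its uniqueness, the complement of \<open>K\<close>
    being open.\<close>
  have zd: "h' x v = 0" if "x \<in> S" "x \<notin> K" for x
    using has_derivative_unique[OF dS[OF that(1)] d0[OF that(2)]] by simp
  have D: "(?H has_derivative ?H' x) (at x)" for x
    using dS[of x] d0[of x] K by (cases "x \<in> S") auto
  have C: "continuous_on UNIV (\<lambda>x. ?H' x v)"
    by (rule continuous_on_zero_extend[OF S compact_imp_closed[OF K(1)] K(2) c zd])
  have "(\<integral>x. ?H' x v \<partial>lborel) = 0"
    by (rule integral_derivative_lborel_eq_0[OF D C K(1)]) (use z zd in auto)
  moreover have "integrable lborel (\<lambda>x. ?H' x v)"
    by (rule integrable_lborel_compact_support[OF C K(1)]) (use zd in auto)
  ultimately have "((\<lambda>x. ?H' x v) has_integral 0) UNIV"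
    using has_integral_integral_lborel by metis
  then show ?thesis by (simp add: has_integral_restrict_UNIV)
qed

section \<open>Jacobi's formula\<close>

text \<open>Differentiate the permutation expansion and regroup by the differentiated factor: each
  row contributes the determinant in which that row is replaced by its derivative.\<close>

lemma det_has_derivative:
  fixes G :: "'e::real_normed_vector \<Rightarrow> real^'n^'n"
  assumes "\<And>i j. ((\<lambda>y. G y $ i $ j) has_derivative (\<lambda>v. B v i j)) (at x)"
  shows "((\<lambda>y. det (G y)) has_derivative
    (\<lambda>v. \<Sum>k\<in>UNIV. det (vec_lambda (\<lambda>i. vec_lambda (\<lambda>j. if i = k then B v i j else G x $ i $ j))))) (at x)"
proof -
  have "((\<lambda>y. det (G y)) has_derivative
      (\<lambda>v. \<Sum>p\<in>{p. p permutes (UNIV::'n set)}. of_int (sign p) *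
         (\<Sum>k\<in>UNIV. B v k (p k) * (\<Prod>i\<in>UNIV - {k}. G x $ i $ p i)))) (at x)"
    unfolding det_def
    by (intro has_derivative_sum has_derivative_mult_right has_derivative_prod assms)
  moreover have "(\<Sum>p\<in>{p. p permutes (UNIV::'n set)}. of_int (sign p) *
         (\<Sum>k\<in>UNIV. B v k (p k) * (\<Prod>i\<in>UNIV - {k}. G x $ i $ p i)))
      = (\<Sum>k\<in>UNIV. det (vec_lambda (\<lambda>i. vec_lambda (\<lambda>j. if i = k then B v i j else G x $ i $ j))))" for v
  proof -
    have "(\<Prod>i\<in>UNIV. if i = k then B v i (p i) else G x $ i $ p i)
        = B v k (p k) * (\<Prod>i\<in>UNIV - {k}. G x $ i $ p i)" for k :: 'n and p
      by (subst prod.remove[of _ k]) (auto intro!: prod.cong)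
    then show ?thesis
      unfolding det_def sum_distrib_left by (subst sum.swap) simp
  qed
  ultimately show ?thesis by simp
qed

text \<open>Row \<open>k\<close> of \<open>M ** G\<close> is a combination of the rows of
  \<open>G\<close> with coefficients \<open>M $ k $ l\<close>. By multilinearity only
  \<open>l = k\<close> survives; every other \<open>l\<close> produces two equal rows.\<close>

lemma sum_det_replace_row:
  fixes G M :: "real^'n^'n"
  shows "(\<Sum>k\<in>UNIV. det (vec_lambda (\<lambda>i. vec_lambda (\<lambda>j. if i = k then (M ** G) $ i $ j else G $ i $ j))))
     = trace M * det G"
proof -
  have "det (vec_lambda (\<lambda>i. vec_lambda (\<lambda>j. if i = k then (M ** G) $ i $ j else G $ i $ j))) = M $ k $ k * det G" for k
  proof -
    have "(vec_lambda (\<lambda>i. vec_lambda (\<lambda>j. if i = k then (M ** G) $ i $ j else G $ i $ j)) :: real^'n^'n)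
        = vec_lambda (\<lambda>i. if i = k then \<Sum>l\<in>UNIV. M $ i $ l *s G $ l else G $ i)"
      by (simp add: vec_eq_iff matrix_matrix_mult_def)
    then have "det (vec_lambda (\<lambda>i. vec_lambda (\<lambda>j. if i = k then (M ** G) $ i $ j else G $ i $ j)))
        = (\<Sum>l\<in>UNIV. det (vec_lambda (\<lambda>i. if i = k then M $ i $ l *s G $ l else G $ i) :: real^'n^'n))"
      by (simp add: det_linear_row_sum)
    also have "\<dots> = (\<Sum>l\<in>UNIV. if l = k then M $ k $ k * det G else 0)"
    proof (rule sum.cong[OF refl])
      fix l
      have "det (vec_lambda (\<lambda>i. if i = k then M $ i $ l *s G $ l else G $ i) :: real^'n^'n)
          = M $ k $ l * det (vec_lambda (\<lambda>i. if i = k then G $ l else G $ i) :: real^'n^'n)"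
        using det_row_mul[of k "M $ k $ l" "\<lambda>i. G $ l" "\<lambda>i. G $ i"] by (simp cong: if_cong)
      also have "\<dots> = (if l = k then M $ k $ k * det G else 0)"
      proof (cases "l = k")
        case True
        then have "(vec_lambda (\<lambda>i. if i = k then G $ l else G $ i) :: real^'n^'n) = G"
          by (simp add: vec_eq_iff)
        then show ?thesis using True by simp
      next
        case False
        then have "det (vec_lambda (\<lambda>i. if i = k then G $ l else G $ i) :: real^'n^'n) = 0"
          by (intro det_identical_rows[of k l]) (auto simp: row_def)
        then show ?thesis using False by simp
      qed
      finally show "det (vec_lambda (\<lambda>i. if i = k then M $ i $ l *s G $ l else G $ i) :: real^'n^'n) = (if l = k then M $ k $ k * det G else 0)" .
    qed
    finally show ?thesis by simp
  qed
  then show ?thesis by (simp add: trace_def sum_distrib_right)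
qed

text \<open>For symmetric \<open>G\<close> the derivatives of \<open>det\<close> at \<open>G\<close> along \<open>B\<close> and along the transpose of \<open>B\<close>
  agree, because \<open>det\<close> is invariant under transposition.\<close>

lemma Jacobi_symmetric:
  fixes G M :: "real^'n^'n"
  assumes sym: "transpose G = G"
  shows "(\<Sum>k\<in>UNIV. det (vec_lambda (\<lambda>i. vec_lambda (\<lambda>j.
     if i = k then (M ** G) $ i $ j + (M ** G) $ j $ i else G $ i $ j)))) = 2 * trace M * det G"
proof -
  define L where "L B = (\<Sum>k\<in>UNIV. det (vec_lambda (\<lambda>i. vec_lambda (\<lambda>j.
     if i = k then B $ i $ j else G $ i $ j)) :: real^'n^'n))" for B :: "real^'n^'n"
  have der: "((\<lambda>X::real^'n^'n. det X) has_derivative L) (at G)"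
    unfolding L_def by (rule det_has_derivative) (auto intro!: derivative_eq_intros bounded_linear_imp_has_derivative
        bounded_linear_compose[OF bounded_linear_vec_nth bounded_linear_vec_nth])
  have tr: "bounded_linear (transpose :: real^'n^'n \<Rightarrow> real^'n^'n)"
    by (rule linear_conv_bounded_linear[THEN iffD1], rule linearI) (auto simp: transpose_def vec_eq_iff)
  have "((\<lambda>X::real^'n^'n. det (transpose X)) has_derivative (\<lambda>B. L (transpose B))) (at G)"
    by (rule has_derivative_compose[OF bounded_linear_imp_has_derivative[OF tr]]) (simp add: sym der)
  then have "((\<lambda>X::real^'n^'n. det X) has_derivative (\<lambda>B. L (transpose B))) (at G)"
    by (simp only: det_transpose)
  from has_derivative_unique[OF this der] have LT: "L (transpose B) = L B" for B
    by metis
  have "L (M ** G + transpose (M ** G)) = 2 * L (M ** G)"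
    using linear_add[OF has_derivative_linear[OF der]] LT by simp
  also have "L (M ** G) = trace M * det G"
    unfolding L_def by (rule sum_det_replace_row)
  finally have "L (M ** G + transpose (M ** G)) = 2 * trace M * det G" by simp
  moreover have "(M ** G + transpose (M ** G)) $ i $ j = (M ** G) $ i $ j + (M ** G) $ j $ i" for i j
    by (simp add: transpose_def)
  ultimately show ?thesis by (simp only: L_def)
qed

section \<open>Integration over charts\<close>

context riem_mfd
begin

text \<open>The coordinate density of the Riemannian volume; with the absolute value its positivity
  is immediate from \<open>det_gram_nonzero\<close>.\<close>

definition density :: "'a set \<Rightarrow> ('a \<Rightarrow> real^'n) \<Rightarrow> 'a \<Rightarrow> real" where
  "density U \<phi> p = sqrt \<bar>det (gram U \<phi> p)\<bar>"

text \<open>Integration against the Riemannian volume within one chart, meant for \<open>f\<close>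
  supported in a compact subset of \<open>U\<close>. \<open>chart_integral_independent\<close>
  compares two charts that both contain the support.\<close>

definition chart_integral :: "'a set \<Rightarrow> ('a \<Rightarrow> real^'n) \<Rightarrow> ('a \<Rightarrow> real) \<Rightarrow> real" where
  "chart_integral U \<phi> f = integral (\<phi> ` U) (\<lambda>y. f (inv_into U \<phi> y) * density U \<phi> (inv_into U \<phi> y))"

lemma density_pos: "(U, \<phi>) \<in> A \<Longrightarrow> p \<in> U \<Longrightarrow> density U \<phi> p > 0"
  using det_gram_nonzero[of U \<phi> p] by (simp add: density_def)

lemma smooth_on_det_gram:
  assumes "(U, \<phi>) \<in> A"
  shows "smooth_on (\<phi> ` U) (\<lambda>y. det (gram U \<phi> (inv_into U \<phi> y)))"
  by (rule smooth_on_det[OF chart_props(2)[OF assms] smooth_on_gram[OF assms]])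

lemma continuous_on_density:
  assumes "(U, \<phi>) \<in> A"
  shows "continuous_on (\<phi> ` U) (\<lambda>y. density U \<phi> (inv_into U \<phi> y))"
  unfolding density_def
  by (intro continuous_intros smooth_on_continuous[OF smooth_on_det_gram[OF assms]])

lemma chart_integrand_absolutely_integrable:
  assumes U: "(U, \<phi>) \<in> A" and f: "continuous_on UNIV f" and K: "compact K" "K \<subseteq> U"
    and z: "\<And>q. q \<notin> K \<Longrightarrow> f q = 0" and S: "open S" "\<phi> ` K \<subseteq> S" "S \<subseteq> \<phi> ` U"
  shows "(\<lambda>y. f (inv_into U \<phi> y) * density U \<phi> (inv_into U \<phi> y)) absolutely_integrable_on S"
proof (rule absolutely_integrable_compact_support[OF S(1) _ S(2)])
  show "compact (\<phi> ` K)"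
    by (rule compact_continuous_image[OF continuous_on_subset[OF chart_props(4)[OF U] K(2)] K(1)])
  have "continuous_on (\<phi> ` U) (\<lambda>y. f (inv_into U \<phi> y))"
    by (rule continuous_on_compose2[OF f chart_props(5)[OF U]]) simp
  then show "continuous_on S (\<lambda>y. f (inv_into U \<phi> y) * density U \<phi> (inv_into U \<phi> y))"
    by (intro continuous_on_mult continuous_on_subset[OF continuous_on_density[OF U] S(3)]) (rule continuous_on_subset[OF _ S(3)])
  show "f (inv_into U \<phi> y) * density U \<phi> (inv_into U \<phi> y) = 0" if "y \<in> S" "y \<notin> \<phi> ` K" for y
  proof -
    have "inv_into U \<phi> y \<notin> K" using that S(3) f_inv_into_f[of y \<phi> U] by (metis imageI subsetD)
    then show ?thesis using z by simp
  qed
qed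

lemma chart_integral_subset:
  assumes U: "(U, \<phi>) \<in> A" and z: "\<And>q. q \<in> U \<Longrightarrow> q \<notin> W \<Longrightarrow> f q = 0" and W: "W \<subseteq> U"
  shows "chart_integral U \<phi> f = integral (\<phi> ` W) (\<lambda>y. f (inv_into U \<phi> y) * density U \<phi> (inv_into U \<phi> y))"
proof -
  have "(if y \<in> \<phi> ` U then f (inv_into U \<phi> y) * density U \<phi> (inv_into U \<phi> y) else 0)
      = (if y \<in> \<phi> ` W then f (inv_into U \<phi> y) * density U \<phi> (inv_into U \<phi> y) else 0)" for y
  proof (cases "y \<in> \<phi> ` U \<and> y \<notin> \<phi> ` W")
    case True
    then obtain q where "q \<in> U" "q \<notin> W" "y = \<phi> q" by blast
    then show ?thesis using z[of q] U by simp
  qed (use W in auto)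
  then have "integral UNIV (\<lambda>y. if y \<in> \<phi> ` U then f (inv_into U \<phi> y) * density U \<phi> (inv_into U \<phi> y) else 0)
      = integral UNIV (\<lambda>y. if y \<in> \<phi> ` W then f (inv_into U \<phi> y) * density U \<phi> (inv_into U \<phi> y) else 0)"
    by (simp only:)
  then show ?thesis
    by (simp only: chart_integral_def Henstock_Kurzweil_Integration.integral_restrict_UNIV)
qed

lemma coord_vec_transition:
  assumes U: "(U, \<phi>) \<in> A" and V: "(V, \<psi>) \<in> A" and p: "p \<in> U" "p \<in> V"
  shows "coord_vec A U \<phi> p w = coord_vec A V \<psi> p (frechet_derivative (\<psi> \<circ> inv_into U \<phi>) (at (\<phi> p)) w)"
proof
  fix f
  show "coord_vec A U \<phi> p w f = coord_vec A V \<psi> p (frechet_derivative (\<psi> \<circ> inv_into U \<phi>) (at (\<phi> p)) w) f"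
  proof (cases "smooth_fun A f")
    case f: True
    have UV: "open (U \<inter> V)" "U \<inter> V \<subseteq> U" using chart_props(1) U V by auto
    have d: "((\<psi> \<circ> inv_into U \<phi>) has_derivative frechet_derivative (\<psi> \<circ> inv_into U \<phi>) (at (\<phi> p))) (at (\<phi> p))"
      by (rule smooth_on_has_derivative[OF smooth_transition[OF U V]]) (use p in blast)
    have "((f \<circ> inv_into V \<psi>) has_derivative frechet_derivative (f \<circ> inv_into V \<psi>) (at (\<psi> p)))
        (at ((\<psi> \<circ> inv_into U \<phi>) (\<phi> p)))"
      using smooth_fun_chart_derivative[OF f V p(2)] U p by simp
    from has_derivative_compose[OF d this]
    have "((f \<circ> inv_into U \<phi>) has_derivative
       (\<lambda>w. frechet_derivative (f \<circ> inv_into V \<psi>) (at (\<psi> p)) (frechet_derivative (\<psi> \<circ> inv_into U \<phi>) (at (\<phi> p)) w))) (at (\<phi> p))"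
      by (rule has_derivative_transform_within_open[OF _ open_chart_image[OF U UV]])
         (use p U V in auto)
    then show ?thesis by (simp add: coord_vec_def frechet_derivative_eq)
  qed (simp add: coord_vec_def)
qed

text \<open>The Gram matrix transforms as a bilinear form, by \<open>transpose M ** G ** M\<close>
  for the Jacobian matrix \<open>M\<close> of the transition map. Its determinant gains the square
  of \<open>det M\<close>, so the root gains exactly the factor of the change of variables
  formula.\<close>

lemma density_transition:
  assumes U: "(U, \<phi>) \<in> A" and V: "(V, \<psi>) \<in> A" and p: "p \<in> U" "p \<in> V"
  shows "density U \<phi> p = \<bar>det (matrix (frechet_derivative (\<psi> \<circ> inv_into U \<phi>) (at (\<phi> p))))\<bar> * density V \<psi> p"
proof -
  let ?L = "frechet_derivative (\<psi> \<circ> inv_into U \<phi>) (at (\<phi> p))"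
  let ?M = "matrix ?L"
  have "gram U \<phi> p $ i $ j = (transpose ?M ** gram V \<psi> p ** ?M) $ i $ j" for i j
  proof -
    have "gram U \<phi> p $ i $ j = g p (coord_vec A V \<psi> p (?L (axis i 1))) (coord_vec A V \<psi> p (?L (axis j 1)))"
      by (simp only: gram_nth coord_vec_transition[OF U V p])
    also have "\<dots> = (\<Sum>l\<in>UNIV. ?L (axis j 1) $ l * (gram V \<psi> p *v ?L (axis i 1)) $ l)"
      by (subst metric_coord_right[OF V p(2) coord_vec_tangent[OF V p(2)]]) (simp only: metric_coord_axis[OF V p(2)])
    also have "\<dots> = (\<Sum>l\<in>UNIV. (\<Sum>k\<in>UNIV. ?M $ k $ i * gram V \<psi> p $ k $ l) * ?M $ l $ j)"
      by (rule sum.cong) (auto simp: matrix_def matrix_vector_mult_def gram_sym[OF V p(2)] sum_distrib_left sum_distrib_right mult_ac)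
    finally show ?thesis by (simp add: matrix_matrix_mult_def transpose_def)
  qed
  then have "gram U \<phi> p = transpose ?M ** gram V \<psi> p ** ?M" by (simp add: vec_eq_iff)
  then have "\<bar>det (gram U \<phi> p)\<bar> = \<bar>det ?M\<bar>\<^sup>2 * \<bar>det (gram V \<psi> p)\<bar>"
    by (simp add: det_mul det_transpose abs_mult power2_eq_square)
  then show ?thesis by (simp add: density_def real_sqrt_mult)
qed

end

locale riem_mfd_vol = riem_mfd A g
  for A :: "('a::{t2_space,second_countable_topology}, real^'n::{finite,wellorder}) chart set" and g
begin

text \<open>Both integrals reduce to the overlap, where the transition map is a change of variables
  and \<open>density_transition\<close> absorbs its Jacobian determinant.\<close>

lemma chart_integral_independent:
  assumes U: "(U, \<phi>) \<in> A" and V: "(V, \<psi>) \<in> A" and f: "continuous_on UNIV f"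
    and K: "compact K" "K \<subseteq> U" "K \<subseteq> V" and z: "\<And>q. q \<notin> K \<Longrightarrow> f q = 0"
  shows "chart_integral U \<phi> f = chart_integral V \<psi> f"
proof -
  let ?W = "U \<inter> V"
  let ?S = "\<phi> ` ?W"
  let ?t = "\<psi> \<circ> inv_into U \<phi>"
  let ?F = "\<lambda>y. f (inv_into V \<psi> y) * density V \<psi> (inv_into V \<psi> y)"
  have W: "open ?W" "?W \<subseteq> U" "?W \<subseteq> V" using chart_props(1) U V by auto
  have oS: "open ?S" and oT: "open (\<psi> ` ?W)" using open_chart_image U V W by auto
  have img: "?t ` ?S = \<psi> ` ?W" using U by (auto simp: image_image)
  have KW: "\<psi> ` K \<subseteq> \<psi> ` ?W" using K by blast
  have iU: "chart_integral U \<phi> f = integral ?S (\<lambda>y. f (inv_into U \<phi> y) * density U \<phi> (inv_into U \<phi> y))"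
    by (rule chart_integral_subset[OF U _ W(2)]) (use z K in auto)
  have iV: "chart_integral V \<psi> f = integral (\<psi> ` ?W) ?F"
    by (rule chart_integral_subset[OF V _ W(3)]) (use z K in auto)
  have ai: "?F absolutely_integrable_on \<psi> ` ?W"
    by (rule chart_integrand_absolutely_integrable[OF V f K(1,3) z oT KW]) (use W in auto)
  have der: "(?t has_derivative frechet_derivative ?t (at x)) (at x within ?S)" if "x \<in> ?S" for x
    using smooth_on_has_derivative[OF smooth_transition[OF U V] that] by (rule has_derivative_at_withinI)
  have inj: "inj_on ?t ?S"
    using chart_props(3)[OF V] U by (auto simp: inj_on_def)
  \<comment> \<open>The change of variables theorem has vector-valued integrands; \<open>vec\<close>
    passes to \<open>real^1\<close>.\<close>
  have "vec (integral ?S (\<lambda>x. \<bar>det (matrix (frechet_derivative ?t (at x)))\<bar> * ?F (?t x))) =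
     (vec (integral (?t ` ?S) ?F) :: real^1)"
    using has_absolute_integral_change_of_variables[OF _ der inj, of "\<lambda>y. vec (?F y) :: real^1" "vec (integral (?t ` ?S) ?F)"]
      ai img oS
    by (simp add: absolutely_integrable_on_1_iff integral_on_1_eq)
  then have "integral ?S (\<lambda>x. \<bar>det (matrix (frechet_derivative ?t (at x)))\<bar> * ?F (?t x)) = integral (?t ` ?S) ?F"
    by (simp only: vec_inj)
  then have "integral ?S (\<lambda>x. \<bar>det (matrix (frechet_derivative ?t (at x)))\<bar> * ?F (?t x)) = chart_integral V \<psi> f"
    by (simp only: img iV)
  moreover have "integral ?S (\<lambda>x. \<bar>det (matrix (frechet_derivative ?t (at x)))\<bar> * ?F (?t x))
      = integral ?S (\<lambda>y. f (inv_into U \<phi> y) * density U \<phi> (inv_into U \<phi> y))"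
    by (rule Henstock_Kurzweil_Integration.integral_cong) (use U V in \<open>auto simp: density_transition[OF U V]\<close>)
  ultimately show ?thesis using iU by simp
qed

end

section \<open>The divergence theorem\<close>

context riem_mfd
begin

text \<open>The trace at \<open>p\<close> of \<open>Y \<mapsto> D Y X\<close>, in any chart. As
  \<open>D\<close> takes global fields, the coordinate basis enters through arbitrary extensions
  \<open>E\<close> that are prescribed at \<open>p\<close> only.\<close>

definition has_divergence :: "'a conn \<Rightarrow> 'a vfield \<Rightarrow> ('a \<Rightarrow> real) \<Rightarrow> bool" where
  "has_divergence D X \<tau> \<longleftrightarrow> (\<forall>U \<phi> p E. (U, \<phi>) \<in> A \<longrightarrow> p \<in> U \<longrightarrow>
     (\<forall>i. vector_field A (E i) \<and> E i p = coord_vec A U \<phi> p (axis i 1)) \<longrightarrow>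
     (\<Sum>i\<in>UNIV. coords A U \<phi> p (D (E i) X p) $ i) = \<tau> p)"

lemma coords_lincomb:
  assumes U: "(U, \<phi>) \<in> A" "p \<in> U" and v: "v \<in> tangent_space A p" and w: "w \<in> tangent_space A p"
  shows "coords A U \<phi> p (lincomb a v b w) = a *\<^sub>R coords A U \<phi> p v + b *\<^sub>R coords A U \<phi> p w"
proof -
  have "lincomb a v b w = coord_vec A U \<phi> p (a *\<^sub>R coords A U \<phi> p v + b *\<^sub>R coords A U \<phi> p w)"
    using coord_vec_lincomb[OF U] v w U by simp
  then show ?thesis using U by simp
qed

lemma coords_zero: "(U, \<phi>) \<in> A \<Longrightarrow> p \<in> U \<Longrightarrow> coords A U \<phi> p zero_tvec = 0"
  using coords_coord_vec[of U \<phi> p 0] by (simp add: coord_vec_zero)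

text \<open>Besides \<open>f\<close> times the old endomorphism, the Leibniz rule produces
  \<open>Y \<mapsto> (Y f) X\<close>, of rank one and trace \<open>X f\<close>.\<close>

lemma has_divergence_scale:
  assumes D: "levi_civita A g D" and X: "vector_field A X" and f: "smooth_fun A f"
    and div: "has_divergence D X \<tau>"
  shows "has_divergence D (\<lambda>p. lincomb (f p) (X p) 0 zero_tvec) (\<lambda>p. f p * \<tau> p + X p f)"
  unfolding has_divergence_def
proof (intro allI impI)
  fix U \<phi> p E
  assume U: "(U, \<phi>) \<in> A" "p \<in> U" and E: "\<forall>i. vector_field A (E i) \<and> E i p = coord_vec A U \<phi> p (axis i 1)"
  have L: "D (E i) (\<lambda>p. lincomb (f p) (X p) 0 zero_tvec) p = lincomb (E i p f) (X p) (f p) (D (E i) X p)" for i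
    using D E X f by (simp add: levi_civita_def affine_connection_def)
  have t: "X p \<in> tangent_space A p" "D (E i) X p \<in> tangent_space A p" for i
    using D E X by (simp_all add: levi_civita_def affine_connection_def vector_field_tangent)
  have s: "(\<Sum>i\<in>UNIV. coords A U \<phi> p (D (E i) X p) $ i) = \<tau> p"
    using div U E by (simp add: has_divergence_def)
  have "X p f = coord_vec A U \<phi> p (coords A U \<phi> p (X p)) f" using t U by simp
  also have "\<dots> = (\<Sum>i\<in>UNIV. coords A U \<phi> p (X p) $ i * coord_vec A U \<phi> p (axis i 1) f)"
    by (rule linear_on_coord_vec[OF U, of "\<lambda>v. v f"]) (simp add: lincomb_def)
  finally have "X p f = (\<Sum>i\<in>UNIV. E i p f * coords A U \<phi> p (X p) $ i)"
    using E by (simp add: mult.commute)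
  then show "(\<Sum>i\<in>UNIV. coords A U \<phi> p (D (E i) (\<lambda>p. lincomb (f p) (X p) 0 zero_tvec) p) $ i) = f p * \<tau> p + X p f"
    by (simp add: L coords_lincomb[OF U] t sum.distrib sum_distrib_left[symmetric] s)
qed

text \<open>The bracket of \<open>X\<close> with a coordinate field is minus the derivative of the
  components of \<open>X\<close>. Torsion-freeness thus trades \<open>D E X\<close>, which enters
  the divergence, for \<open>D X E\<close>, which controls the derivative of the Gram
  determinant.\<close>

lemma coords_torsion_free:
  assumes D: "levi_civita A g D" and X: "vector_field A X" and U: "(U, \<phi>) \<in> A" "p \<in> U"
    and W: "open W" "p \<in> W" "W \<subseteq> U"
    and E: "vector_field A E" "\<And>q. q \<in> W \<Longrightarrow> E q = coord_vec A U \<phi> q w"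
  shows "coords A U \<phi> p (D X E p) = coords A U \<phi> p (D E X p)
    - frechet_derivative (\<lambda>y. coords A U \<phi> (inv_into U \<phi> y) (X (inv_into U \<phi> y))) (at (\<phi> p)) w"
    (is "_ = _ - frechet_derivative ?x _ _")
proof -
  obtain x :: "real^'n \<Rightarrow> 'a \<Rightarrow> real" and N where x: "open N" "p \<in> N" "N \<subseteq> U" "\<And>u. smooth_fun A (x u)"
    "\<And>u q. q \<in> N \<Longrightarrow> x u q = (\<phi> q - \<phi> p) \<bullet> u"
    "\<And>u w q. q \<in> N \<Longrightarrow> coord_vec A U \<phi> q w (x u) = w \<bullet> u"
    by (rule coordinate_functions[OF U]) blast
  have ev: "v (x u) = coords A U \<phi> q v \<bullet> u" if "q \<in> N" "v \<in> tangent_space A q" for u q v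
    using x(6)[OF that(1), of "coords A U \<phi> q v" u] that x(3) U by auto
  have DX: "vector_field A (D X E)" "vector_field A (D E X)"
    using D X E by (simp_all add: levi_civita_def affine_connection_def)
  note t = DX[THEN vector_field_tangent] X[THEN vector_field_tangent] E(1)[THEN vector_field_tangent]
  have o: "open (\<phi> ` N)" by (rule open_chart_image[OF U(1) x(1,3)])
  have "coords A U \<phi> p (D X E p) \<bullet> u
      = (coords A U \<phi> p (D E X p) - frechet_derivative ?x (at (\<phi> p)) w) \<bullet> u" for u
  proof -
    have "lincomb 1 (D X E p) (- 1) (D E X p) (x u) = lie_bracket X E p (x u)"
      using D X E(1) by (simp add: levi_civita_def)
    then have "D X E p (x u) - D E X p (x u) = X p (\<lambda>q. E q (x u)) - E p (\<lambda>q. X q (x u))"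
      by (simp add: lincomb_def lie_bracket_def)
    moreover have "X p (\<lambda>q. E q (x u)) = X p (\<lambda>q. w \<bullet> u)"
      by (rule tangent_local[OF t(3) vector_field_smooth[OF E(1) x(4)] smooth_fun_const open_Int[OF W(1) x(1)]])
         (use W x E in auto)
    moreover have "X p (\<lambda>q. w \<bullet> u) = 0" by (rule tangent_const[OF t(3)])
    moreover have "E p (\<lambda>q. X q (x u)) = frechet_derivative ?x (at (\<phi> p)) w \<bullet> u"
    proof -
      have d: "(?x has_derivative frechet_derivative ?x (at (\<phi> p))) (at (\<phi> p))"
        by (rule smooth_on_has_derivative[OF smooth_on_coords[OF X U(1)]]) (use U in blast)
      have "frechet_derivative ((\<lambda>q. X q (x u)) \<circ> inv_into U \<phi>) (at (\<phi> p)) = frechet_derivative (\<lambda>y. ?x y \<bullet> u) (at (\<phi> p))"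
        by (rule frechet_derivative_cong_open[OF o]) (use x(2,3) U ev t in \<open>auto simp: subset_iff\<close>)
      also have "\<dots> = (\<lambda>v. frechet_derivative ?x (at (\<phi> p)) v \<bullet> u)"
        by (rule frechet_derivative_eq[OF has_derivative_inner_left[OF d]])
      finally show ?thesis
        using E(2)[OF W(2)] vector_field_smooth[OF X x(4)] by (simp add: coord_vec_def)
    qed
    ultimately show ?thesis by (simp add: ev[OF x(2)] t inner_diff_left)
  qed
  then show ?thesis by (simp add: vec_eq_iff inner_axis' cart_eq_inner_axis)
qed

lemma density_has_derivative:
  assumes U: "(U, \<phi>) \<in> A" and y: "y \<in> \<phi> ` U"
  shows "((\<lambda>y. density U \<phi> (inv_into U \<phi> y)) has_derivative
    (\<lambda>v. density U \<phi> (inv_into U \<phi> y) *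
       (frechet_derivative (\<lambda>y. det (gram U \<phi> (inv_into U \<phi> y))) (at y) v / (2 * det (gram U \<phi> (inv_into U \<phi> y)))))) (at y)"
proof -
  let ?\<delta> = "\<lambda>y. det (gram U \<phi> (inv_into U \<phi> y))"
  have d: "(?\<delta> has_derivative frechet_derivative ?\<delta> (at y)) (at y)"
    by (rule smooth_on_has_derivative[OF smooth_on_det_gram[OF U] y])
  have nz: "?\<delta> y \<noteq> 0"
    by (rule det_gram_nonzero[OF U]) (use y in \<open>auto intro: inv_into_into\<close>)
  \<comment> \<open>Written as \<open>sqrt |t| / (2 t)\<close>, the derivative has one formula for
    both signs of \<open>t\<close>.\<close>
  have "((\<lambda>t. sqrt \<bar>t\<bar>) has_real_derivative sqrt \<bar>t\<bar> / (2 * t)) (at t)" if "t \<noteq> 0" for t :: real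
  proof (cases "t > 0")
    case True
    have "(sqrt has_real_derivative sqrt \<bar>t\<bar> / (2 * t)) (at t)"
    proof (rule DERIV_cong[OF DERIV_real_sqrt[OF True]])
      have "inverse s / 2 = s / (2 * (s * s))" if "s \<noteq> 0" for s :: real using that by (simp add: field_simps)
      from this[of "sqrt t"] show "inverse (sqrt t) / 2 = sqrt \<bar>t\<bar> / (2 * t)" using True by simp
    qed
    then show ?thesis
      by (rule has_field_derivative_transform_within_open[of _ _ _ "{0<..}"]) (use True in auto)
  next
    case False
    then have t: "t < 0" using that by simp
    have "((\<lambda>t. sqrt (- t)) has_real_derivative sqrt \<bar>t\<bar> / (2 * t)) (at t)"
      using t by (auto intro!: derivative_eq_intros simp: field_simps)
    then show ?thesis
      by (rule has_field_derivative_transform_within_open[of _ _ _ "{..<0}"]) (use t in auto)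
  qed
  from has_derivative_compose[OF d this[OF nz, unfolded has_field_derivative_def]]
  show ?thesis by (simp add: density_def algebra_simps)
qed

text \<open>With the coordinates of \<open>D X (E i)\<close> as the rows of \<open>M\<close>,
  compatibility with the metric says that the derivative of the Gram matrix \<open>G\<close> along
  \<open>X\<close> is \<open>M ** G\<close> plus its transpose; Jacobi's formula does the
  rest.\<close>

lemma det_gram_derivative:
  assumes D: "levi_civita A g D" and X: "vector_field A X" and U: "(U, \<phi>) \<in> A" "p \<in> U"
    and W: "open W" "p \<in> W" "W \<subseteq> U"
    and E: "\<And>i. vector_field A (E i)" "\<And>i q. q \<in> W \<Longrightarrow> E i q = coord_vec A U \<phi> q (axis i 1)"
  shows "frechet_derivative (\<lambda>y. det (gram U \<phi> (inv_into U \<phi> y))) (at (\<phi> p)) (coords A U \<phi> p (X p))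
    = 2 * (\<Sum>i\<in>UNIV. coords A U \<phi> p (D X (E i) p) $ i) * det (gram U \<phi> p)"
proof -
  let ?G = "\<lambda>y. gram U \<phi> (inv_into U \<phi> y)"
  let ?x = "coords A U \<phi> p (X p)"
  define M :: "real^'n^'n" where "M = vec_lambda (\<lambda>i. coords A U \<phi> p (D X (E i) p))"
  define B where "B v i j = frechet_derivative (\<lambda>y. ?G y $ i $ j) (at (\<phi> p)) v" for v i j
  have py: "\<phi> p \<in> \<phi> ` U" using U by blast
  note o = open_chart_image[OF U(1) W(1,3)]
  have tD: "D X (E i) p \<in> tangent_space A p" for i
    using D X E(1) by (simp add: levi_civita_def affine_connection_def vector_field_tangent)
  have tE: "E i p \<in> tangent_space A p" for i by (rule vector_field_tangent[OF E(1)])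
  have gE: "g p (D X (E i) p) (E j p) = (M ** gram U \<phi> p) $ i $ j" for i j
  proof -
    have "g p (D X (E i) p) (E j p) = g p (coord_vec A U \<phi> p (coords A U \<phi> p (D X (E i) p))) (coord_vec A U \<phi> p (axis j 1))"
      using U tD W E(2) by simp
    also have "\<dots> = (gram U \<phi> p *v coords A U \<phi> p (D X (E i) p)) $ j"
      by (rule metric_coord_axis[OF U])
    also have "\<dots> = (M ** gram U \<phi> p) $ i $ j"
      by (simp add: matrix_vector_mult_def matrix_matrix_mult_def M_def gram_sym[OF U, of j] mult.commute)
    finally show ?thesis .
  qed
  have Bx: "B ?x i j = (M ** gram U \<phi> p) $ i $ j + (M ** gram U \<phi> p) $ j $ i" for i j
  proof -
    let ?f = "\<lambda>q. g q (E i q) (E j q)"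
    have "frechet_derivative (\<lambda>y. ?G y $ i $ j) (at (\<phi> p)) = frechet_derivative (?f \<circ> inv_into U \<phi>) (at (\<phi> p))"
      by (rule frechet_derivative_cong_open[OF o]) (use U W E(2) in \<open>auto simp: gram_nth subset_iff\<close>)
    then have "B ?x i j = coord_vec A U \<phi> p ?x ?f"
      by (simp add: B_def coord_vec_def metric_smooth[OF E(1) E(1)])
    also have "\<dots> = X p ?f" using U X by (simp add: vector_field_tangent)
    also have "\<dots> = g p (D X (E i) p) (E j p) + g p (E i p) (D X (E j) p)"
      using D X E(1) by (simp add: levi_civita_def)
    also have "g p (E i p) (D X (E j) p) = g p (D X (E j) p) (E i p)"
      by (rule metric_sym[OF tE tD])
    finally show ?thesis by (simp only: gE)
  qed
  have "((\<lambda>y. ?G y $ i $ j) has_derivative (\<lambda>v. B v i j)) (at (\<phi> p))" for i j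
    unfolding B_def by (rule smooth_on_has_derivative[OF smooth_on_gram[OF U(1)] py])
  from det_has_derivative[of ?G, OF this, unfolded chart_inv[OF U]]
  have "frechet_derivative (\<lambda>y. det (?G y)) (at (\<phi> p)) ?x
      = (\<Sum>k\<in>UNIV. det (vec_lambda (\<lambda>i. vec_lambda (\<lambda>j. if i = k then B ?x i j else gram U \<phi> p $ i $ j))))"
    by (simp only: frechet_derivative_eq)
  also have "\<dots> = 2 * trace M * det (gram U \<phi> p)"
    unfolding Bx by (rule Jacobi_symmetric) (simp add: transpose_def vec_eq_iff gram_sym[OF U])
  finally show ?thesis by (simp add: trace_def M_def)
qed

text \<open>In coordinates \<open>\<tau>\<close> times the density is the sum over \<open>k\<close>
  of the \<open>k\<close>-th partial derivatives of (\<open>k\<close>-th component of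
  \<open>X\<close>) times density. Each of these functions has compact support, so each derivative
  integrates to 0.\<close>

lemma chart_integral_divergence:
  assumes D: "levi_civita A g D" and X: "vector_field A X" and div: "has_divergence D X \<tau>"
    and U: "(U, \<phi>) \<in> A" and K: "compact K" "K \<subseteq> U" and z: "\<And>q. q \<notin> K \<Longrightarrow> X q = zero_tvec"
  shows "chart_integral U \<phi> \<tau> = 0"
proof -
  let ?S = "\<phi> ` U"
  let ?x = "\<lambda>y. coords A U \<phi> (inv_into U \<phi> y) (X (inv_into U \<phi> y))"
  let ?d = "\<lambda>y. density U \<phi> (inv_into U \<phi> y)"
  let ?\<delta> = "\<lambda>y. det (gram U \<phi> (inv_into U \<phi> y))"
  \<comment> \<open>The derivative along \<open>v\<close> of the \<open>k\<close>-th component times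
    the density, by the product rule and \<open>density_has_derivative\<close>.\<close>
  define h' where "h' k y v = ?x y $ k * (?d y * (frechet_derivative ?\<delta> (at y) v / (2 * ?\<delta> y)))
      + (frechet_derivative ?x (at y) v $ k) * ?d y" for k y v
  note oS = chart_props(2)[OF U]
  note sx = smooth_on_coords[OF X U]
  note s\<delta> = smooth_on_det_gram[OF U]
  have nz: "?\<delta> y \<noteq> 0" if "y \<in> ?S" for y
    by (rule det_gram_nonzero[OF U]) (use that in \<open>auto intro: inv_into_into\<close>)
  have int: "((\<lambda>y. h' k y (axis k 1)) has_integral 0) ?S" for k
  proof (rule integral_derivative_eq_0[where h = "\<lambda>y. ?x y $ k * ?d y", OF oS])
    show "((\<lambda>y. ?x y $ k * ?d y) has_derivative h' k y) (at y)" if y: "y \<in> ?S" for y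
    proof -
      have "((\<lambda>y. ?x y $ k) has_derivative (\<lambda>v. frechet_derivative ?x (at y) v $ k)) (at y)"
        by (rule bounded_linear.has_derivative[OF bounded_linear_vec_nth smooth_on_has_derivative[OF sx y]])
      from has_derivative_mult[OF this density_has_derivative[OF U y]]
      show ?thesis by (simp add: h'_def[abs_def])
    qed
    show "continuous_on ?S (\<lambda>y. h' k y (axis k 1))"
      unfolding h'_def
      by (intro continuous_intros smooth_on_continuous[OF sx] smooth_on_continuous[OF s\<delta>] continuous_on_density[OF U]
          smooth_on_continuous[OF smooth_on_frechet_derivative[OF sx]]
          smooth_on_continuous[OF smooth_on_frechet_derivative[OF s\<delta>]]) (use nz in auto)
    show "compact (\<phi> ` K)"
      by (rule compact_continuous_image[OF continuous_on_subset[OF chart_props(4)[OF U] K(2)] K(1)])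
    show "\<phi> ` K \<subseteq> ?S" using K by blast
    show "?x y $ k * ?d y = 0" if y: "y \<in> ?S" "y \<notin> \<phi> ` K" for y
    proof -
      obtain q where "q \<in> U" "y = \<phi> q" "q \<notin> K" using y by blast
      then show ?thesis using U z by (simp add: coords_zero)
    qed
  qed
  have eq: "(\<Sum>k\<in>UNIV. h' k y (axis k 1)) = \<tau> (inv_into U \<phi> y) * ?d y" if y: "y \<in> ?S" for y
  proof -
    obtain p where p: "p \<in> U" "y = \<phi> p" using y by blast
    obtain E :: "real^'n \<Rightarrow> 'a vfield" and W where E: "open W" "p \<in> W" "W \<subseteq> U"
      "\<And>w. vector_field A (E w)" "\<And>w q. q \<in> W \<Longrightarrow> E w q = coord_vec A U \<phi> q w"
      by (rule coordinate_fields[OF U p(1)]) blast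
    have inv: "inv_into U \<phi> y = p" using U p by simp
    have "(\<Sum>i\<in>UNIV. coords A U \<phi> p (D (E (axis i 1)) X p) $ i) = \<tau> p"
      using div U p(1) E by (simp add: has_divergence_def)
    moreover have "coords A U \<phi> p (D X (E (axis i 1)) p) = coords A U \<phi> p (D (E (axis i 1)) X p)
        - frechet_derivative ?x (at y) (axis i 1)" for i
      unfolding p(2) by (rule coords_torsion_free[OF D X U p(1) E(1-4,5)])
    ultimately have c: "(\<Sum>i\<in>UNIV. coords A U \<phi> p (D X (E (axis i 1)) p) $ i)
        = \<tau> p - (\<Sum>i\<in>UNIV. frechet_derivative ?x (at y) (axis i 1) $ i)"
      by (simp add: sum_subtractf)
    have d: "(?\<delta> has_derivative frechet_derivative ?\<delta> (at y)) (at y)"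
      by (rule smooth_on_has_derivative[OF s\<delta> y])
    have l: "linear (frechet_derivative ?\<delta> (at y))" by (rule has_derivative_linear[OF d])
    have "frechet_derivative ?\<delta> (at y) (?x y) = (\<Sum>k\<in>UNIV. ?x y $ k * frechet_derivative ?\<delta> (at y) (axis k 1))"
      using linear_sum[OF l, of "\<lambda>k. ?x y $ k *\<^sub>R axis k 1" UNIV] linear_scale[OF l] basis_expansion[of "?x y"]
      by (simp add: scalar_mult_eq_scaleR)
    moreover have "frechet_derivative ?\<delta> (at y) (?x y)
        = 2 * (\<Sum>i\<in>UNIV. coords A U \<phi> p (D X (E (axis i 1)) p) $ i) * ?\<delta> y"
      unfolding inv p(2)
      using det_gram_derivative[OF D X U p(1) E(1-3), of "\<lambda>i. E (axis i 1)", OF E(4,5)] U p(1) by simp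
    ultimately have S: "(\<Sum>k\<in>UNIV. ?x y $ k * frechet_derivative ?\<delta> (at y) (axis k 1))
        = 2 * (\<tau> p - (\<Sum>i\<in>UNIV. frechet_derivative ?x (at y) (axis i 1) $ i)) * ?\<delta> y"
      by (simp only: c)
    \<comment> \<open>By \<open>S\<close>, differentiating the density contributes
      \<open>\<tau>\<close> minus the Euclidean divergence of the components; differentiating the
      components adds that Euclidean divergence back.\<close>
    have "(\<Sum>k\<in>UNIV. h' k y (axis k 1)) = (\<Sum>k\<in>UNIV. ?x y $ k * frechet_derivative ?\<delta> (at y) (axis k 1)) * (?d y / (2 * ?\<delta> y))
        + (\<Sum>k\<in>UNIV. frechet_derivative ?x (at y) (axis k 1) $ k) * ?d y"
      unfolding h'_def sum.distrib sum_distrib_right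
      by (intro arg_cong2[where f="(+)"] sum.cong refl) simp_all
    also have "\<dots> = \<tau> p * ?d y"
      unfolding S using nz[OF y] by (simp add: field_simps)
    finally show ?thesis by (simp add: inv)
  qed
  have "((\<lambda>y. \<Sum>k\<in>UNIV. h' k y (axis k 1)) has_integral 0) ?S"
    using has_integral_sum[OF finite, of UNIV "\<lambda>k y. h' k y (axis k 1)" "\<lambda>k. 0" ?S] int by simp
  from has_integral_eq[OF eq this]
  have "((\<lambda>y. \<tau> (inv_into U \<phi> y) * ?d y) has_integral 0) ?S" .
  then show ?thesis by (simp add: chart_integral_def integral_unique)
qed

end

section \<open>Linearity and positivity of integrals over charts\<close>

context riem_mfd
begin

lemma chart_integral_sum:
  assumes U: "(U, \<phi>) \<in> A" and K: "compact K" "K \<subseteq> U"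
    and f: "\<And>i. i \<in> I \<Longrightarrow> continuous_on UNIV (f i)" "\<And>i q. i \<in> I \<Longrightarrow> q \<notin> K \<Longrightarrow> f i q = 0" and "finite I"
  shows "chart_integral U \<phi> (\<lambda>q. \<Sum>i\<in>I. f i q) = (\<Sum>i\<in>I. chart_integral U \<phi> (f i))"
proof -
  have "(\<lambda>y. f i (inv_into U \<phi> y) * density U \<phi> (inv_into U \<phi> y)) integrable_on \<phi> ` U" if "i \<in> I" for i
    by (rule set_lebesgue_integral_eq_integral(1)[OF
          chart_integrand_absolutely_integrable[OF U f(1)[OF that] K f(2)[OF that] chart_props(2)[OF U]]])
       (use K in auto)
  then show ?thesis
    unfolding chart_integral_def sum_distrib_right by (intro integral_sum assms)
qed

lemma chart_integral_cmult: "chart_integral U \<phi> (\<lambda>q. f q * c) = chart_integral U \<phi> f * c"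
proof -
  have "(\<lambda>y. f (inv_into U \<phi> y) * c * density U \<phi> (inv_into U \<phi> y))
      = (\<lambda>y. f (inv_into U \<phi> y) * density U \<phi> (inv_into U \<phi> y) * c)"
    by (simp add: mult_ac)
  then show ?thesis by (simp add: chart_integral_def)
qed

text \<open>If the integral were 0, so would be the integral over a box around the image of
  \<open>q\<close>, and a continuous nonnegative integrand would vanish on that box.\<close>

lemma chart_integral_pos:
  assumes U: "(U, \<phi>) \<in> A" and f: "continuous_on UNIV f" "\<And>q. f q \<ge> 0"
    and K: "compact K" "K \<subseteq> U" and z: "\<And>q. q \<notin> K \<Longrightarrow> f q = 0" and q: "f q > 0"
  shows "chart_integral U \<phi> f > 0"
proof -
  let ?F = "\<lambda>y. f (inv_into U \<phi> y) * density U \<phi> (inv_into U \<phi> y)"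
  have qU: "q \<in> U" using q z K by force
  have nn: "?F y \<ge> 0" if "y \<in> \<phi> ` U" for y
    using f(2) density_pos[OF U inv_into_into[OF that]] by (intro mult_nonneg_nonneg) auto
  have int: "?F integrable_on \<phi> ` U"
    by (rule set_lebesgue_integral_eq_integral(1)[OF
          chart_integrand_absolutely_integrable[OF U f(1) K z chart_props(2)[OF U]]])
       (use K in auto)
  have c: "continuous_on (\<phi> ` U) ?F"
    by (intro continuous_on_mult continuous_on_density[OF U] continuous_on_compose2[OF f(1) chart_props(5)[OF U]]) simp
  obtain a b where ab: "cbox a b \<subseteq> \<phi> ` U" "\<phi> q \<in> box a b"
    by (rule open_contains_cbox[OF chart_props(2)[OF U] imageI[OF qU]])
  have intc: "?F integrable_on cbox a b"
    by (rule integrable_continuous[OF continuous_on_subset[OF c ab(1)]])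
  have le: "integral (cbox a b) ?F \<le> chart_integral U \<phi> f"
    unfolding chart_integral_def by (rule integral_subset_le[OF ab(1) intc int]) (use nn in blast)
  have ge: "integral (cbox a b) ?F \<ge> 0"
    by (rule Henstock_Kurzweil_Integration.integral_nonneg[OF intc nn]) (use ab in auto)
  show ?thesis
  proof (rule ccontr)
    assume "\<not> ?thesis"
    with le ge have "integral (cbox a b) ?F = 0" by linarith
    then have "(?F has_integral 0) (cbox a b)" using integrable_integral[OF intc] by simp
    then have "?F (\<phi> q) = 0"
      by (rule has_integral_0_cbox_imp_0[OF continuous_on_subset[OF c ab(1)], rotated])
         (use nn ab box_subset_cbox[of a b] in auto)
    then show False using U qU q density_pos[OF U qU] by simp
  qed
qed

lemma vector_field_zero: "vector_field A (\<lambda>q. zero_tvec)"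
  by (simp add: vector_field_def tangent_zero) (simp add: zero_tvec_def smooth_fun_const)

end

section \<open>Partitions of unity\<close>

context smooth_mfd
begin

text \<open>Every point indexes a bump function in a chart around it. By compactness finitely many
  of the sets where these equal 1 cover the manifold, and the bump functions are divided by their
  finite positive sum.\<close>

lemma partition_of_unity:
  assumes cpt: "compact (UNIV :: 'a set)"
  obtains I :: "'a set" and U \<phi> \<xi> K where "finite I" "\<And>i. (U i, \<phi> i) \<in> A"
    "\<And>i. smooth_fun A (\<xi> i)" "\<And>i q. 0 \<le> \<xi> i q" "\<And>i. compact (K i)" "\<And>i. K i \<subseteq> U i"
    "\<And>i q. q \<notin> K i \<Longrightarrow> \<xi> i q = 0" "\<And>q. (\<Sum>i\<in>I. \<xi> i q) = 1"
proof -
  let ?P = "\<lambda>p (U, \<phi>, b, K, W). (U, \<phi>) \<in> A \<and> smooth_fun A b \<and> compact K \<and> K \<subseteq> U \<and> open W \<and> p \<in> W \<and>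
     (\<forall>q\<in>W. b q = 1) \<and> (\<forall>q. q \<notin> K \<longrightarrow> b q = 0) \<and> (\<forall>q. 0 \<le> b q)"
  have "\<forall>p. \<exists>t. ?P p t"
  proof
    fix p
    obtain U \<phi> where U: "(U, \<phi>) \<in> A" "p \<in> U" by (rule chart_exists)
    obtain b K W where b: "smooth_fun A b" "compact K" "closed K" "K \<subseteq> U" "open W" "p \<in> W" "W \<subseteq> K"
      "\<And>q. q \<in> W \<Longrightarrow> b q = 1" "\<And>q. q \<notin> K \<Longrightarrow> b q = 0" "\<And>q. 0 \<le> b q"
      by (rule bump_exists[OF chart_props(1)[OF U(1)] U(2)]) blast
    show "\<exists>t. ?P p t"
      by (rule exI[of _ "(U, \<phi>, b, K, W)"]) (simp add: U b)
  qed
  from choice[OF this] obtain t where t: "\<forall>p. ?P p (t p)" ..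
  define U where "U p = fst (t p)" for p
  define \<phi> where "\<phi> p = fst (snd (t p))" for p
  define b where "b p = fst (snd (snd (t p)))" for p
  define K where "K p = fst (snd (snd (snd (t p))))" for p
  define W where "W p = snd (snd (snd (snd (t p))))" for p
  have *: "(U p, \<phi> p) \<in> A \<and> smooth_fun A (b p) \<and> compact (K p) \<and> K p \<subseteq> U p \<and>
     open (W p) \<and> p \<in> W p \<and> (\<forall>q\<in>W p. b p q = 1) \<and> (\<forall>q. q \<notin> K p \<longrightarrow> b p q = 0) \<and> (\<forall>q. 0 \<le> b p q)" for p
    unfolding U_def \<phi>_def b_def K_def W_def by (rule t[rule_format, of p, unfolded case_prod_unfold])
  obtain I where I: "finite I" "(UNIV :: 'a set) \<subseteq> (\<Union>p\<in>I. W p)"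
    by (rule compactE_image[OF cpt, of UNIV W]) (use * in auto)
  define s where "s q = (\<Sum>p\<in>I. b p q)" for q
  have s: "s q > 0" for q
  proof -
    obtain p where p: "p \<in> I" "q \<in> W p" using I by blast
    have "b p q \<le> s q" unfolding s_def by (rule member_le_sum[OF p(1)]) (use * I in auto)
    then show ?thesis using * p by fastforce
  qed
  have ss: "smooth_fun A (\<lambda>q. inverse (s q))"
    unfolding s_def[abs_def]
    by (intro smooth_fun_inverse smooth_fun_sum) (use * s in \<open>auto simp: s_def less_imp_neq[symmetric]\<close>)
  show ?thesis
  proof (rule that[of I U \<phi> "\<lambda>p q. b p q * inverse (s q)" K])
    show "smooth_fun A (\<lambda>q. b p q * inverse (s q))" for p
      by (rule smooth_fun_mult[OF _ ss]) (use * in blast)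
    show "0 \<le> b p q * inverse (s q)" for p q using * s[of q] by simp
    show "(\<Sum>p\<in>I. b p q * inverse (s q)) = 1" for q
      using s[of q] by (simp add: sum_distrib_right[symmetric] s_def[symmetric])
  qed (use * I in auto)
qed

end

section \<open>Gluing the divergence theorem over a compact manifold\<close>

context riem_mfd_vol
begin

text \<open>The chart version applied to \<open>\<xi> i\<close> times \<open>X\<close> gives
  \<open>c\<close> times the integral of \<open>\<xi> i\<close>, plus the integral of
  \<open>X (\<xi> i)\<close>, equal to 0. Over all \<open>i\<close> the latter integrals cancel,
  while those of \<open>\<xi> i\<close> have a positive sum.\<close>

theorem constant_divergence_eq_0:
  assumes cpt: "compact (UNIV :: 'a set)" and D: "levi_civita A g D" and X: "vector_field A X"
    and div: "has_divergence D X (\<lambda>p. c)"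
  shows "c = 0"
proof -
  obtain I :: "'a set" and U \<phi> \<xi> K where I: "finite I" and U: "\<And>i. (U i, \<phi> i) \<in> A"
    and \<xi>: "\<And>i. smooth_fun A (\<xi> i)" and nn: "\<And>i q. 0 \<le> \<xi> i q"
    and K: "\<And>i. compact (K i)" "\<And>i. K i \<subseteq> U i" and z: "\<And>i q. q \<notin> K i \<Longrightarrow> \<xi> i q = 0"
    and one: "\<And>q. (\<Sum>i\<in>I. \<xi> i q) = 1"
    by (rule partition_of_unity[OF cpt]) blast
  let ?int = "\<lambda>i. chart_integral (U i) (\<phi> i)"
  have zX: "X q (\<xi> i) = 0" if "q \<notin> K i" for i q
  proof -
    have "X q (\<xi> i) = X q (\<lambda>q. 0)"
      by (rule tangent_local[OF vector_field_tangent[OF X] \<xi> smooth_fun_const, of "- K i"])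
         (use that z compact_imp_closed[OF K(1)] in \<open>auto simp: open_Compl\<close>)
    then show ?thesis using tangent_const[OF vector_field_tangent[OF X]] by simp
  qed
  have sX: "(\<Sum>i\<in>I. X q (\<xi> i)) = 0" for q
  proof -
    have "(\<Sum>i\<in>I. X q (\<xi> i)) = X q (\<lambda>q. \<Sum>i\<in>I. \<xi> i q)"
      using tangent_sum[OF vector_field_tangent[OF X], of I \<xi>] \<xi> by simp
    then show ?thesis using tangent_const[OF vector_field_tangent[OF X]] by (simp add: one)
  qed
  have cont: "continuous_on UNIV (\<xi> i)" "continuous_on UNIV (\<lambda>q. X q (\<xi> i))" for i
    by (rule smooth_fun_continuous[OF \<xi>], rule smooth_fun_continuous[OF vector_field_smooth[OF X \<xi>]])
  have 1: "?int i (\<xi> i) * c + ?int i (\<lambda>q. X q (\<xi> i)) = 0" for i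
  proof -
    have "?int i (\<lambda>q. \<xi> i q * c + X q (\<xi> i)) = 0"
    proof (rule chart_integral_divergence[OF D _ has_divergence_scale[OF D X \<xi> div] U K])
      show "vector_field A (\<lambda>p. lincomb (\<xi> i p) (X p) 0 zero_tvec)"
        by (rule vector_field_lincomb[OF X vector_field_zero \<xi> smooth_fun_const])
      show "lincomb (\<xi> i q) (X q) 0 zero_tvec = zero_tvec" if "q \<notin> K i" for q
        using z[OF that] by (simp add: lincomb_def zero_tvec_def)
    qed
    \<comment> \<open>A sum of two functions, indexed by the truth values to fit
      \<open>chart_integral_sum\<close>.\<close>
    moreover have "?int i (\<lambda>q. \<Sum>j\<in>{True, False}. if j then \<xi> i q * c else X q (\<xi> i))
        = (\<Sum>j\<in>{True, False}. ?int i (\<lambda>q. if j then \<xi> i q * c else X q (\<xi> i)))"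
    proof (rule chart_integral_sum[OF U K])
      show "continuous_on UNIV (\<lambda>q. if j then \<xi> i q * c else X q (\<xi> i))" for j
        using cont by (cases j) (simp_all add: continuous_on_mult)
    qed (use z zX in auto)
    ultimately show ?thesis by (simp add: chart_integral_cmult)
  qed
  \<comment> \<open>The functions \<open>X (\<xi> i)\<close> add up to 0, but they are integrated in
    different charts. After inserting the sum of the \<open>\<xi> j\<close>, each product is
    supported in \<open>K i \<inter> K j\<close> and can be moved to chart \<open>j\<close>, where
    the sum over \<open>i\<close> is taken under the integral.\<close>
  have "(\<Sum>i\<in>I. ?int i (\<lambda>q. X q (\<xi> i))) = (\<Sum>i\<in>I. \<Sum>j\<in>I. ?int i (\<lambda>q. \<xi> j q * X q (\<xi> i)))"
  proof (rule sum.cong[OF refl])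
    fix i
    have "?int i (\<lambda>q. \<Sum>j\<in>I. \<xi> j q * X q (\<xi> i)) = (\<Sum>j\<in>I. ?int i (\<lambda>q. \<xi> j q * X q (\<xi> i)))"
      by (rule chart_integral_sum[OF U K _ _ I]) (use zX cont in \<open>auto intro!: continuous_on_mult\<close>)
    then show "?int i (\<lambda>q. X q (\<xi> i)) = (\<Sum>j\<in>I. ?int i (\<lambda>q. \<xi> j q * X q (\<xi> i)))"
      by (simp add: sum_distrib_right[symmetric] one)
  qed
  also have "\<dots> = (\<Sum>i\<in>I. \<Sum>j\<in>I. ?int j (\<lambda>q. \<xi> j q * X q (\<xi> i)))"
  proof (intro sum.cong refl)
    fix i j
    show "?int i (\<lambda>q. \<xi> j q * X q (\<xi> i)) = ?int j (\<lambda>q. \<xi> j q * X q (\<xi> i))"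
    proof (rule chart_integral_independent[OF U U])
      show "compact (K i \<inter> K j)" by (intro compact_Int K)
      show "continuous_on UNIV (\<lambda>q. \<xi> j q * X q (\<xi> i))" by (intro continuous_on_mult cont)
    qed (use K z zX in auto)
  qed
  also have "\<dots> = (\<Sum>j\<in>I. \<Sum>i\<in>I. ?int j (\<lambda>q. \<xi> j q * X q (\<xi> i)))"
    by (rule sum.swap)
  also have "\<dots> = (\<Sum>j\<in>I. ?int j (\<lambda>q. \<Sum>i\<in>I. \<xi> j q * X q (\<xi> i)))"
    by (intro sum.cong refl chart_integral_sum[OF U K _ _ I, symmetric])
       (use z cont in \<open>auto intro!: continuous_on_mult\<close>)
  also have "\<dots> = 0"
    by (simp add: sum_distrib_left[symmetric] sX chart_integral_def)
  finally have "(\<Sum>i\<in>I. ?int i (\<xi> i)) * c = 0"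
    using 1 by (simp add: sum_distrib_right eq_neg_iff_add_eq_0[symmetric] sum_negf)
  \<comment> \<open>At any point some \<open>\<xi> i\<close> is positive, since they sum to 1; its
    integral is positive and the others are nonnegative.\<close>
  moreover have "(\<Sum>i\<in>I. ?int i (\<xi> i)) > 0"
  proof -
    have "\<exists>i\<in>I. \<xi> i q > 0" for q
    proof (rule ccontr)
      assume "\<not> (\<exists>i\<in>I. \<xi> i q > 0)"
      then have "(\<Sum>i\<in>I. \<xi> i q) \<le> 0" by (intro sum_nonpos) (auto simp: not_less)
      then show False by (simp add: one)
    qed
    then obtain i q where i: "i \<in> I" "\<xi> i q > 0" by blast
    have pos: "\<xi> j r > 0 \<Longrightarrow> ?int j (\<xi> j) > 0" for j r
      by (rule chart_integral_pos[OF U cont(1) nn K z])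
    have nonneg: "?int j (\<xi> j) \<ge> 0" for j
    proof (cases "\<exists>r. \<xi> j r > 0")
      case False
      then have "\<xi> j = (\<lambda>r. 0)" using nn by (metis less_eq_real_def ext)
      then show ?thesis by (simp add: chart_integral_def)
    qed (use pos less_imp_le in blast)
    show ?thesis
      by (rule sum_pos2[OF I i(1), of "\<lambda>i. ?int i (\<xi> i)"]) (rule pos[OF i(2)], rule nonneg)
  qed
  ultimately show ?thesis by simp
qed

end

section \<open>Connections on locally conformally Kaehler manifolds\<close>

locale lck_mfd = riem_mfd A g
  for A :: "('a::{t2_space,second_countable_topology}, real^'n::finite) chart set" and g +
  fixes J :: "'a endo" and \<theta> :: "'a form1" and D :: "'a conn" and T :: "'a vfield"
  assumes herm: "hermitian_manifold A J g" and lee: "lee_form A J g \<theta>" and lc: "levi_civita A g D"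
    and T_field: "vector_field A T" and T_dual: "v \<in> tangent_space A p \<Longrightarrow> g p (T p) v = \<theta> p v"
begin

lemma J_tangent: "v \<in> tangent_space A p \<Longrightarrow> J p v \<in> tangent_space A p"
  using herm by (simp add: hermitian_manifold_def complex_structure_def almost_complex_structure_def)

lemma J_lin:
  "v \<in> tangent_space A p \<Longrightarrow> w \<in> tangent_space A p \<Longrightarrow> J p (lincomb a v b w) = lincomb a (J p v) b (J p w)"
  using herm by (simp add: hermitian_manifold_def complex_structure_def almost_complex_structure_def)

lemma J_J: "v \<in> tangent_space A p \<Longrightarrow> J p (J p v) = (\<lambda>f. - v f)"
  using herm by (simp add: hermitian_manifold_def complex_structure_def almost_complex_structure_def)

lemma J_field: "vector_field A X \<Longrightarrow> vector_field A (app J X)"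
  using herm by (simp add: hermitian_manifold_def complex_structure_def almost_complex_structure_def)

lemma J_isometry: "v \<in> tangent_space A p \<Longrightarrow> w \<in> tangent_space A p \<Longrightarrow> g p (J p v) (J p w) = g p v w"
  using herm by (simp add: hermitian_manifold_def)

text \<open>Apply the isometry \<open>J\<close> to both arguments and use that \<open>J\<close>
  squares to minus the identity.\<close>

lemma J_skew:
  assumes "v \<in> tangent_space A p" "w \<in> tangent_space A p"
  shows "g p v (J p w) = - g p (J p v) w"
proof -
  have "g p v (J p w) = g p (J p v) (J p (J p w))"
    using J_isometry[OF assms(1) J_tangent[OF assms(2)]] by simp
  also have "\<dots> = g p (J p (J p w)) (J p v)"
    by (rule metric_sym) (simp_all add: J_tangent assms)
  also have "\<dots> = - g p w (J p v)"
    by (simp add: J_J metric_neg_left assms J_tangent)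
  also have "\<dots> = - g p (J p v) w"
    by (simp add: metric_sym[OF assms(2) J_tangent[OF assms(1)]])
  finally show ?thesis .
qed

lemma J_self: "v \<in> tangent_space A p \<Longrightarrow> g p v (J p v) = 0"
  using J_skew[of v p v] metric_sym[of v p "J p v"] J_tangent by simp

lemma theta_form: "one_form A \<theta>"
  using lee by (simp add: lee_form_def)

lemma theta_lin:
  "v \<in> tangent_space A p \<Longrightarrow> w \<in> tangent_space A p \<Longrightarrow> \<theta> p (lincomb a v b w) = a * \<theta> p v + b * \<theta> p w"
  using theta_form by (simp add: one_form_def)

lemma theta_smooth: "vector_field A X \<Longrightarrow> smooth_fun A (\<lambda>p. \<theta> p (X p))"
  using theta_form by (simp add: one_form_def)

lemma theta_neg: "v \<in> tangent_space A p \<Longrightarrow> \<theta> p (\<lambda>f. - v f) = - \<theta> p v"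
  using theta_lin[of v p v "-1" 0] by (simp add: lincomb_def)

lemma theta_J_T: "\<theta> p (J p (T p)) = 0"
  using J_self[of "T p" p] T_dual[of "J p (T p)" p] T_field J_tangent vector_field_tangent by simp

lemma D_field: "vector_field A X \<Longrightarrow> vector_field A Y \<Longrightarrow> vector_field A (D X Y)"
  using lc by (simp add: levi_civita_def affine_connection_def)

lemma D_metric:
  "vector_field A X \<Longrightarrow> vector_field A Y \<Longrightarrow> vector_field A Z \<Longrightarrow>
    X p (\<lambda>q. g q (Y q) (Z q)) = g p (D X Y p) (Z p) + g p (Y p) (D X Z p)"
  using lc by (simp add: levi_civita_def)

lemma d_omega:
  assumes "vector_field A X" "vector_field A Y" "vector_field A Z"
  shows "ext_d2 (fundamental_form J g) X Y Z p =
    \<theta> p (X p) * g p (J p (Y p)) (Z p) - \<theta> p (Y p) * g p (J p (X p)) (Z p) + \<theta> p (Z p) * g p (J p (X p)) (Y p)"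
  using lee assms by (simp add: lee_form_def wedge12_def fundamental_form_def)

text \<open>Every occurrence of \<open>Z\<close> is brought into the form of an inner product with
  \<open>Z\<close>, using \<open>\<theta>(JZ) = - g(JT, Z)\<close>, so that the equation defining
  the connection can be solved for its value.\<close>

lemma d_omega_JJJ:
  assumes "vector_field A X" "vector_field A Y" "vector_field A Z"
  shows "ext_d2 (fundamental_form J g) (app J X) (app J Y) (app J Z) p =
    \<theta> p (J p (X p)) * g p (J p (Y p)) (Z p) - \<theta> p (J p (Y p)) * g p (J p (X p)) (Z p)
      - g p (J p (T p)) (Z p) * g p (J p (X p)) (Y p)"
proof -
  note t = assms[THEN vector_field_tangent, of p] T_field[THEN vector_field_tangent, of p]
  have "\<theta> p (J p (Z p)) = - g p (J p (T p)) (Z p)"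
    using T_dual[OF J_tangent[OF t(3)]] J_skew[OF t(4,3)] by simp
  then show ?thesis
    using d_omega[OF assms[THEN J_field], of p] by (simp add: app_def J_isometry t J_tangent)
qed

lemma d_omega_J:
  assumes "vector_field A X" "vector_field A Y" "vector_field A Z"
  shows "ext_d2 (fundamental_form J g) (app J X) Y Z p =
    \<theta> p (J p (X p)) * g p (J p (Y p)) (Z p) + \<theta> p (Y p) * g p (X p) (Z p)
      - g p (T p) (Z p) * g p (X p) (Y p)"
proof -
  note t = assms[THEN vector_field_tangent, of p] T_field[THEN vector_field_tangent, of p]
  show ?thesis
    using d_omega[OF J_field[OF assms(1)] assms(2,3), of p] T_dual[OF t(3)]
    by (simp add: app_def J_J t metric_neg_left)
qed

lemma fields_determined_by_metric:
  assumes "vector_field A V" "vector_field A W"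
    and "\<And>Z p. vector_field A Z \<Longrightarrow> g p (V p) (Z p) = g p (W p) (Z p)"
  shows "V = W"
proof
  fix p
  show "V p = W p"
  proof (rule metric_nondegenerate[OF assms(1,2)[THEN vector_field_tangent]])
    fix u assume "u \<in> tangent_space A p"
    then obtain Z where "vector_field A Z" "Z p = u" by (rule vector_field_through)
    then show "g p (V p) u = g p (W p) u" using assms(3)[of Z p] by simp
  qed
qed

text \<open>Nondegeneracy supplies the uniqueness that \<open>THE\<close> asks for; existence is
  delegated to an explicit \<open>W\<close>.\<close>

lemma eps_rho_eqI:
  assumes W: "vector_field A W"
    and eq: "\<And>Z p. vector_field A Z \<Longrightarrow> g p (W p) (Z p) = g p (D X Y p) (Z p)
          - \<epsilon> * ext_d2 (fundamental_form J g) (app J X) (app J Y) (app J Z) p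
          - \<rho> * ext_d2 (fundamental_form J g) (app J X) Y Z p"
  shows "eps_rho_connection A J g D \<epsilon> \<rho> X Y = W"
  unfolding eps_rho_connection_def
proof (rule the_equality)
  fix V
  assume V: "vector_field A V \<and> (\<forall>Z. vector_field A Z \<longrightarrow> (\<forall>p. g p (V p) (Z p) = g p (D X Y p) (Z p)
          - \<epsilon> * ext_d2 (fundamental_form J g) (app J X) (app J Y) (app J Z) p
          - \<rho> * ext_d2 (fundamental_form J g) (app J X) Y Z p))"
  show "V = W"
    by (rule fields_determined_by_metric[OF _ W]) (use V eq in auto)
qed (use W eq in blast)

text \<open>The \<open>\<epsilon>\<close>-term drops out because \<open>d\<omega>(JX, JY, JT) = 0\<close> for the vector field \<open>T\<close> dual to \<open>\<theta>\<close>.\<close>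

lemma theta_eps_rho:
  assumes X: "vector_field A X" and Y: "vector_field A Y"
  shows "\<theta> p (eps_rho_connection A J g D \<epsilon> \<rho> X Y p) = \<theta> p (D X Y p)
    - \<rho> * (\<theta> p (J p (X p)) * \<theta> p (J p (Y p)) + \<theta> p (Y p) * \<theta> p (X p) - g p (X p) (Y p) * \<theta> p (T p))"
proof -
  \<comment> \<open>Read off from \<open>d_omega_JJJ\<close> and \<open>d_omega_J\<close> by
    collecting the vectors paired with \<open>Z\<close>. Under \<open>\<theta>\<close> the two
    \<open>\<epsilon>\<close>-terms with \<open>JY\<close> and \<open>JX\<close> cancel, and the one
    with \<open>JT\<close> vanishes.\<close>
  define W where "W p = lincomb 1 (D X Y p) 1 (lincomb
      1 (lincomb (- (\<epsilon> + \<rho>) * \<theta> p (J p (X p))) (J p (Y p)) (\<epsilon> * \<theta> p (J p (Y p))) (J p (X p)))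
      1 (lincomb (\<epsilon> * g p (J p (X p)) (Y p)) (J p (T p)) 1
         (lincomb (- \<rho> * \<theta> p (Y p)) (X p) (\<rho> * g p (X p) (Y p)) (T p))))" for p
  note t = X[THEN vector_field_tangent] Y[THEN vector_field_tangent] T_field[THEN vector_field_tangent]
    D_field[OF X Y, THEN vector_field_tangent]
  note sm = theta_smooth[OF J_field[OF X], unfolded app_def] theta_smooth[OF J_field[OF Y], unfolded app_def]
    theta_smooth[OF Y] metric_smooth[OF J_field[OF X] Y, unfolded app_def] metric_smooth[OF X Y]
  note J_field' = J_field[unfolded app_def]
  have W: "vector_field A W"
    unfolding W_def[abs_def]
    by (intro vector_field_lincomb smooth_fun_const smooth_fun_mult sm D_field J_field' X Y T_field)
  have "eps_rho_connection A J g D \<epsilon> \<rho> X Y = W"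
  proof (rule eps_rho_eqI[OF W])
    fix Z p assume Z: "vector_field A Z"
    note tZ = Z[THEN vector_field_tangent, of p]
    show "g p (W p) (Z p) = g p (D X Y p) (Z p)
          - \<epsilon> * ext_d2 (fundamental_form J g) (app J X) (app J Y) (app J Z) p
          - \<rho> * ext_d2 (fundamental_form J g) (app J X) Y Z p"
      unfolding d_omega_JJJ[OF X Y Z] d_omega_J[OF X Y Z] W_def
      by (simp add: metric_lin_left t tZ J_tangent tangent_lincomb) (simp add: algebra_simps)
  qed
  then show ?thesis
    by (simp add: W_def theta_lin t J_tangent tangent_lincomb theta_J_T) (simp add: algebra_simps)
qed

text \<open>Since \<open>D\<close> is metric, \<open>g(D_X T, Y)\<close> is the covariant derivative
  of \<open>\<theta>\<close> along \<open>X\<close> evaluated on \<open>Y\<close>. Replacing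
  \<open>\<theta>(JY)\<close> by \<open>- g(JT, Y)\<close> turns the equation for
  \<open>\<theta>\<close> into one between vectors.\<close>

lemma D_T:
  assumes par: "parallel_form1 A (eps_rho_connection A J g D \<epsilon> \<rho>) \<theta>" and X: "vector_field A X"
  shows "D X T p = lincomb (\<rho> * \<theta> p (T p)) (X p) 1
    (lincomb (- \<rho> * \<theta> p (X p)) (T p) (\<rho> * \<theta> p (J p (X p))) (J p (T p)))" (is "_ = ?R")
proof -
  note t = X[THEN vector_field_tangent] T_field[THEN vector_field_tangent] D_field[OF X T_field, THEN vector_field_tangent]
  show ?thesis
  proof (rule metric_nondegenerate)
    show "D X T p \<in> tangent_space A p" "?R \<in> tangent_space A p"
      by (simp_all add: tangent_lincomb t J_tangent)
    fix u assume "u \<in> tangent_space A p"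
    then obtain Y where Y: "vector_field A Y" and u: "Y p = u" by (rule vector_field_through)
    note tY = Y[THEN vector_field_tangent] D_field[OF X Y, THEN vector_field_tangent]
    have "X p (\<lambda>q. \<theta> q (Y q)) = g p (D X T p) (Y p) + \<theta> p (D X Y p)"
      using D_metric[OF X T_field Y, of p] by (simp add: T_dual tY)
    moreover have "X p (\<lambda>q. \<theta> q (Y q)) = \<theta> p (eps_rho_connection A J g D \<epsilon> \<rho> X Y p)"
      using par X Y by (simp add: parallel_form1_def)
    ultimately have "g p (D X T p) (Y p) = - \<rho> * (\<theta> p (J p (X p)) * \<theta> p (J p (Y p)) + \<theta> p (Y p) * \<theta> p (X p)
        - g p (X p) (Y p) * \<theta> p (T p))"
      by (simp add: theta_eps_rho[OF X Y])
    moreover have "\<theta> p (J p (Y p)) = - g p (J p (T p)) (Y p)"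
      using T_dual[OF J_tangent[OF tY(1)], of p] J_skew[OF t(2) tY(1), of p] by simp
    ultimately show "g p (D X T p) u = g p ?R u"
      unfolding u[symmetric]
      by (simp add: metric_lin_left t tY J_tangent tangent_lincomb T_dual) (simp add: algebra_simps)
  qed
qed

text \<open>The derivative of \<open>|T|^2\<close> along \<open>X\<close> is
  \<open>2 \<theta>(D_X T)\<close>. In \<open>D_T\<close> the terms in \<open>X\<close> and
  \<open>T\<close> cancel under \<open>\<theta>\<close>, and the term in \<open>JT\<close> is
  killed.\<close>

lemma theta_T_constant:
  assumes par: "parallel_form1 A (eps_rho_connection A J g D \<epsilon> \<rho>) \<theta>"
    and con: "connected (UNIV :: 'a set)"
  shows "\<theta> p (T p) = \<theta> q (T q)"
proof (rule constant_if_derivatives_vanish[OF theta_smooth[OF T_field] con])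
  fix p v assume "v \<in> tangent_space A p"
  then obtain X where X: "vector_field A X" and v: "X p = v" by (rule vector_field_through)
  note t = X[THEN vector_field_tangent] T_field[THEN vector_field_tangent] D_field[OF X T_field, THEN vector_field_tangent]
  have "X p (\<lambda>q. g q (T q) (T q)) = 2 * \<theta> p (D X T p)"
    using D_metric[OF X T_field T_field, of p] by (simp add: metric_sym[OF t(3) t(2)] T_dual t)
  also have "\<theta> p (D X T p) = 0"
    by (simp add: D_T[OF par X] theta_lin t tangent_lincomb J_tangent theta_J_T)
  finally show "v (\<lambda>q. \<theta> q (T q)) = 0"
    by (simp add: v T_dual t)
qed

end

section \<open>Change of the model space\<close>

text \<open>The orthonormal basis itself serves as index type, so that \<open>'e\<close> becomes
  \<open>real^'n\<close> with \<open>CARD('n) = DIM('e)\<close> and matrices become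
  available.\<close>

typedef (overloaded) ('e::euclidean_space) basis_index = "Basis :: 'e set"
  using nonempty_Basis by blast

lemma finite_UNIV_basis_index: "finite (UNIV :: ('e::euclidean_space) basis_index set)"
  using finite_imageI[OF finite_Basis, of Abs_basis_index]
  by (metis (mono_tags) type_definition.Abs_image type_definition_basis_index)

instance basis_index :: (euclidean_space) finite
  by standard (rule finite_UNIV_basis_index)

text \<open>The change of variables theorem is available for index types of class \<^class>\<open>wellorder\<close>;
  any enumeration of the basis provides the order.\<close>

definition basis_index_rank :: "('e::euclidean_space) basis_index \<Rightarrow> nat" where
  "basis_index_rank = (SOME f. inj f)"

lemma inj_basis_index_rank: "inj (basis_index_rank :: ('e::euclidean_space) basis_index \<Rightarrow> nat)"
proof -
  obtain f :: "'e basis_index \<Rightarrow> nat" where "inj f"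
    using finite_imp_inj_to_nat_seg[OF finite_UNIV_basis_index] by blast
  then show ?thesis unfolding basis_index_rank_def by (rule someI[of inj])
qed

instantiation basis_index :: (euclidean_space) wellorder
begin

definition "i \<le> j \<longleftrightarrow> basis_index_rank i \<le> basis_index_rank j"
definition "i < j \<longleftrightarrow> basis_index_rank i < basis_index_rank j"

instance
proof
  fix i j k :: "'a basis_index" and P :: "'a basis_index \<Rightarrow> bool"
  show "i < j \<longleftrightarrow> i \<le> j \<and> \<not> j \<le> i" "i \<le> i" "i \<le> j \<Longrightarrow> j \<le> k \<Longrightarrow> i \<le> k" "i \<le> j \<or> j \<le> i"
    by (auto simp: less_eq_basis_index_def less_basis_index_def)
  show "i \<le> j \<Longrightarrow> j \<le> i \<Longrightarrow> i = j"
    by (metis inj_basis_index_rank injD less_eq_basis_index_def order_antisym)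
  show "P i" if "\<And>i. (\<And>j. j < i \<Longrightarrow> P j) \<Longrightarrow> P i"
  proof (rule measure_induct_rule[of basis_index_rank P])
    fix x :: "'a basis_index"
    assume "\<And>y. basis_index_rank y < basis_index_rank x \<Longrightarrow> P y"
    then show "P x" by (rule that) (simp add: less_basis_index_def)
  qed
qed

end

lemma card_basis_index: "CARD(('e::euclidean_space) basis_index) = DIM('e)"
  using type_definition.card[OF type_definition_basis_index] by metis

definition to_cart :: "'e::euclidean_space \<Rightarrow> real^'e basis_index" where
  "to_cart x = vec_lambda (\<lambda>i. x \<bullet> Rep_basis_index i)"

definition of_cart :: "real^'e basis_index \<Rightarrow> 'e::euclidean_space" where
  "of_cart y = (\<Sum>i\<in>UNIV. y $ i *\<^sub>R Rep_basis_index i)"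

lemma of_cart_to_cart [simp]: "of_cart (to_cart x) = x"
proof -
  have "(\<Sum>i\<in>UNIV. (x \<bullet> Rep_basis_index i) *\<^sub>R Rep_basis_index i) = (\<Sum>b\<in>Basis. (x \<bullet> b) *\<^sub>R b)"
    by (rule sum.reindex_bij_betw)
       (metis (no_types) bij_betw_def inj_onI Rep_basis_index_inject type_definition.Rep_range type_definition_basis_index)
  then show ?thesis by (simp add: of_cart_def to_cart_def euclidean_representation)
qed

lemma to_cart_of_cart [simp]: "to_cart (of_cart y) = y"
proof -
  have ort: "Rep_basis_index j \<bullet> Rep_basis_index i = (if j = i then 1 else 0)" for i j :: "'a basis_index"
    using Rep_basis_index[of i] Rep_basis_index[of j] by (auto simp: inner_Basis Rep_basis_index_inject)
  show ?thesis
    by (simp add: of_cart_def to_cart_def vec_eq_iff inner_sum_left ort if_distrib cong: if_cong)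
qed

lemma bounded_linear_to_cart: "bounded_linear to_cart"
  unfolding linear_conv_bounded_linear[symmetric]
  by (rule linearI) (simp_all add: to_cart_def vec_eq_iff inner_add_left)

lemma bounded_linear_of_cart: "bounded_linear (of_cart :: real^'e::euclidean_space basis_index \<Rightarrow> 'e)"
  unfolding linear_conv_bounded_linear[symmetric]
  by (rule linearI) (simp_all add: of_cart_def scaleR_add_left sum.distrib scaleR_sum_right)

lemma homeomorphism_to_cart: "homeomorphism S (to_cart ` S) to_cart of_cart"
  unfolding homeomorphism_def
  by (auto simp: image_image intro!: linear_continuous_on bounded_linear_to_cart bounded_linear_of_cart)

lemma open_to_cart_image:
  assumes "open S"
  shows "open (to_cart ` S)"
proof -
  have "to_cart ` S = of_cart -` S" by (force simp: image_iff)
  then show ?thesis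
    by (simp only:) (rule continuous_open_vimage[OF assms linear_continuous_at[OF bounded_linear_of_cart]])
qed

text \<open>Only the coordinates are composed with a linear isomorphism; chart domains and the
  underlying type stay the same.\<close>

definition cart_atlas :: "('a, 'e::euclidean_space) chart set \<Rightarrow> ('a, real^'e basis_index) chart set" where
  "cart_atlas A = (\<lambda>(U, \<phi>). (U, to_cart \<circ> \<phi>)) ` A"

lemma smooth_on_cart_iff:
  assumes S: "open S" and eq: "\<And>x. x \<in> S \<Longrightarrow> f' (to_cart x) = f x"
  shows "smooth_on (to_cart ` S) f' \<longleftrightarrow> smooth_on S f"
proof
  assume f': "smooth_on (to_cart ` S) f'"
  have "smooth_on S (\<lambda>x. f' (to_cart x))"
    by (rule smooth_on_compose[OF S _ smooth_on_linear[OF bounded_linear_to_cart S] f']) simp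
  then show "smooth_on S f" by (rule smooth_on_cong[OF S, rotated]) (rule eq)
next
  assume f: "smooth_on S f"
  note o = open_to_cart_image[OF S]
  have "smooth_on (to_cart ` S) (\<lambda>x. f (of_cart x))"
    by (rule smooth_on_compose[OF o _ smooth_on_linear[OF bounded_linear_of_cart o] f]) auto
  then show "smooth_on (to_cart ` S) f'" by (rule smooth_on_cong[OF o, rotated]) (auto simp: eq)
qed

section \<open>Invariance of all notions under the change of model\<close>

context smooth_mfd
begin

lemma inv_into_cart:
  assumes U: "(U, \<phi>) \<in> A" and y: "y \<in> to_cart ` \<phi> ` U"
  shows "inv_into U (to_cart \<circ> \<phi>) y = inv_into U \<phi> (of_cart y)"
proof -
  obtain p where p: "p \<in> U" "y = to_cart (\<phi> p)" using y by blast
  have "inj_on (to_cart \<circ> \<phi>) U"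
    by (rule comp_inj_on[OF chart_props(3)[OF U]]) (metis inj_onI of_cart_to_cart)
  then have "inv_into U (to_cart \<circ> \<phi>) ((to_cart \<circ> \<phi>) p) = p" using p by (intro inv_into_f_f)
  then show ?thesis using p U by simp
qed

text \<open>Derivations, fields, tensors and connections are all defined through the smooth
  functions, so this equivalence, together with \<open>smooth_mfd_cart\<close>, transfers every
  notion by rewriting.\<close>

lemma smooth_fun_cart: "smooth_fun (cart_atlas A) f \<longleftrightarrow> smooth_fun A f"
proof -
  have "smooth_on ((to_cart \<circ> \<phi>) ` U) (f \<circ> inv_into U (to_cart \<circ> \<phi>)) \<longleftrightarrow> smooth_on (\<phi> ` U) (f \<circ> inv_into U \<phi>)"
    if U: "(U, \<phi>) \<in> A" for U \<phi>
    unfolding image_comp[symmetric]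
    by (rule smooth_on_cart_iff[OF chart_props(2)[OF U]]) (use inv_into_cart[OF U] in simp)
  from this[of "fst c" "snd c" for c] show ?thesis
    unfolding smooth_fun_def cart_atlas_def ball_simps case_prod_unfold fst_conv snd_conv
    by (intro ball_cong refl) simp
qed

lemma smooth_mfd_cart: "smooth_mfd (cart_atlas A)"
proof
  have chart: "is_chart (U, to_cart \<circ> \<phi>)" if U: "(U, \<phi>) \<in> A" for U \<phi>
  proof -
    have h: "homeomorphism U (\<phi> ` U) \<phi> (inv_into U \<phi>)"
      using mfd U by (auto simp: smooth_manifold_def is_chart_def)
    have "homeomorphism U (to_cart ` \<phi> ` U) (to_cart \<circ> \<phi>) (inv_into U \<phi> \<circ> of_cart)"
      by (rule homeomorphism_compose[OF h homeomorphism_to_cart])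
    then have "homeomorphism U (to_cart ` \<phi> ` U) (to_cart \<circ> \<phi>) (inv_into U (to_cart \<circ> \<phi>))"
      by (rule homeomorphism_cong) (use inv_into_cart[OF U] in auto)
    moreover have "open (to_cart ` \<phi> ` U)" by (rule open_to_cart_image[OF chart_props(2)[OF U]])
    ultimately show ?thesis
      unfolding is_chart_def prod.case image_comp[symmetric] using chart_props(1)[OF U] by blast
  qed
  have trans: "smooth_on ((to_cart \<circ> \<phi>) ` (U \<inter> V)) ((to_cart \<circ> \<psi>) \<circ> inv_into U (to_cart \<circ> \<phi>))"
    if U: "(U, \<phi>) \<in> A" and V: "(V, \<psi>) \<in> A" for U \<phi> V \<psi>
  proof -
    have o: "open (\<phi> ` (U \<inter> V))" 
      by (rule open_chart_image[OF U open_Int[OF chart_props(1)[OF U] chart_props(1)[OF V]]]) simp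
    have "smooth_on (\<phi> ` (U \<inter> V)) (\<lambda>y. to_cart ((\<psi> \<circ> inv_into U \<phi>) y))"
      by (rule smooth_on_bounded_linear[OF bounded_linear_to_cart o smooth_transition[OF U V]])
    then show ?thesis
      unfolding image_comp[symmetric]
      by (subst smooth_on_cart_iff[OF o]) (use inv_into_cart[OF U] in auto)
  qed
  show "smooth_manifold (cart_atlas A)"
    unfolding smooth_manifold_def cart_atlas_def ball_simps case_prod_unfold fst_conv snd_conv image_image
  proof (intro conjI ballI)
    show "\<Union> (fst ` A) = UNIV" using mfd by (simp add: smooth_manifold_def)
    show "is_chart (fst c, to_cart \<circ> snd c)" if "c \<in> A" for c using chart that by simp
    show "smooth_on ((to_cart \<circ> snd c) ` (fst c \<inter> fst c')) (to_cart \<circ> snd c' \<circ> inv_into (fst c) (to_cart \<circ> snd c))"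
      if "c \<in> A" "c' \<in> A" for c c' by (rule trans) (use that in simp_all)
  qed
qed

lemma tangent_space_cart: "tangent_space (cart_atlas A) = tangent_space A"
  by (rule ext) (simp only: tangent_space_def smooth_fun_cart)

lemma vector_field_cart: "vector_field (cart_atlas A) = vector_field A"
  by (rule ext) (simp only: vector_field_def tangent_space_cart smooth_fun_cart)

lemmas cart_transfer = smooth_fun_cart tangent_space_cart vector_field_cart

lemma riemannian_metric_cart: "riemannian_metric (cart_atlas A) g \<longleftrightarrow> riemannian_metric A g"
  by (simp only: riemannian_metric_def cart_transfer)

lemma complex_structure_cart: "complex_structure (cart_atlas A) J \<longleftrightarrow> complex_structure A J"
  by (simp only: complex_structure_def almost_complex_structure_def cart_transfer)

lemma hermitian_manifold_cart: "hermitian_manifold (cart_atlas A) J g \<longleftrightarrow> hermitian_manifold A J g"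
  using mfd smooth_mfd_cart
  by (simp only: hermitian_manifold_def smooth_mfd_def riemannian_metric_cart complex_structure_cart cart_transfer)

lemma lee_form_cart: "lee_form (cart_atlas A) J g \<theta> \<longleftrightarrow> lee_form A J g \<theta>"
  by (simp only: lee_form_def one_form_def closed_form1_def cart_transfer)

lemma levi_civita_cart: "levi_civita (cart_atlas A) g D \<longleftrightarrow> levi_civita A g D"
  by (simp only: levi_civita_def affine_connection_def cart_transfer)

lemma parallel_form1_cart: "parallel_form1 (cart_atlas A) D \<theta> \<longleftrightarrow> parallel_form1 A D \<theta>"
  by (simp only: parallel_form1_def cart_transfer)

lemma eps_rho_connection_cart: "eps_rho_connection (cart_atlas A) J g D \<epsilon> \<rho> = eps_rho_connection A J g D \<epsilon> \<rho>"
  by (intro ext) (simp only: eps_rho_connection_def cart_transfer)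

end

section \<open>Parallel Lee forms\<close>

context lck_mfd
begin

text \<open>The trace of \<open>D_T\<close>: the multiple of the identity contributes
  \<open>n\<close>, the rank-one term with \<open>T\<close> contributes -1, and the one with
  \<open>JT\<close> contributes \<open>\<theta>(JJT) / |T|^2 = -1\<close>, in units of
  \<open>\<rho> |T|^2\<close> when \<open>T\<close> is nonzero at \<open>p\<close>.\<close>

lemma has_divergence_T:
  assumes par: "parallel_form1 A (eps_rho_connection A J g D \<epsilon> \<rho>) \<theta>"
  shows "has_divergence D T (\<lambda>p. \<rho> * (real CARD('n) - 2) * \<theta> p (T p))"
  unfolding has_divergence_def
proof (intro allI impI)
  fix U \<phi> p E
  assume U: "(U, \<phi>) \<in> A" "p \<in> U" and E: "\<forall>i. vector_field A (E i) \<and> E i p = coord_vec A U \<phi> p (axis i 1)"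
  have tT: "T p \<in> tangent_space A p" by (rule vector_field_tangent[OF T_field])
  note t = tT J_tangent[OF tT] coord_vec_tangent[OF U]
  let ?t = "coords A U \<phi> p (T p)" and ?j = "coords A U \<phi> p (J p (T p))"
  let ?e = "\<lambda>i. coord_vec A U \<phi> p (axis i 1)"
  have "coords A U \<phi> p (D (E i) T p) $ i = \<rho> * \<theta> p (T p) + (- \<rho> * \<theta> p (?e i)) * ?t $ i
      + (\<rho> * \<theta> p (J p (?e i))) * ?j $ i" for i
    using E U D_T[OF par, of "E i" p]
    by (simp add: coords_lincomb[OF U] t tangent_lincomb)
  then have "(\<Sum>i\<in>UNIV. coords A U \<phi> p (D (E i) T p) $ i) = real CARD('n) * (\<rho> * \<theta> p (T p))
      - \<rho> * (\<Sum>i\<in>UNIV. ?t $ i * \<theta> p (?e i)) + \<rho> * (\<Sum>i\<in>UNIV. ?j $ i * \<theta> p (J p (?e i)))"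
    by (simp add: sum.distrib sum_distrib_left sum_subtractf mult_ac)
  also have "(\<Sum>i\<in>UNIV. ?t $ i * \<theta> p (?e i)) = \<theta> p (coord_vec A U \<phi> p ?t)"
    by (rule linear_on_coord_vec[OF U, of "\<theta> p", symmetric]) (rule theta_lin)
  also have "(\<Sum>i\<in>UNIV. ?j $ i * \<theta> p (J p (?e i))) = \<theta> p (J p (coord_vec A U \<phi> p ?j))"
    by (rule linear_on_coord_vec[OF U, of "\<lambda>v. \<theta> p (J p v)", symmetric]) (simp add: J_lin theta_lin J_tangent)
  finally show "(\<Sum>i\<in>UNIV. coords A U \<phi> p (D (E i) T p) $ i) = \<rho> * (real CARD('n) - 2) * \<theta> p (T p)"
    using U t by (simp add: J_J theta_neg algebra_simps)
qed

lemma theta_T_zero_imp: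
  assumes "\<theta> p (T p) = 0" and v: "v \<in> tangent_space A p"
  shows "\<theta> p v = 0"
proof -
  have tT: "T p \<in> tangent_space A p" by (rule vector_field_tangent[OF T_field])
  have "T p = zero_tvec"
    using metric_pos[OF tT] T_dual[OF tT] assms(1) by force
  then show ?thesis using T_dual[OF v] metric_zero_left[OF v] by simp
qed

text \<open>\<open>d\<omega> = \<theta> \<and> \<omega>\<close> vanishes, so \<open>D X Y\<close>
  itself solves the equation that defines the modified connection.\<close>

lemma kahler_if_theta_zero:
  assumes "\<And>p v. v \<in> tangent_space A p \<Longrightarrow> \<theta> p v = 0"
  shows "kahler_manifold A J g"
    and "vector_field A X \<Longrightarrow> vector_field A Y \<Longrightarrow> eps_rho_connection A J g D \<epsilon> \<rho> X Y = D X Y"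
proof -
  have z: "ext_d2 (fundamental_form J g) X Y Z p = 0"
    if "vector_field A X" "vector_field A Y" "vector_field A Z" for X Y Z p
    using d_omega[OF that] assms that[THEN vector_field_tangent] by simp
  then show "kahler_manifold A J g"
    using herm by (simp add: kahler_manifold_def)
  assume XY: "vector_field A X" "vector_field A Y"
  show "eps_rho_connection A J g D \<epsilon> \<rho> X Y = D X Y"
    by (rule eps_rho_eqI[OF D_field[OF XY]]) (simp add: z XY J_field)
qed

text \<open>At \<open>\<rho> = 0\<close>, \<open>theta_eps_rho\<close> says that
  \<open>\<theta>\<close> takes the same values on both connections, whatever
  \<open>\<epsilon>\<close> is, so \<open>\<theta>\<close> is parallel for \<open>D\<close> as
  well.\<close>

lemma vaisman_if_rho_zero:
  assumes par: "parallel_form1 A (eps_rho_connection A J g D \<epsilon> 0) \<theta>"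
  shows "vaisman_manifold A J g"
proof -
  have "parallel_form1 A D \<theta>"
    using par by (simp add: parallel_form1_def theta_eps_rho)
  then show ?thesis using herm lee lc by (auto simp: vaisman_manifold_def)
qed

end

theorem theorem7p3:
  fixes A :: "('a::{t2_space,second_countable_topology}, 'e::euclidean_space) chart set"
    and J :: "'a endo" and g :: "'a form2" and \<theta> :: "'a form1" and nabla_g :: "'a conn"
    and \<epsilon> \<rho> :: real
  assumes "DIM('e) \<ge> 4"
    and "connected (UNIV :: 'a set)" and "compact (UNIV :: 'a set)"
    and "lck_manifold A J g" and "lee_form A J g \<theta>"
    and "levi_civita A g nabla_g"
    and "parallel_form1 A (eps_rho_connection A J g nabla_g \<epsilon> \<rho>) \<theta>"
  shows "((\<forall>p. \<forall>v\<in>tangent_space A p. \<theta> p v = 0) \<and> kahler_manifold A J g \<and>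
           (\<forall>\<epsilon>' \<rho>'. \<forall>X Y. vector_field A X \<longrightarrow> vector_field A Y \<longrightarrow>
              eps_rho_connection A J g nabla_g \<epsilon>' \<rho>' X Y = nabla_g X Y))
       \<or> (vaisman_manifold A J g \<and> \<rho> = 0)"
proof -
  have herm: "hermitian_manifold A J g" using assms(4) by (simp add: lck_manifold_def)
  interpret A: smooth_mfd A by standard (use herm in \<open>simp add: hermitian_manifold_def\<close>)
  let ?A = "cart_atlas A"
  interpret B: smooth_mfd ?A by (rule A.smooth_mfd_cart)
  interpret B: riem_mfd_vol ?A g
    by standard (use herm in \<open>simp add: hermitian_manifold_def A.riemannian_metric_cart\<close>)
  have lee: "lee_form ?A J g \<theta>" and lc: "levi_civita ?A g nabla_g"
    and par: "parallel_form1 ?A (eps_rho_connection ?A J g nabla_g \<epsilon> \<rho>) \<theta>"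
    using assms by (simp_all add: A.lee_form_cart A.levi_civita_cart A.parallel_form1_cart A.eps_rho_connection_cart)
  obtain T where T: "vector_field ?A T" "\<And>p v. v \<in> tangent_space ?A p \<Longrightarrow> g p (T p) v = \<theta> p v"
    by (rule B.sharp_exists) (use lee in \<open>auto simp: lee_form_def\<close>)
  interpret B: lck_mfd ?A g J \<theta> nabla_g T
    by standard (use herm lee lc T in \<open>simp_all add: A.hermitian_manifold_cart\<close>)
  show ?thesis
  \<comment> \<open>\<open>\<theta>(T)\<close> is \<open>|T|^2\<close>: if it vanishes everywhere,
    so does \<open>\<theta>\<close>, which is the Kaehler case; otherwise it is a nonzero
    constant.\<close>
  proof (cases "\<exists>p. \<theta> p (T p) \<noteq> 0")
    case False
    then have z: "\<theta> p v = 0" if "v \<in> tangent_space A p" for p v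
      using B.theta_T_zero_imp[of p v] that by (simp add: A.tangent_space_cart)
    then show ?thesis
      using B.kahler_if_theta_zero herm
      by (simp add: A.cart_transfer A.eps_rho_connection_cart kahler_manifold_def A.hermitian_manifold_cart)
  next
    case True
    then obtain p0 where p0: "\<theta> p0 (T p0) \<noteq> 0" by blast
    have "(\<lambda>p. \<rho> * (real CARD('e basis_index) - 2) * \<theta> p (T p))
        = (\<lambda>p. \<rho> * (real CARD('e basis_index) - 2) * \<theta> p0 (T p0))"
      by (intro ext arg_cong2[where f="(*)"] refl B.theta_T_constant[OF par assms(2)])
    then have "B.has_divergence nabla_g T (\<lambda>p. \<rho> * (real CARD('e basis_index) - 2) * \<theta> p0 (T p0))"
      using B.has_divergence_T[OF par] by simp
    from B.constant_divergence_eq_0[OF assms(3) lc T(1) this]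
    \<comment> \<open>The divergence constant is a product whose factors \<open>n - 2\<close> and
      \<open>|T|^2\<close> are nonzero, the former because the dimension is at least 4.\<close>
    have "\<rho> = 0" using p0 assms(1) by (simp add: card_basis_index)
    then have "vaisman_manifold ?A J g"
      using B.vaisman_if_rho_zero[of \<epsilon>] par by simp
    then show ?thesis
      using \<open>\<rho> = 0\<close>
      by (auto simp: vaisman_manifold_def A.hermitian_manifold_cart A.lee_form_cart A.levi_civita_cart A.parallel_form1_cart)
  qed
qed

end
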